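(* Let $k$ be a number field and let $\mathcal E$ be a curve over $k(T)$ given by $$y^2=B(x)T+C(x),$$ where $B,C\in k[x]$, $\deg(B)\le 2$ and $\deg(C)=3$, subject to the standing assumptions stated in the context. Then $r_k=\delta_k$, where $r_k$ is the rank of $\mathcal E(k(T))$ and $\delta_k$ is the number defined in the context.
   Context: **Standing assumptions.** Write the equation as $y^2=a_3(T)x^3+a_2(T)x^2+a_1(T)x+a_0(T)$ with $a_i\in k[T]$ of degree at most $2$. It is assumed that $\Delta_{\mathrm{ell}}(T)=a_3^2(-27a_0^2a_3^2+18a_0a_1a_2a_3+a_1^2a_2^2-4a_0a_2^3-4a_1^3a_3)$ is not identically $0$, and that the $a_i(T)$ are not all multiples of $(T-c)^2$ for any $c\in\overline k$. Here $\overline k$ is a fixed algebraic closure of $k$. Under these assumptions $\mathcal E$ is regarded as an elliptic curve over $k(T)$. **$\delta_k$.** For a curve $y^2=A(x)T^2+B(x)T+C(x)$, put $\Delta_{\mathrm{conic}}(x)=B(x)^2-4A(x)C(x)$. Then $\delta_k$ is the number of $\mathrm{Gal}(\overline k/k)$-orbits $[\theta]$ of elements $\theta\in\overline k$ with $\Delta_{\mathrm{conic}}(\theta)=0$ such that either $A(\theta)$ is a nonzero square in $k(\theta)$, or $A(\theta)=0$ and $C(\theta)$ is a nonzero square in $k(\theta)$. (Here $A=0$, so $\Delta_{\mathrm{conic}}=B^2$.)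
   Formalization: The polynomial B is assumed to be nonzero (i.e. Δ_conic is not identically 0); for B = 0 the curve is constant, its rank is finite, but infinitely many Galois orbits satisfy the condition defining δ_k, so the claim fails. *)

theory Defs
  imports
    "HOL-Algebra.Algebraic_Closure_Type"
    "HOL-Algebra.Generated_Fields"
    "HOL-Computational_Algebra.Computational_Algebra"
    "HOL-Library.Extended_Nat"
begin

section \<open>Number fields\<close>

class number_field = field_char_0 +
  assumes finite_dim_over_rat:
    "\<exists>S :: 'a set. finite S \<and> (\<forall>x. \<exists>q :: 'a \<Rightarrow> rat. x = (\<Sum>s\<in>S. of_rat (q s) * s))"

instance rat :: number_field
  by intro_classes (rule exI[of _ "{1}"], auto)


section \<open>The rank of an abelian group\<close>

definition Z_independent :: "('a, 'b) monoid_scheme \<Rightarrow> 'a set \<Rightarrow> bool" where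
  "Z_independent G S \<longleftrightarrow> finite S \<and> S \<subseteq> carrier G \<and>
     (\<forall>n :: 'a \<Rightarrow> int. (\<Otimes>\<^bsub>G\<^esub>x\<in>S. x [^]\<^bsub>G\<^esub> n x) = \<one>\<^bsub>G\<^esub> \<longrightarrow> (\<forall>x\<in>S. n x = 0))"

text \<open>
  The rank takes values in \<^typ>\<open>enat\<close>, so that a group with arbitrarily large independent
  sets has rank \<open>\<infinity>\<close> rather than an unspecified natural number.
\<close>

definition group_rank :: "('a, 'b) monoid_scheme \<Rightarrow> enat" where
  "group_rank G = (SUP S\<in>{S. Z_independent G S}. enat (card S))"


section \<open>The group of points of \<open>y\<^sup>2 = f(x)\<close> for a separable cubic \<open>f\<close>\<close>

datatype 'a point = Infinity | Affine 'a 'a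

definition on_curve :: "'a::field poly \<Rightarrow> 'a point \<Rightarrow> bool" where
  "on_curve f P \<longleftrightarrow> (case P of Infinity \<Rightarrow> True | Affine x y \<Rightarrow> y\<^sup>2 = poly f x)"

text \<open>
  The chord-tangent law with neutral element the point at infinity, which is the only point at
  infinity of the projective closure and is a flex. The cubic \<open>f\<close> need not be monic: a line
  \<open>y = l * x + m\<close> meets the curve where \<open>f(x) - (l * x + m)\<^sup>2 = 0\<close>, so the \<open>x\<close>-coordinates
  of the three intersection points add up to \<open>(l\<^sup>2 - a\<^sub>2) / a\<^sub>3\<close>.
\<close>

fun point_add :: "'a::field poly \<Rightarrow> 'a point \<Rightarrow> 'a point \<Rightarrow> 'a point" where
  "point_add f Infinity Q = Q"
| "point_add f P Infinity = P"
| "point_add f (Affine x1 y1) (Affine x2 y2) =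
     (if x1 = x2 \<and> y1 = - y2 then Infinity
      else let l = (if x1 = x2 then poly (pderiv f) x1 / (2 * y1) else (y2 - y1) / (x2 - x1));
               x3 = (l\<^sup>2 - Polynomial.coeff f 2) / Polynomial.coeff f 3 - x1 - x2
           in Affine x3 (- (y1 + l * (x3 - x1))))"

definition point_group :: "'a::field poly \<Rightarrow> 'a point monoid" where
  "point_group f = \<lparr>carrier = {P. on_curve f P}, monoid.mult = point_add f, one = Infinity\<rparr>"


section \<open>The curve \<open>y\<^sup>2 = A(x) T\<^sup>2 + B(x) T + C(x)\<close>\<close>

text \<open>
  \<open>T_coeff A B C i\<close> is the polynomial \<open>a\<^sub>i(T)\<close> in the equation rewritten as
  \<open>y\<^sup>2 = a\<^sub>3(T) x\<^sup>3 + a\<^sub>2(T) x\<^sup>2 + a\<^sub>1(T) x + a\<^sub>0(T)\<close>.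
\<close>

definition T_coeff :: "'k::field poly \<Rightarrow> 'k poly \<Rightarrow> 'k poly \<Rightarrow> nat \<Rightarrow> 'k poly" where
  "T_coeff A B C i =
     [:Polynomial.coeff C i, Polynomial.coeff B i, Polynomial.coeff A i:]"

definition Delta_ell :: "'k::field poly \<Rightarrow> 'k poly \<Rightarrow> 'k poly \<Rightarrow> 'k poly" where
  "Delta_ell A B C =
     (let a0 = T_coeff A B C 0; a1 = T_coeff A B C 1; a2 = T_coeff A B C 2; a3 = T_coeff A B C 3
      in a3^2 * (- 27 * a0^2 * a3^2 + 18 * a0 * a1 * a2 * a3 + a1^2 * a2^2
                 - 4 * a0 * a2^3 - 4 * a1^3 * a3))"

definition standing_assumptions :: "'k::field poly \<Rightarrow> 'k poly \<Rightarrow> 'k poly \<Rightarrow> bool" where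
  "standing_assumptions A B C \<longleftrightarrow>
     Delta_ell A B C \<noteq> 0 \<and>
     (\<nexists>c :: 'k alg_closure. \<forall>i\<le>3. [:- c, 1:]^2 dvd map_poly to_ac (T_coeff A B C i))"

definition generic_cubic :: "'k::field poly \<Rightarrow> 'k poly \<Rightarrow> 'k poly \<Rightarrow> 'k poly fract poly" where
  "generic_cubic A B C = [:to_fract (T_coeff A B C 0), to_fract (T_coeff A B C 1),
                           to_fract (T_coeff A B C 2), to_fract (T_coeff A B C 3):]"

definition curve_rank :: "'k::field poly \<Rightarrow> 'k poly \<Rightarrow> 'k poly \<Rightarrow> enat" where
  "curve_rank A B C = group_rank (point_group (generic_cubic A B C))"


section \<open>The invariant \<open>\<delta>\<^sub>k\<close>\<close>

definition absolute_galois :: "('k::field alg_closure \<Rightarrow> 'k alg_closure) set" where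
  "absolute_galois =
     {\<sigma> \<in> ring_iso ring_of_type_algebra ring_of_type_algebra. \<forall>c. \<sigma> (to_ac c) = to_ac c}"

definition galois_orbit :: "'k::field alg_closure \<Rightarrow> 'k alg_closure set" where
  "galois_orbit \<theta> = {\<sigma> \<theta> | \<sigma>. \<sigma> \<in> absolute_galois}"

definition adjoin :: "'k::field alg_closure \<Rightarrow> 'k alg_closure set" where
  "adjoin \<theta> = generate_field ring_of_type_algebra (insert \<theta> (range to_ac))"

definition nonzero_square_in :: "'a::field set \<Rightarrow> 'a \<Rightarrow> bool" where
  "nonzero_square_in F a \<longleftrightarrow> a \<noteq> 0 \<and> (\<exists>s\<in>F. a = s\<^sup>2)"

definition Delta_conic :: "'k::field poly \<Rightarrow> 'k poly \<Rightarrow> 'k poly \<Rightarrow> 'k poly" where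
  "Delta_conic A B C = B^2 - 4 * A * C"

definition ac_eval :: "'k::field poly \<Rightarrow> 'k alg_closure \<Rightarrow> 'k alg_closure" where
  "ac_eval p \<theta> = poly (map_poly to_ac p) \<theta>"

text \<open>
  If \<open>Delta_conic A B C = 0\<close>, then the set of orbits below can be infinite and its
  cardinality is meaningless; \<open>delta\<close> is to be used for \<open>Delta_conic A B C \<noteq> 0\<close> only.
\<close>

definition delta :: "'k::field poly \<Rightarrow> 'k poly \<Rightarrow> 'k poly \<Rightarrow> nat" where
  "delta A B C = card (galois_orbit `
     {\<theta>. ac_eval (Delta_conic A B C) \<theta> = 0 \<and>
          (nonzero_square_in (adjoin \<theta>) (ac_eval A \<theta>) \<or>
           ac_eval A \<theta> = 0 \<and> nonzero_square_in (adjoin \<theta>) (ac_eval C \<theta>))})"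

end

theory Submission
  imports Defs "HOL-Library.Set_Algebras"
begin

text \<open>
  Let \<open>K\<close> be the algebraic closure of \<open>k\<close>. On the curve \<open>E: y\<^sup>2 = B(x) T + C(x)\<close> the
  parameter is a function of the coordinates, \<open>T = (y\<^sup>2 - C(x)) / B(x)\<close>; so \<open>E\<close> is the
  generic fibre of a map from the plane to the \<open>T\<close>-line which is defined outside the lines
  \<open>x = \<theta>\<close> with \<open>B(\<theta>) = 0\<close>. A curve in the plane is cut out by one polynomial, hence a point
  of \<open>E\<close> over \<open>K(T)\<close>, viewed as a curve in the plane, is cut out by a function on \<open>E\<close> whose
  other zeros lie on those lines. Therefore the group of points over \<open>K(T)\<close> is spanned, up to
  torsion, by the vertical points \<open>P\<^sub>\<theta> = (\<theta>, sqrt (C(\<theta>)))\<close> (\<open>vertical_points_span\<close>). They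
  are \<open>2\<close>-torsion if \<open>C(\<theta>) = 0\<close>. Those with \<open>C(\<theta>) \<noteq> 0\<close> are independent
  (\<open>vertical_points_independent\<close>): a relation between them is the divisor of some
  \<open>p(x) + q(x) y\<close> whose norm \<open>p\<^sup>2 - (B T + C) q\<^sup>2\<close> is, up to a factor in \<open>K(T)\<close>, a polynomial
  in \<open>x\<close> over \<open>K\<close>. For each value \<open>t\<close> of \<open>T\<close> the cubic \<open>t B + C\<close> has odd degree, which
  makes that factor constant after division by common factors, and then the parity of the degree
  in \<open>T\<close> forces \<open>q = 0\<close> (\<open>rigidity\<close>). So the relation is the divisor of a polynomial in
  \<open>x\<close>, which vanishes equally at \<open>P\<^sub>\<theta>\<close> and \<open>-P\<^sub>\<theta>\<close>.

  Divisors are handled as ideals: a point gives a maximal ideal of the coordinate ring, and its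
  ideal class determines it. Collinear points have a principal product of ideals, so the chord-tangent
  law is multiplication of ideal classes; this yields the group law (\<open>comm_group_EE\<close>) as well
  as the dictionary between relations of points and functions (\<open>function_relation\<close>,
  \<open>no_relation\<close>).

  The absolute Galois group permutes the points \<open>P\<^sub>\<theta>\<close> up to sign. In an invariant
  combination the coefficient of \<open>P\<^sub>\<theta>\<close> vanishes if some automorphism fixes \<open>\<theta>\<close> and negates the
  square root of \<open>C(\<theta>)\<close>, that is, if \<open>C(\<theta>)\<close> is not a square in \<open>k(\<theta>)\<close>; otherwise the points
  over the orbit of \<open>\<theta>\<close> can be given compatible signs, and their sum is defined over
  \<open>k(T)\<close>. As \<open>deg B \<le> 2\<close>, either the roots of \<open>B\<close> lie in \<open>k\<close> (\<open>rank_rational_roots\<close>)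
  or \<open>B\<close> has two conjugate roots (\<open>rank_conjugate_squares\<close>, \<open>rank_zero\<close>). In each case the
  rank is the number of orbits on which \<open>C\<close> takes nonzero square values.
\<close>

section \<open>Polynomials: parity of degrees and products of linear factors\<close>

declare set_one [simp del]

abbreviation linear_factors :: "'a::comm_ring_1 multiset \<Rightarrow> 'a poly" where
  "linear_factors A \<equiv> \<Prod>a\<in>#A. [:- a, 1:]"

lemma odd_times_square_not_square:
  fixes u v w :: "'a::idom poly"
  assumes "u\<^sup>2 = w * v\<^sup>2" "odd (degree w)"
  shows "u = 0 \<and> v = 0"
proof (rule ccontr)
  assume "\<not> ?thesis"
  then have nz: "u \<noteq> 0" "v \<noteq> 0" "w \<noteq> 0" using assms by auto
  then have "2 * degree u = degree w + 2 * degree v"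
    using arg_cong[OF assms(1), of degree] by (simp add: degree_mult_eq degree_power_eq)
  then show False using assms(2) by presburger
qed

lemma degree_le_square_minus_odd:
  fixes u v :: "'a::idom poly"
  assumes "odd (degree v)"
  shows "degree v \<le> degree (u\<^sup>2 - v)"
proof -
  have "degree (u\<^sup>2) = 2 * degree u"
    by (cases "u = 0") (auto simp: degree_power_eq)
  then have "even (degree (u\<^sup>2))" by simp
  with assms have "degree (u\<^sup>2) \<noteq> degree v" by metis
  then show ?thesis
    using degree_add_eq_left[of "- v" "u\<^sup>2"] degree_add_eq_right[of "u\<^sup>2" "- v"]
    by (cases rule: linorder_cases[of "degree (u\<^sup>2)" "degree v"]) auto
qed

text \<open>
  Unique factorization restricted to linear factors, so that it holds over every field.
\<close>

lemma dvd_prod_linear_factors: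
  fixes n :: "'a::field poly"
  assumes "n dvd smult c (linear_factors A)" and "c \<noteq> 0"
  shows "\<exists>c' A'. c' \<noteq> 0 \<and> A' \<subseteq># A \<and> n = smult c' (linear_factors A')"
  using assms(1)
proof (induction A arbitrary: n)
  case empty
  then have "n dvd [:c:]" by simp
  then obtain k where k: "[:c:] = n * k" ..
  with assms(2) have "n \<noteq> 0" "k \<noteq> 0" by auto
  then have "degree n + degree k = 0"
    using k assms(2) by (metis degree_mult_eq degree_pCons_0)
  then obtain c' where "n = [:c':]" by (meson add_is_0 degree_eq_zeroE)
  with \<open>n \<noteq> 0\<close> show ?case by (intro exI[of _ c'] exI[of _ "{#}"]) auto
next
  case (add a A)
  let ?m = "smult c (linear_factors A)"
  obtain k where k: "[:- a, 1:] * ?m = n * k"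
    using add.prems by (auto simp: dvd_def)
  show ?case
  proof (cases "poly n a = 0")
    case True
    then obtain n' where n': "n = [:- a, 1:] * n'" by (auto simp: poly_eq_0_iff_dvd)
    then have "[:- a, 1:] * ?m = [:- a, 1:] * (n' * k)" using k by (simp only: mult.assoc)
    then have "?m = n' * k" by (subst (asm) mult_cancel_left) auto
    then have "n' dvd ?m" by simp
    from add.IH[OF this] obtain c' A' where
      "c' \<noteq> 0" "A' \<subseteq># A" "n' = smult c' (linear_factors A')" by blast
    then show ?thesis unfolding n'
      by (intro exI[of _ c'] exI[of _ "add_mset a A'"]) auto
  next
    case False
    have "poly (n * k) a = 0" unfolding k[symmetric] by simp
    then have "poly k a = 0" using False by simp
    then obtain k' where k': "k = [:- a, 1:] * k'" by (auto simp: poly_eq_0_iff_dvd)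
    then have "[:- a, 1:] * ?m = [:- a, 1:] * (n * k')" using k by (simp only: ac_simps)
    then have "?m = n * k'" by (subst (asm) mult_cancel_left) auto
    then have "n dvd ?m" by simp
    from add.IH[OF this] obtain c' A' where
      "c' \<noteq> 0" "A' \<subseteq># A" "n = smult c' (linear_factors A')" by blast
    moreover have "A' \<subseteq># add_mset a A"
      using \<open>A' \<subseteq># A\<close> by (metis add_mset_add_single mset_subset_eq_add_left subset_mset.order_trans)
    ultimately show ?thesis by blast
  qed
qed

section \<open>The coordinate ring of the affine curve\<close>

text \<open>
  The function field of the curve is realized inside an algebraic closure of the rational function
  field in \<open>x\<close>, where a square root of \<open>f\<close> exists. Ideals then become subsets of a field.
\<close>

definition emb :: "'a::field poly \<Rightarrow> 'a poly fract alg_closure" where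
  "emb p = to_ac (to_fract p)"

lemma emb_simps [simp]:
  "emb 0 = 0" "emb 1 = 1" "emb (p + q) = emb p + emb q" "emb (p - q) = emb p - emb q"
  "emb (- p) = - emb p" "emb (p * q) = emb p * emb q" "emb (p ^ n) = emb p ^ n"
  by (induction n) (simp_all add: emb_def)

lemma emb_eq_iff [simp]: "emb p = emb q \<longleftrightarrow> p = q"
  by (simp add: emb_def)

lemma emb_eq_0_iff [simp]: "emb p = 0 \<longleftrightarrow> p = 0"
  by (simp add: emb_def)

locale cubic_curve =
  fixes f :: "'a::field poly"
  assumes degree_f: "degree f = 3"
    and two_nonzero: "(2::'a) \<noteq> 0"
    and nonsingular: "\<And>a. poly f a = 0 \<Longrightarrow> poly (pderiv f) a \<noteq> 0"
begin

definition yy :: "'a poly fract alg_closure" where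
  "yy = (SOME y. y\<^sup>2 = emb f)"

lemma yy_square: "yy\<^sup>2 = emb f"
proof -
  have "\<exists>y. y\<^sup>2 = emb f"
    using nth_root_exists[of 2 "emb f"] by auto
  then show ?thesis unfolding yy_def by (rule someI_ex)
qed

text \<open>
  The function \<open>p(x) + q(x) y\<close>.
\<close>

definition fn :: "'a poly \<Rightarrow> 'a poly \<Rightarrow> 'a poly fract alg_closure" where
  "fn p q = emb p + emb q * yy"

lemma fn_simps:
  "fn p q + fn r s = fn (p + r) (q + s)" "fn p q - fn r s = fn (p - r) (q - s)"
  "- fn p q = fn (- p) (- q)" "fn p q * fn r s = fn (p * r + f * q * s) (p * s + q * r)"
  using yy_square by (auto simp: fn_def algebra_simps power2_eq_square)

lemma norm_zero_imp: "p\<^sup>2 = f * q\<^sup>2 \<Longrightarrow> p = 0 \<and> q = 0"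
  using odd_times_square_not_square[of p f q] degree_f by simp

text \<open>
  The norm of a function is a polynomial, and \<open>p\<^sup>2 = f q\<^sup>2\<close> has no nonzero solution because \<open>f\<close>
  has odd degree.
\<close>

lemma fn_eq_0_iff: "fn p q = 0 \<longleftrightarrow> p = 0 \<and> q = 0"
proof
  assume "fn p q = 0"
  then have "fn p q * fn p (- q) = 0" by simp
  then have "fn (p\<^sup>2 - f * q\<^sup>2) 0 = 0" unfolding fn_simps by (simp add: power2_eq_square algebra_simps)
  then have "emb (p\<^sup>2 - f * q\<^sup>2) = 0" unfolding fn_def by simp
  then have "p\<^sup>2 - f * q\<^sup>2 = 0" by (simp only: emb_eq_0_iff)
  then show "p = 0 \<and> q = 0" by (intro norm_zero_imp) simp
qed (simp add: fn_def)

lemma fn_eq_iff: "fn p q = fn r s \<longleftrightarrow> p = r \<and> q = s"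
  using fn_eq_0_iff[of "p - r" "q - s"] by (simp add: fn_simps(2)[symmetric])

definition S :: "'a poly fract alg_closure set" where
  "S = {fn p q | p q. True}"

lemma fn_in_S [simp, intro]: "fn p q \<in> S"
  by (auto simp: S_def)

lemma S_cases: assumes "u \<in> S" obtains p q where "u = fn p q"
  using assms by (auto simp: S_def)

lemma emb_conv_fn: "emb p = fn p 0" and yy_conv_fn: "yy = fn 0 1"
  by (auto simp: fn_def)

lemma emb_in_S [simp, intro]: "emb p \<in> S" and yy_in_S [simp, intro]: "yy \<in> S"
  unfolding emb_conv_fn yy_conv_fn by auto

lemma S_closed [simp, intro]:
  "u \<in> S \<Longrightarrow> v \<in> S \<Longrightarrow> u + v \<in> S" "u \<in> S \<Longrightarrow> v \<in> S \<Longrightarrow> u - v \<in> S"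
  "u \<in> S \<Longrightarrow> v \<in> S \<Longrightarrow> u * v \<in> S" "u \<in> S \<Longrightarrow> - u \<in> S" "0 \<in> S" "1 \<in> S"
  using emb_in_S[of 0] emb_in_S[of 1] by (simp_all add: S_def) (metis fn_simps)+

text \<open>
  The norm of \<open>p + q y\<close> down to the polynomials in \<open>x\<close>.
\<close>

definition Norm :: "'a poly \<Rightarrow> 'a poly \<Rightarrow> 'a poly" where
  "Norm p q = p\<^sup>2 - f * q\<^sup>2"

lemma Norm_eq_0_iff [simp]: "Norm p q = 0 \<longleftrightarrow> p = 0 \<and> q = 0"
  using norm_zero_imp[of p q] by (auto simp: Norm_def)

lemma Norm_mult: assumes "fn p q * fn r s = fn u v" shows "Norm p q * Norm r s = Norm u v"
proof -
  have uv: "u = p * r + f * q * s" "v = p * s + q * r"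
    using assms unfolding fn_simps fn_eq_iff by simp_all
  show ?thesis unfolding uv Norm_def by (simp add: power2_eq_square algebra_simps)
qed

lemma fn_mult_conj: "fn p q * fn p (- q) = emb (Norm p q)"
  unfolding fn_simps emb_conv_fn fn_eq_iff by (simp add: Norm_def power2_eq_square)

section \<open>Ideal classes\<close>

text \<open>
  The submodule over the coordinate ring generated by a set.
\<close>

inductive_set lat :: "'a poly fract alg_closure set \<Rightarrow> 'a poly fract alg_closure set"
  for G where
  lat_0: "0 \<in> lat G"
| lat_step: "s \<in> S \<Longrightarrow> g \<in> G \<Longrightarrow> u \<in> lat G \<Longrightarrow> s * g + u \<in> lat G"

lemma lat_incl: "g \<in> G \<Longrightarrow> g \<in> lat G"
  using lat_step[of 1 g G 0] lat_0 by simp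

lemma lat_add: "u \<in> lat G \<Longrightarrow> v \<in> lat G \<Longrightarrow> u + v \<in> lat G"
  by (induction u rule: lat.induct) (auto simp: add.assoc intro: lat_step)

lemma lat_scale: "u \<in> lat G \<Longrightarrow> s \<in> S \<Longrightarrow> s * u \<in> lat G"
proof (induction rule: lat.induct)
  case lat_0 then show ?case by (simp add: lat.lat_0)
next
  case (lat_step t g u)
  then have "(s * t) * g + s * u \<in> lat G" by (intro lat.lat_step) auto
  then show ?case by (simp add: algebra_simps)
qed

lemma lat_uminus: "u \<in> lat G \<Longrightarrow> - u \<in> lat G"
  using lat_scale[of u G "-1"] by simp

lemma lat_diff: "u \<in> lat G \<Longrightarrow> v \<in> lat G \<Longrightarrow> u - v \<in> lat G"
  using lat_add[of u G "-v"] lat_uminus[of v G] by simp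

lemma lat_min:
  assumes "G \<subseteq> lat H" shows "lat G \<subseteq> lat H"
proof
  fix u assume "u \<in> lat G"
  then show "u \<in> lat H"
  proof induction
    case (lat_step s g u)
    then show ?case using assms by (intro lat_add lat_scale) auto
  qed (rule lat_0)
qed

lemma lat_eqI: "G \<subseteq> lat H \<Longrightarrow> H \<subseteq> lat G \<Longrightarrow> lat G = lat H"
  using lat_min by blast

text \<open>
  Products of ideals are computed on generators: the elementwise product of two generating sets
  generates the product ideal. Sets under elementwise multiplication form a commutative monoid, which
  makes associativity and commutativity of the product of ideals available at once.
\<close>

lemma lat_times: "lat (lat G * H) = lat (G * H)"
proof (rule lat_eqI)
  have "u * h \<in> lat (G * H)" if "u \<in> lat G" "h \<in> H" for u h
    using that(1)
  proof induction
    case (lat_step s g u)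
    then have "s * (g * h) + u * h \<in> lat (G * H)"
      using that(2) by (intro lat.lat_step) (auto intro: set_times_intro)
    then show ?case by (simp add: algebra_simps)
  qed (auto intro: lat_0)
  then show "lat G * H \<subseteq> lat (G * H)" by (auto simp: set_times_def)
  show "G * H \<subseteq> lat (lat G * H)"
    by (intro subset_trans[OF set_times_mono2[of G "lat G" H H]]) (auto intro: lat_incl)
qed

lemma lat_times_cong: "lat G = lat G' \<Longrightarrow> lat (G * H) = lat (G' * H)"
  by (metis lat_times)

lemma lat_singleton: "lat {g} = {s * g | s. s \<in> S}"
proof -
  have "u \<in> {s * g | s. s \<in> S}" if "u \<in> lat {g}" for u
    using that
  proof induction
    case lat_0 then show ?case by (auto intro!: exI[of _ 0])
  next
    case (lat_step s h u)
    then obtain t where "u = t * g" "t \<in> S" by auto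
    with lat_step show ?case by (auto intro!: exI[of _ "s + t"] simp: algebra_simps)
  qed
  then show ?thesis using lat_scale lat_incl by blast
qed

lemma lat_subset_S: "G \<subseteq> S \<Longrightarrow> lat G \<subseteq> S"
  using lat_min[of G "{1}"] by (simp add: lat_singleton)

text \<open>
  Generating sets are equivalent if their ideals differ by a nonzero scalar of the function field.
\<close>

definition equivalent :: "'a poly fract alg_closure set \<Rightarrow> 'a poly fract alg_closure set \<Rightarrow> bool"
    (infix "\<approx>" 50) where
  "G \<approx> H \<longleftrightarrow> (\<exists>c. c \<noteq> 0 \<and> lat G = lat ({c} * H))"

lemma equivalent_lat: "lat G = lat H \<Longrightarrow> G \<approx> H"
  unfolding equivalent_def by (intro exI[of _ 1]) (simp flip: set_one)

lemma equivalent_refl [simp, intro]: "G \<approx> G"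
  by (rule equivalent_lat) simp

lemma equivalent_trans [trans]: assumes "G \<approx> H" "H \<approx> K" shows "G \<approx> K"
proof -
  obtain c d where c: "c \<noteq> 0" "lat G = lat ({c} * H)" and d: "d \<noteq> 0" "lat H = lat ({d} * K)"
    using assms by (auto simp: equivalent_def)
  have "lat G = lat (H * {c})" using c(2) by (simp only: mult.commute)
  also have "\<dots> = lat ({d} * K * {c})" by (rule lat_times_cong[OF d(2)])
  also have "{d} * K * {c} = ({c} * {d}) * K" by (simp only: ac_simps)
  also have "{c} * {d} = {c * d}" by (auto simp: set_times_def)
  finally show ?thesis using c d by (auto simp: equivalent_def intro!: exI[of _ "c * d"])
qed

lemma equivalent_sym: assumes "G \<approx> H" shows "H \<approx> G"
proof -
  obtain c where c: "c \<noteq> 0" "lat G = lat ({c} * H)"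
    using assms by (auto simp: equivalent_def)
  have "lat ({inverse c} * G) = lat (G * {inverse c})" by (simp only: mult.commute)
  also have "\<dots> = lat ({c} * H * {inverse c})" by (rule lat_times_cong[OF c(2)])
  also have "{c} * H * {inverse c} = ({c} * {inverse c}) * H" by (simp only: ac_simps)
  also have "{c} * {inverse c} = 1" using c by (auto simp: set_times_def set_one)
  finally have "lat H = lat ({inverse c} * G)" by simp
  then show ?thesis using c unfolding equivalent_def by (intro exI[of _ "inverse c"]) simp
qed

lemma equivalent_times_right: assumes "G \<approx> H" shows "G * K \<approx> H * K"
proof -
  obtain c where c: "c \<noteq> 0" "lat G = lat ({c} * H)"
    using assms by (auto simp: equivalent_def)
  then show ?thesis using lat_times_cong[OF c(2), of K] by (auto simp: equivalent_def mult.assoc)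
qed

lemma equivalent_times: "G \<approx> H \<Longrightarrow> G' \<approx> H' \<Longrightarrow> G * G' \<approx> H * H'"
  by (metis equivalent_times_right equivalent_trans mult.commute)

lemma equivalent_singleton: "g \<noteq> 0 \<Longrightarrow> {g} \<approx> 1"
  unfolding equivalent_def by (intro exI[of _ g]) simp


section \<open>The maximal ideals of points\<close>

definition on :: "'a \<Rightarrow> 'a \<Rightarrow> bool" where
  "on a b \<longleftrightarrow> b\<^sup>2 = poly f a"

text \<open>
  Generators of the maximal ideal of functions that vanish at a point.
\<close>

fun gen :: "'a point \<Rightarrow> 'a poly fract alg_closure set" where
  "gen Infinity = 1"
| "gen (Affine a b) = {emb [:- a, 1:], yy - emb [:b:]}"

fun neg :: "'a point \<Rightarrow> 'a point" where
  "neg Infinity = Infinity"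
| "neg (Affine a b) = Affine a (- b)"

lemma lat_linear_combination:
  assumes "u \<in> lat G" "v \<in> lat G"
  shows "emb p * u + emb q * v \<in> lat G"
  using assms by (intro lat_add lat_scale) auto

text \<open>
  The ideal \<open>(U, y - V)\<close> with \<open>U\<close> dividing \<open>V\<^sup>2 - f\<close> represents the zeros of \<open>U\<close> lifted to
  the curve by \<open>y = V\<close>. One linear factor of \<open>U\<close> splits off as the ideal of a point. The
  product contains \<open>y - V\<close> times \<open>x - a\<close>, times \<open>U\<close> and times \<open>2 V(a)\<close>; these three have no
  common zero, because a point \<open>(a, 0)\<close> where \<open>U\<close> also vanishes would be singular.
\<close>

lemma lat_split_linear:
  fixes a :: 'a and U V w :: "'a poly"
  assumes U: "V\<^sup>2 - f = [:- a, 1:] * U * w"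
  shows "lat (gen (Affine a (poly V a)) * {emb U, yy - emb V}) = lat {emb ([:- a, 1:] * U), yy - emb V}"
    (is "lat ?L = lat ?R")
proof -
  define l where "l = [:- a, 1:]"
  define b where "b = poly V a"
  note U = U[folded l_def]
  have l_a [simp]: "poly l a = 0" by (simp add: l_def)
  have dvd_l: "l dvd p" if "poly p a = 0" for p
    using that by (simp add: poly_eq_0_iff_dvd l_def)
  have root: "poly f a = b\<^sup>2"
    using arg_cong[OF U, of "\<lambda>p. poly p a"] by (simp add: b_def)
  have "l dvd V - [:b:]" by (rule dvd_l) (simp add: b_def)
  then obtain V' where V': "V = [:b:] + l * V'" by (metis dvdE diff_eq_eq add.commute)
  have sq: "(yy - emb V) * (yy - emb V) = - emb 2 * emb V * (yy - emb V) - emb (l * U) * emb w"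
  proof -
    have "emb (l * U) * emb w = emb (V\<^sup>2 - f)" unfolding U by simp
    also have "\<dots> = (emb V)\<^sup>2 - yy\<^sup>2" by (simp add: yy_square)
    finally have *: "emb (l * U) * emb w = (emb V)\<^sup>2 - yy\<^sup>2" .
    have "emb 2 = (2 :: 'a poly fract alg_closure)" by (metis emb_simps(2,3) one_add_one)
    then show ?thesis unfolding * by (simp add: power2_eq_square algebra_simps)
  qed
  have e2: "emb 2 = (2 :: 'a poly fract alg_closure)" by (metis emb_simps(2,3) one_add_one)
  have y: "yy - emb [:b:] = (yy - emb V) + emb l * emb V'"
    by (subst V') simp
  have L: "?L = {emb l * emb U, emb l * (yy - emb V), (yy - emb [:b:]) * emb U, (yy - emb [:b:]) * (yy - emb V)}"
    by (auto simp: set_times_def l_def b_def)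
  have R1: "emb (l * U) \<in> lat ?R" and R2: "yy - emb V \<in> lat ?R"
    by (auto intro: lat_incl simp: l_def simp del: mult_pCons_left)
  have "(yy - emb [:b:]) * emb U = emb V' * emb (l * U) + emb U * (yy - emb V)"
    unfolding y by (simp add: algebra_simps)
  also have "\<dots> \<in> lat ?R" using R1 R2 by (intro lat_add lat_scale) auto
  finally have R3: "(yy - emb [:b:]) * emb U \<in> lat ?R" .
  have R4: "(yy - emb [:b:]) * (yy - emb V) \<in> lat ?R" using R2 by (intro lat_scale) auto
  have R5: "emb l * emb U \<in> lat ?R" using R1 by simp
  have R6: "emb l * (yy - emb V) \<in> lat ?R" using R2 by (intro lat_scale) auto
  have 1: "?L \<subseteq> lat ?R" unfolding L using R3 R4 R5 R6 by blast
  have L1: "emb l * emb U \<in> lat ?L" and L2: "emb l * (yy - emb V) \<in> lat ?L"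
    and L3: "(yy - emb [:b:]) * emb U \<in> lat ?L" and L4: "(yy - emb [:b:]) * (yy - emb V) \<in> lat ?L"
    unfolding L by (auto intro!: lat_incl)
  have M3: "emb U * (yy - emb V) \<in> lat ?L"
  proof -
    have "emb U * (yy - emb V) = (yy - emb [:b:]) * emb U - emb V' * (emb l * emb U)"
      unfolding y by (simp add: algebra_simps)
    then show ?thesis using L1 L3 by (auto intro!: lat_diff lat_scale)
  qed
  \<comment> \<open>The factor \<open>2 b\<close> arises from \<open>(y - V)\<^sup>2 = - 2 V (y - V) - (V\<^sup>2 - f)\<close> and \<open>V(a) = b\<close>.\<close>
  have M4: "emb [:2 * b:] * (yy - emb V) \<in> lat ?L"
  proof -
    have b2: "[:2 * b:] = 2 * V - 2 * l * V'" by (subst V') (simp add: algebra_simps numeral_poly)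
    have "emb [:2 * b:] * (yy - emb V) = emb V' * (emb l * (yy - emb V)) - emb w * (emb l * emb U)
        - emb 2 * emb V' * (emb l * (yy - emb V)) - (yy - emb [:b:]) * (yy - emb V)"
      unfolding b2 y using sq e2 by (simp add: algebra_simps)
    moreover have "emb V' * (emb l * (yy - emb V)) - emb w * (emb l * emb U)
        - emb 2 * emb V' * (emb l * (yy - emb V)) - (yy - emb [:b:]) * (yy - emb V) \<in> lat ?L"
      by (rule lat_diff[OF lat_diff[OF lat_diff[OF lat_scale[OF L2] lat_scale[OF L1]] lat_scale[OF L2]] L4]) auto
    ultimately show ?thesis by simp
  qed
  have "yy - emb V \<in> lat ?L"
  proof (cases "b = 0 \<and> poly U a = 0")
    case False
    have "\<exists>p q c. p * l + q * U + [:c * (2 * b):] = 1"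
    proof (cases "b = 0")
      case True
      with False have Ua: "poly U a \<noteq> 0" by simp
      have "l dvd 1 - smult (1 / poly U a) U" by (rule dvd_l) (use Ua in simp)
      then obtain p where "1 - smult (1 / poly U a) U = l * p" by blast
      then have "p * l + [:1 / poly U a:] * U + [:0 * (2 * b):] = 1"
        by (simp add: algebra_simps)
      then show ?thesis by blast
    next
      case False
      then have "0 * l + 0 * U + [:(1 / (2 * b)) * (2 * b):] = 1"
        using two_nonzero by (simp add: one_pCons)
      then show ?thesis by blast
    qed
    then obtain p q c where pqc: "p * l + q * U + [:c * (2 * b):] = 1" by blast
    have "yy - emb V = emb (p * l + q * U + [:c:] * [:2 * b:]) * (yy - emb V)"
    proof -
      have "[:c:] * [:2 * b:] = [:c * (2 * b):]" by simp
      then show ?thesis by (simp only: pqc emb_simps(2) mult_1)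
    qed
    also have "\<dots> = emb p * (emb l * (yy - emb V)) + emb q * (emb U * (yy - emb V))
       + emb [:c:] * (emb [:2 * b:] * (yy - emb V))"
      by (simp only: emb_simps algebra_simps)
    also have "\<dots> \<in> lat ?L"
      by (rule lat_add[OF lat_add[OF lat_scale[OF L2] lat_scale[OF M3]] lat_scale[OF M4]]) auto
    finally show ?thesis .
  next
    case True
    then obtain U' where U': "U = l * U'" using dvd_l by blast
    from True V' have "f = l * (l * V'\<^sup>2 - l * U' * w)"
      using U unfolding U' by (simp add: algebra_simps power2_eq_square)
    then have "poly f a = 0" "poly (pderiv f) a = 0"
      by (auto simp: pderiv_mult)
    then show ?thesis using nonsingular by blast
  qed
  then have "?R \<subseteq> lat ?L" using L1 by (simp add: l_def del: mult_pCons_left)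
  with 1 show ?thesis by (rule lat_eqI)
qed


lemma lat_one: "lat 1 = S"
  by (simp add: set_one lat_singleton)

text \<open>
  The ideals of a point and of its negative have as product the ideal of the vertical line through
  them: the product is generated by \<open>x - a\<close> times \<open>x - a\<close>, \<open>2 b\<close> and \<open>(f - b\<^sup>2) / (x - a)\<close>, which
  have no common zero by nonsingularity.
\<close>

lemma lat_mult_neg:
  assumes "on a b"
  shows "lat (gen (Affine a b) * gen (Affine a (- b))) = lat {emb [:- a, 1:]}"
proof -
  define l where "l = [:- a, 1:]"
  have dvd_l: "l dvd p" if "poly p a = 0" for p
    using that by (simp add: poly_eq_0_iff_dvd l_def)
  have "l dvd f - [:b\<^sup>2:]" by (rule dvd_l) (use assms in \<open>simp add: on_def\<close>)
  then obtain f1 where f1: "f - [:b\<^sup>2:] = l * f1" by blast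
  let ?b = "emb [:b:]"
  have nb: "emb [:- b:] = - ?b" by (metis emb_simps(5) minus_pCons minus_zero)
  have bb: "?b * ?b = emb [:b\<^sup>2:]" by (simp flip: emb_simps add: power2_eq_square)
  have e4: "(yy - ?b) * (yy + ?b) = emb l * emb f1"
  proof -
    have "(yy - ?b) * (yy + ?b) = yy\<^sup>2 - ?b * ?b" by (simp add: algebra_simps power2_eq_square)
    also have "\<dots> = emb (f - [:b\<^sup>2:])" by (simp add: yy_square bb)
    finally show ?thesis unfolding f1 by simp
  qed
  have L: "gen (Affine a b) * gen (Affine a (- b))
      = {emb l * emb l, emb l * (yy + ?b), (yy - ?b) * emb l, emb l * emb f1}" (is "?L = _")
    by (auto simp: set_times_def l_def[symmetric] nb e4)
  show ?thesis
  proof (rule lat_eqI)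
    have "emb l \<in> lat {emb l}" by (rule lat_incl) simp
    then have "s * emb l \<in> lat {emb l}" if "s \<in> S" for s using that by (rule lat_scale)
    from this[of "emb l"] this[of "yy + ?b"] this[of "yy - ?b"] this[of "emb f1"]
    show "?L \<subseteq> lat {emb [:- a, 1:]}"
      unfolding L l_def[symmetric] by (auto simp: mult.commute)
    have L1: "emb l * emb l \<in> lat ?L" and L2: "emb l * (yy + ?b) \<in> lat ?L"
      and L3: "(yy - ?b) * emb l \<in> lat ?L" and L4: "emb l * emb f1 \<in> lat ?L"
      unfolding L by (auto intro!: lat_incl)
    have "emb l \<in> lat ?L"
    proof (cases "b = 0")
      case False
      have "[:1 / (2 * b):] * ([:b:] + [:b:]) = 1" using False two_nonzero by (simp add: one_pCons field_simps)
      then have *: "emb [:1 / (2 * b):] * (?b + ?b) = 1" by (metis emb_simps(2,3,6))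
      have "emb l = (emb [:1 / (2 * b):] * (?b + ?b)) * emb l" by (simp only: * mult_1)
      also have "\<dots> = emb [:1 / (2 * b):] * (emb l * (yy + ?b) - (yy - ?b) * emb l)"
        by (simp only: algebra_simps)
      also have "\<dots> \<in> lat ?L" by (rule lat_scale[OF lat_diff[OF L2 L3]]) auto
      finally show ?thesis .
    next
      case True
      then have f: "f = l * f1" using f1 by simp
      have "poly f a = 0" using assms True by (simp add: on_def)
      then have "poly (pderiv f) a \<noteq> 0" by (rule nonsingular)
      moreover have "pderiv f = l * pderiv f1 + f1 * pderiv l" using f pderiv_mult by metis
      moreover have "poly l a = 0" "poly (pderiv l) a = 1" by (simp_all add: l_def pderiv_pCons)
      ultimately have nz: "poly f1 a \<noteq> 0" by simp
      have "l dvd 1 - smult (1 / poly f1 a) f1" by (rule dvd_l) (use nz in simp)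
      then obtain p where p: "1 - smult (1 / poly f1 a) f1 = l * p" by blast
      have "l = p * (l * l) + [:1 / poly f1 a:] * (l * f1)"
      proof -
        have "1 = l * p + [:1 / poly f1 a:] * f1" using p by (simp add: algebra_simps)
        then have "l * 1 = l * (l * p + [:1 / poly f1 a:] * f1)" by (rule arg_cong)
        then show ?thesis by (simp add: algebra_simps)
      qed
      then have "emb l = emb p * (emb l * emb l) + emb [:1 / poly f1 a:] * (emb l * emb f1)"
        by (metis emb_simps(3,6))
      also have "\<dots> \<in> lat ?L" by (rule lat_linear_combination[OF L1 L4])
      finally show ?thesis .
    qed
    then show "{emb [:- a, 1:]} \<subseteq> lat ?L" by (simp add: l_def)
  qed
qed

lemma lat_split:
  assumes "V\<^sup>2 - f = smult c (linear_factors A) * w" "c \<noteq> 0"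
  shows "lat {emb (smult c (linear_factors A)), yy - emb V}
       = lat (\<Prod>a\<in>#A. gen (Affine a (poly V a)))"
  using assms(1)
proof (induction A arbitrary: w)
  case empty
  have "emb [:1 / c:] * emb [:c:] = emb ([:1 / c:] * [:c:])" by (simp only: emb_simps)
  also have "\<dots> = 1" using assms(2) by (simp flip: one_pCons)
  finally have *: "emb [:1 / c:] * emb [:c:] = 1" .
  have "emb [:c:] \<in> lat {emb [:c:], yy - emb V}" by (rule lat_incl) simp
  from lat_scale[OF this, of "emb [:1 / c:]"] have "1 \<in> lat {emb [:c:], yy - emb V}"
    by (simp add: *)
  then have "lat {emb [:c:], yy - emb V} = lat 1"
    by (intro lat_eqI) (simp_all add: lat_one, simp add: set_one)
  then show ?case by simp
next
  case (add a A)
  let ?U = "smult c (linear_factors A)"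
  have U: "smult c (linear_factors (add_mset a A)) = [:- a, 1:] * ?U"
    by (simp only: image_mset_add_mset prod_mset.add_mset mult_smult_right)
  have eq: "V\<^sup>2 - f = [:- a, 1:] * ?U * w" using add.prems unfolding U .
  then have "V\<^sup>2 - f = ?U * ([:- a, 1:] * w)" by (simp only: ac_simps)
  note IH = add.IH[OF this]
  have "lat {emb ([:- a, 1:] * ?U), yy - emb V} = lat (gen (Affine a (poly V a)) * {emb ?U, yy - emb V})"
    by (rule lat_split_linear[OF eq, symmetric])
  also have "\<dots> = lat ((\<Prod>a\<in>#A. gen (Affine a (poly V a))) * gen (Affine a (poly V a)))"
    unfolding mult.commute[of "gen _"] by (rule lat_times_cong[OF IH])
  finally show ?case unfolding U by (simp add: mult.commute)
qed

lemma bezout_linear_factors: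
  fixes q :: "'a poly"
  assumes "\<And>a. a \<in># A \<Longrightarrow> poly q a \<noteq> 0"
  shows "\<exists>r s. r * q + s * (linear_factors A) = 1"
  using assms
proof (induction A)
  case empty
  show ?case by (intro exI[of _ 0] exI[of _ 1]) simp
next
  case (add a A)
  then obtain r s where rs: "r * q + s * (linear_factors A) = 1" by force
  let ?l = "[:- a, 1:]" and ?P = "\<Prod>a\<in>#A. [:- a, 1:]" and ?c = "[:1 / poly q a:]"
  have "poly (1 - ?c * q) a = 0" using add.prems[of a] by simp
  then obtain v where v: "1 - ?c * q = ?l * v" unfolding poly_eq_0_iff_dvd by blast
  then have 1: "?c * q + v * ?l = 1" by (simp only: algebra_simps diff_eq_eq)
  have "1 = (r * q + s * ?P) * (?c * q + v * ?l)" unfolding rs 1 by simp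
  also have "\<dots> = (r * (?c * q + v * ?l) + s * ?P * ?c) * q + (s * v) * (?l * ?P)"
    by (simp only: algebra_simps)
  finally have "(r * (?c * q + v * ?l) + s * ?P * ?c) * q + (s * v) * (linear_factors (add_mset a A)) = 1"
    by (simp only: image_mset_add_mset prod_mset.add_mset)
  then show ?case by blast
qed

text \<open>
  If a function is divisible by no linear factor of its norm, then modulo the norm it is a unit
  times \<open>y - V\<close> for some polynomial \<open>V\<close>, and its ideal is \<open>(N, y - V)\<close>. So its divisor consists
  of one point over each root of the norm.
\<close>

lemma lat_fn:
  assumes N: "Norm p q = smult c (linear_factors A)" and c: "c \<noteq> 0"
    and nd: "\<And>a. a \<in># A \<Longrightarrow> poly p a \<noteq> 0 \<or> poly q a \<noteq> 0"
  shows "\<exists>V. (\<forall>a\<in>#A. poly q a \<noteq> 0 \<and> poly V a = - poly p a / poly q a \<and> on a (poly V a)) \<and>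
           lat {fn p q} = lat (\<Prod>a\<in>#A. gen (Affine a (poly V a)))"
proof -
  have qa: "poly q a \<noteq> 0" "(poly p a)\<^sup>2 = poly f a * (poly q a)\<^sup>2" if "a \<in># A" for a
  proof -
    have "poly (Norm p q) a = 0"
      using that unfolding N by (auto simp: poly_prod_mset prod_mset_zero_iff)
    then show "(poly p a)\<^sup>2 = poly f a * (poly q a)\<^sup>2" by (simp add: Norm_def)
    then show "poly q a \<noteq> 0" using nd[OF that] by auto
  qed
  obtain r s where "r * q + s * (linear_factors A) = 1"
    using bezout_linear_factors[of A q] qa by blast
  then have rs: "r * q + smult (1 / c) s * Norm p q = 1"
    unfolding N using c by simp
  define s' where "s' = smult (1 / c) s"
  define V where "V = - (r * p)"
  have rs: "r * q = 1 - s' * Norm p q" using rs by (simp add: s'_def algebra_simps)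
  have Na: "poly (Norm p q) a = 0" if "a \<in># A" for a
    using that unfolding N by (auto simp: poly_prod_mset prod_mset_zero_iff)
  have Va: "poly V a = - poly p a / poly q a" if "a \<in># A" for a
  proof -
    have "poly r a * poly q a = 1" using arg_cong[OF rs, of "\<lambda>p. poly p a"] Na[OF that] by simp
    then show ?thesis using qa(1)[OF that] by (simp add: V_def field_simps)
  qed
  have on: "on a (poly V a)" if "a \<in># A" for a
    using qa[OF that] by (simp add: Va[OF that] on_def power_divide)
  \<comment> \<open>The norm divides \<open>V\<^sup>2 - f\<close>, because \<open>r\<close> is an inverse of \<open>q\<close> modulo the norm.\<close>
  have "V\<^sup>2 - f = Norm p q * (r\<^sup>2 - f * s' * (2 - s' * Norm p q))"
  proof -
    have "V\<^sup>2 - f = r\<^sup>2 * Norm p q + f * ((r * q)\<^sup>2 - 1)"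
      by (simp add: V_def Norm_def power2_eq_square algebra_simps)
    also have "(r * q)\<^sup>2 - 1 = - Norm p q * (s' * (2 - s' * Norm p q))"
      unfolding rs by (simp add: power2_eq_square algebra_simps)
    finally show ?thesis by (simp add: algebra_simps)
  qed
  from lat_split[OF this[unfolded N] c]
  have 1: "lat {emb (Norm p q), yy - emb V} = lat (\<Prod>a\<in>#A. gen (Affine a (poly V a)))"
    unfolding N .
  have 2: "lat {fn p q} = lat {emb (Norm p q), yy - emb V}"
  proof (rule lat_eqI)
    have g: "fn p q \<in> lat {fn p q}" by (rule lat_incl) simp
    from lat_scale[OF g, of "fn p (- q)"] have gN: "emb (Norm p q) \<in> lat {fn p q}"
      using fn_mult_conj[of p q] by (simp add: mult.commute)
    have "yy - emb V = emb r * fn p q + (emb s' * yy) * emb (Norm p q)"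
    proof -
      have "emb r * fn p q = emb (r * p) + emb (r * q) * yy" by (simp add: fn_def algebra_simps)
      then show ?thesis unfolding rs by (simp add: V_def algebra_simps)
    qed
    moreover have "\<dots> \<in> lat {fn p q}" by (rule lat_add[OF lat_scale[OF g] lat_scale[OF gN]]) auto
    ultimately show "{emb (Norm p q), yy - emb V} \<subseteq> lat {fn p q}" using gN by simp
    have h1: "emb (Norm p q) \<in> lat {emb (Norm p q), yy - emb V}" 
      and h2: "yy - emb V \<in> lat {emb (Norm p q), yy - emb V}" by (auto intro: lat_incl)
    have "p + q * V = p * (s' * Norm p q)"
    proof -
      have "p + q * V = p * (1 - r * q)" by (simp add: V_def algebra_simps)
      then show ?thesis unfolding rs by simp
    qed
    then have "emb p + emb q * emb V = emb (p * s') * emb (Norm p q)"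
      by (metis emb_simps(3,6) mult.assoc)
    then have "fn p q = emb (p * s') * emb (Norm p q) + emb q * (yy - emb V)"
      by (simp add: fn_def algebra_simps)
    then show "{fn p q} \<subseteq> lat {emb (Norm p q), yy - emb V}"
      using lat_linear_combination[OF h1 h2, of "p * s'" q] by simp
  qed
  show ?thesis using 1 2 qa Va on by (intro exI[of _ V]) auto
qed


section \<open>The group law\<close>

lemma on_curve_Affine [simp]: "on_curve f (Affine a b) \<longleftrightarrow> on a b"
  and on_curve_Infinity [simp]: "on_curve f Infinity"
  by (simp_all add: on_curve_def on_def)

lemma on_curve_neg [simp]: "on_curve f (neg P) \<longleftrightarrow> on_curve f P"
  by (cases P) (simp_all add: on_def)

lemma gen_mult_neg: assumes "on_curve f P" shows "gen P * gen (neg P) \<approx> 1"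
proof (cases P)
  case (Affine a b)
  with assms have "lat (gen P * gen (neg P)) = lat {emb [:- a, 1:]}" using lat_mult_neg by simp
  then have "gen P * gen (neg P) \<approx> {emb [:- a, 1:]}" by (rule equivalent_lat)
  also have "\<dots> \<approx> 1" by (rule equivalent_singleton) simp
  finally show ?thesis .
qed simp

lemma cubic_two_roots:
  fixes h :: "'a poly"
  assumes "degree h = 3" "[:- r, 1:] * [:- s, 1:] dvd h"
  defines "t \<equiv> - coeff h 2 / coeff h 3 - r - s"
  shows "h = smult (coeff h 3) ([:- r, 1:] * [:- s, 1:] * [:- t, 1:])"
proof -
  obtain k where k: "h = [:- r, 1:] * [:- s, 1:] * k" using assms(2) by blast
  have "k \<noteq> 0" using assms(1) k by auto
  then have "degree h = degree ([:- r, 1:] * [:- s, 1:]) + degree k"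
    unfolding k by (intro degree_mult_eq) auto
  also have "degree ([:- r, 1:] * [:- s, 1:]) = 2" by simp
  finally have "degree k = 1" using assms(1) by simp
  then obtain k0 k1 where k01: "k = [:k0, k1:]" "k1 \<noteq> 0"
  proof -
    obtain k0 k' where k': "k = pCons k0 k'" by (cases k) auto
    then have "degree k' = 0" "k' \<noteq> 0"
      using \<open>degree k = 1\<close> by (auto split: if_splits)
    then obtain k1 where "k' = [:k1:]" "k1 \<noteq> 0" by (auto elim: degree_eq_zeroE)
    then show thesis using that k' by blast
  qed
  have h: "h = [:r * s * k0, r * s * k1 - (r + s) * k0, k0 - (r + s) * k1, k1:]"
    unfolding k k01 by (simp add: algebra_simps)
  have c: "coeff h 3 = k1" "coeff h 2 = k0 - (r + s) * k1"
    unfolding h by (simp_all add: numeral_2_eq_2 numeral_3_eq_3)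
  have "k1 * t = - k0" unfolding t_def c using k01(2) by (simp add: field_simps)
  then have "k = smult k1 [:- t, 1:]" unfolding k01 by simp
  then show ?thesis using c(1) k by (simp only: mult_smult_right)
qed

text \<open>
  The chord or tangent \<open>y = V\<close> through two points. The two known roots of the cubic \<open>V\<^sup>2 - f\<close>
  determine the third through its coefficient of degree two; for a tangent the slope is chosen such
  that the derivative vanishes.
\<close>

lemma line_through:
  assumes P: "on x1 y1" and Q: "on x2 y2" and ne: "\<not> (x1 = x2 \<and> y1 = - y2)"
  shows "\<exists>V x3. point_add f (Affine x1 y1) (Affine x2 y2) = Affine x3 (- poly V x3) \<and>
     poly V x1 = y1 \<and> poly V x2 = y2 \<and>
     V\<^sup>2 - f = smult (- coeff f 3) (linear_factors ({#x1, x2, x3#}))"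
proof -
  define m where "m = (if x1 = x2 then poly (pderiv f) x1 / (2 * y1) else (y2 - y1) / (x2 - x1))"
  define V where "V = [:y1 - m * x1, m:]"
  define h where "h = V\<^sup>2 - f"
  have V1: "poly V x1 = y1" by (simp add: V_def)
  have eq: "y1 = y2" if "x1 = x2"
  proof -
    have "y1\<^sup>2 = y2\<^sup>2" using P Q that by (simp add: on_def)
    then show ?thesis using ne that by (auto simp: power2_eq_iff)
  qed
  have "m * (x2 - x1) = y2 - y1" if "x1 \<noteq> x2"
    using that by (simp add: m_def)
  then have V2: "poly V x2 = y2"
    using eq V1 by (cases "x1 = x2") (auto simp: V_def algebra_simps)
  have V_sq: "V\<^sup>2 = [:(y1 - m * x1)\<^sup>2, 2 * m * (y1 - m * x1), m\<^sup>2:]"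
    by (simp add: V_def power2_eq_square algebra_simps)
  have h3: "coeff h 3 = - coeff f 3"
    and h2: "coeff h 2 = m\<^sup>2 - coeff f 2"
    unfolding h_def coeff_diff V_sq by (simp_all add: numeral_2_eq_2 numeral_3_eq_3)
  have degV: "degree (V\<^sup>2) < degree f"
    unfolding degree_f V_sq by (rule le_less_trans[OF degree_pCons_le]) (simp)
  have deg: "degree h = 3"
    using degree_add_eq_right[of "V\<^sup>2" "- f"] degV degree_f by (simp add: h_def)
  have hx: "poly h x1 = 0" "poly h x2 = 0"
    using P Q by (simp_all add: h_def V1 V2 on_def)
  have "[:- x1, 1:] * [:- x2, 1:] dvd h"
  proof -
    obtain k where k: "h = [:- x1, 1:] * k" using hx(1) unfolding poly_eq_0_iff_dvd by blast
    have "poly k x2 = 0"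
    proof (cases "x1 = x2")
      case False
      then show ?thesis using hx(2) unfolding k by simp
    next
      case True
      have "y1 \<noteq> 0" using ne eq True by auto
      have "pderiv h = 2 * V * pderiv V - pderiv f"
        by (simp add: h_def pderiv_diff pderiv_mult power2_eq_square)
      then have "poly (pderiv h) x1 = 2 * y1 * m - poly (pderiv f) x1"
        by (simp add: V1) (simp add: V_def pderiv_pCons)
      then have 0: "poly (pderiv h) x1 = 0" using True \<open>y1 \<noteq> 0\<close> two_nonzero by (simp add: m_def)
      have "pderiv h = [:- x1, 1:] * pderiv k + k * pderiv [:- x1, 1:]"
        unfolding k by (rule pderiv_mult)
      then have "poly (pderiv h) x1 = poly k x1" by (simp add: pderiv_pCons)
      then show ?thesis using 0 True by simp
    qed
    then have "[:- x2, 1:] dvd k" by (simp add: poly_eq_0_iff_dvd)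
    then show ?thesis unfolding k by (rule mult_dvd_mono[OF dvd_refl])
  qed
  from cubic_two_roots[OF deg this]
  obtain x3 where x3: "x3 = - coeff h 2 / coeff h 3 - x1 - x2"
    and fac: "h = smult (coeff h 3) ([:- x1, 1:] * [:- x2, 1:] * [:- x3, 1:])"
    by blast
  have x3': "x3 = (m\<^sup>2 - coeff f 2) / coeff f 3 - x1 - x2"
    unfolding x3 h2 h3 by (simp add: minus_divide_left)
  have "point_add f (Affine x1 y1) (Affine x2 y2) = Affine x3 (- (y1 + m * (x3 - x1)))"
    using ne unfolding x3' by (simp add: m_def Let_def)
  also have "y1 + m * (x3 - x1) = poly V x3" by (simp add: V_def algebra_simps)
  finally have 1: "point_add f (Affine x1 y1) (Affine x2 y2) = Affine x3 (- poly V x3)" .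
  have 2: "V\<^sup>2 - f = smult (- coeff f 3) (linear_factors ({#x1, x2, x3#}))"
    using fac[unfolded h3] unfolding h_def by (simp add: mult.assoc del: mult_pCons_left mult_pCons_right)
  show ?thesis using 1 2 V1 V2 by blast
qed

lemma coeff_f_3 [simp]: "coeff f 3 \<noteq> 0"
  using degree_f leading_coeff_0_iff[of f] by auto

text \<open>
  For collinear points \<open>P\<close>, \<open>Q\<close>, \<open>R\<close> the ideal \<open>(V\<^sup>2 - f, y - V)\<close> is generated by \<open>y - V\<close>, so
  the product of the three ideals is principal, and \<open>P + Q = -R\<close>.
\<close>

lemma point_add_on_curve_gen:
  assumes "on_curve f P" "on_curve f Q"
  shows "on_curve f (point_add f P Q)" "gen (point_add f P Q) \<approx> gen P * gen Q"
proof -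
  have "on_curve f (point_add f P Q) \<and> gen (point_add f P Q) \<approx> gen P * gen Q"
  proof (cases "P = Infinity \<or> Q = Infinity")
    case True
    then show ?thesis using assms by (cases P; cases Q) auto
  next
    case False
    then obtain x1 y1 x2 y2 where PQ: "P = Affine x1 y1" "Q = Affine x2 y2" by (cases P; cases Q) auto
    note on = assms[unfolded PQ on_curve_Affine]
    show ?thesis
    proof (cases "x1 = x2 \<and> y1 = - y2")
      case True
      then have "Q = neg P" "point_add f P Q = Infinity" by (auto simp: PQ)
      then show ?thesis using gen_mult_neg[OF assms(1)] by (simp add: equivalent_sym)
    next
      case False
      from line_through[OF on False] obtain V x3 where
        add: "point_add f P Q = Affine x3 (- poly V x3)" and V: "poly V x1 = y1" "poly V x2 = y2"
        and fac: "V\<^sup>2 - f = smult (- coeff f 3) (linear_factors ({#x1, x2, x3#}))"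
        unfolding PQ by blast
      define R where "R = Affine x3 (poly V x3)"
      have "poly (V\<^sup>2 - f) x3 = 0" unfolding fac by (simp del: mult_pCons_left mult_pCons_right)
      then have onR: "on x3 (poly V x3)" by (simp add: on_def)
      have sum: "point_add f P Q = neg R" by (simp add: add R_def)
      let ?U = "smult (- coeff f 3) (linear_factors ({#x1, x2, x3#}))"
      have "lat {emb ?U, yy - emb V} = lat (\<Prod>a\<in>#{#x1, x2, x3#}. gen (Affine a (poly V a)))"
        by (rule lat_split[where w = 1]) (use fac in simp_all)
      also have "(\<Prod>a\<in>#{#x1, x2, x3#}. gen (Affine a (poly V a))) = gen P * gen Q * gen R"
        by (simp add: PQ V R_def mult.assoc)
      also have "lat {emb ?U, yy - emb V} = lat {yy - emb V}"
      proof (rule lat_eqI)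
        have h: "yy - emb V \<in> lat {yy - emb V}" by (rule lat_incl) simp
        have "emb ?U = (emb V)\<^sup>2 - yy\<^sup>2" unfolding fac[symmetric] by (simp add: yy_square)
        also have "\<dots> = (- (yy + emb V)) * (yy - emb V)" by (simp add: power2_eq_square algebra_simps)
        also have "\<dots> \<in> lat {yy - emb V}" by (rule lat_scale[OF h]) auto
        finally show "{emb ?U, yy - emb V} \<subseteq> lat {yy - emb V}" using h by simp
      qed (auto intro: lat_incl)
      finally have "gen P * gen Q * gen R \<approx> {yy - emb V}"
        by (intro equivalent_lat) simp
      also have "\<dots> \<approx> 1"
      proof (rule equivalent_singleton)
        have "yy - emb V = fn (- V) 1" by (simp add: fn_def)
        then show "yy - emb V \<noteq> 0" by (simp add: fn_eq_0_iff)
      qed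
      finally have 1: "gen P * gen Q * gen R \<approx> 1" .
      have "gen P * gen Q * 1 \<approx> gen P * gen Q * (gen R * gen (neg R))"
        using onR by (intro equivalent_times equivalent_refl equivalent_sym[OF gen_mult_neg]) (simp add: R_def)
      also have "\<dots> = (gen P * gen Q * gen R) * gen (neg R)" by (simp only: ac_simps)
      also have "\<dots> \<approx> 1 * gen (neg R)" by (rule equivalent_times_right[OF 1])
      finally have "gen P * gen Q \<approx> gen (neg R)" by simp
      then show ?thesis using onR unfolding sum by (auto simp: R_def on_def intro: equivalent_sym)
    qed
  qed
  then show "on_curve f (point_add f P Q)" "gen (point_add f P Q) \<approx> gen P * gen Q" by auto
qed

lemma gen_subset_S: "gen P \<subseteq> S"
  by (cases P) (auto simp: set_one)

lemma equivalent_one_imp: assumes "G \<approx> 1" "G \<subseteq> S" "G \<noteq> {}"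
  shows "\<exists>p q. lat G = lat {fn p q} \<and> fn p q \<noteq> 0"
proof -
  obtain c where c: "c \<noteq> 0" "lat G = lat {c}" using assms(1) by (auto simp: equivalent_def)
  then have "c \<in> lat G" by (auto intro: lat_incl)
  then have "c \<in> S" using lat_subset_S[OF assms(2)] by blast
  then show ?thesis using c by (auto simp: S_def)
qed

definition vanishing :: "'a \<Rightarrow> 'a \<Rightarrow> 'a poly fract alg_closure set" where
  "vanishing a b = {fn p q | p q. poly p a + poly q a * b = 0}"

lemma fn_in_vanishing: "fn p q \<in> vanishing a b \<longleftrightarrow> poly p a + poly q a * b = 0"
  by (auto simp: vanishing_def fn_eq_iff)

text \<open>
  Evaluation at a point of the curve is multiplicative, so its kernel is a prime ideal.
\<close>

lemma vanishing_times:
  assumes "on a b"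
  shows "fn p q * fn r s \<in> vanishing a b \<longleftrightarrow> fn p q \<in> vanishing a b \<or> fn r s \<in> vanishing a b"
proof -
  have "poly f a = b * b" using assms by (simp add: on_def power2_eq_square)
  then have "poly (p * r + f * q * s) a + poly (p * s + q * r) a * b
     = (poly p a + poly q a * b) * (poly r a + poly s a * b)"
    by (simp add: algebra_simps)
  then show ?thesis by (simp add: fn_simps fn_in_vanishing)
qed

lemma lat_subset_vanishing:
  assumes "on a b" "G \<subseteq> vanishing a b"
  shows "lat G \<subseteq> vanishing a b"
proof
  fix u assume "u \<in> lat G"
  then show "u \<in> vanishing a b"
  proof induction
    case lat_0
    then show ?case using fn_in_vanishing[of 0 0] by (simp add: fn_def)
  next
    case (lat_step s g u)
    obtain p q where s: "s = fn p q" using lat_step(1) by (rule S_cases)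
    obtain p' q' where g: "g = fn p' q'" using lat_step(2) assms(2) unfolding vanishing_def by blast
    have "s * g \<in> vanishing a b"
      using vanishing_times[OF assms(1)] assms(2) lat_step(2) unfolding s g by blast
    then obtain P Q where sg: "s * g = fn P Q" "poly P a + poly Q a * b = 0"
      unfolding vanishing_def by blast
    obtain r t where u: "u = fn r t" "poly r a + poly t a * b = 0"
      using lat_step.IH unfolding vanishing_def by blast
    have "poly (P + r) a + poly (Q + t) a * b
        = (poly P a + poly Q a * b) + (poly r a + poly t a * b)" by (simp add: algebra_simps)
    then show ?case unfolding sg(1) u(1) fn_simps fn_in_vanishing using sg(2) u(2) by simp
  qed
qed

lemma gen_vanishing: "gen (Affine a b) \<subseteq> vanishing a b"
proof -
  have "emb [:- a, 1:] = fn [:- a, 1:] 0" "yy - emb [:b:] = fn [:- b:] 1" 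
    using emb_simps(5)[of "[:b:]"] by (simp_all add: fn_def)
  then show ?thesis by (simp add: fn_in_vanishing)
qed

text \<open>
  No affine point has a principal ideal: a generator would divide \<open>x - a\<close>, so its norm would have
  degree at most two. But a function with \<open>q \<noteq> 0\<close> has a norm of degree at least three, and a
  polynomial in \<open>x\<close> that divides \<open>y - b\<close> is constant.
\<close>

lemma gen_equivalent_one_imp:
  assumes "on_curve f P" "gen P \<approx> 1" shows "P = Infinity"
proof (cases P)
  case (Affine a b)
  have on: "on a b" using assms Affine by simp
  obtain p q where g: "lat (gen P) = lat {fn p q}" "fn p q \<noteq> 0"
    using equivalent_one_imp[OF assms(2) gen_subset_S] Affine by auto
  have ex: "\<exists>r s. fn u v = fn r s * fn p q" if "fn u v \<in> gen P" for u v
    using lat_incl[OF that] unfolding g(1) lat_singleton by (auto simp: S_def)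
  have "fn [:- a, 1:] 0 \<in> gen P" by (simp add: Affine fn_def)
  from ex[OF this] obtain r s where rs: "fn [:- a, 1:] 0 = fn r s * fn p q" by blast
  then have N: "Norm r s * Norm p q = Norm [:- a, 1:] 0" by (metis Norm_mult)
  have "Norm [:- a, 1:] 0 \<noteq> 0" by simp
  then have "Norm r s \<noteq> 0" "Norm p q \<noteq> 0" unfolding N[symmetric] by auto
  then have "degree (Norm r s) + degree (Norm p q) = degree (Norm [:- a, 1:] 0)"
    unfolding N[symmetric] by (rule degree_mult_eq[symmetric])
  also have "\<dots> = 2" by (simp add: Norm_def degree_power_eq)
  finally have deg: "degree (Norm p q) \<le> 2" by simp
  have "q = 0"
  proof (rule ccontr)
    assume q: "q \<noteq> 0"
    have dq: "degree (f * q\<^sup>2) = 3 + 2 * degree q"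
      using q degree_f by (subst degree_mult_eq) (auto simp: degree_power_eq)
    have "degree (f * q\<^sup>2) \<le> degree (Norm p q)"
      unfolding Norm_def by (rule degree_le_square_minus_odd) (simp add: dq)
    then show False using dq deg by simp
  qed
  have "fn [:- b:] 1 \<in> gen P" using emb_simps(5)[of "[:b:]"] by (simp add: Affine fn_def)
  from ex[OF this] obtain r' s' where "fn [:- b:] 1 = fn r' s' * fn p q" by blast
  then have "s' * p = 1" using \<open>q = 0\<close> unfolding fn_simps fn_eq_iff by simp
  then have "fn s' 0 * fn p q = 1" using \<open>q = 0\<close> unfolding fn_simps by (simp add: fn_def)
  then have "1 \<in> lat (gen P)" unfolding g(1) lat_singleton by (metis (mono_tags, lifting) fn_in_S mem_Collect_eq)
  then have "1 \<in> vanishing a b"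
    using lat_subset_vanishing[OF on, of "gen P"] gen_vanishing[of a b] Affine by auto
  then show ?thesis using fn_in_vanishing[of 1 0 a b] by (simp add: fn_def)
qed simp

lemma gen_inj:
  assumes "on_curve f P" "on_curve f Q" "gen P \<approx> gen Q" shows "P = Q"
proof -
  have "gen (point_add f P (neg Q)) \<approx> gen P * gen (neg Q)"
    using assms by (intro point_add_on_curve_gen) auto
  also have "\<dots> \<approx> gen Q * gen (neg Q)" by (rule equivalent_times_right[OF assms(3)])
  also have "\<dots> \<approx> 1" by (rule gen_mult_neg[OF assms(2)])
  finally have "point_add f P (neg Q) = Infinity"
    using assms by (intro gen_equivalent_one_imp point_add_on_curve_gen) auto
  then show ?thesis by (cases P; cases Q) (auto simp: Let_def split: if_splits)
qed

abbreviation EE :: "'a point monoid" where "EE \<equiv> point_group f"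

lemma carrier_EE [simp]: "P \<in> carrier EE \<longleftrightarrow> on_curve f P"
  and mult_EE [simp]: "P \<otimes>\<^bsub>EE\<^esub> Q = point_add f P Q"
  and one_EE [simp]: "\<one>\<^bsub>EE\<^esub> = Infinity"
  by (simp_all add: point_group_def)

text \<open>
  The class of the ideal of a point determines the point, and addition corresponds to
  multiplication of classes. Associativity and commutativity are inherited.
\<close>

theorem comm_group_EE: "comm_group EE"
proof (rule comm_groupI)
  fix P Q R assume PQR: "P \<in> carrier EE" "Q \<in> carrier EE" "R \<in> carrier EE"
  note on = this[unfolded carrier_EE]
  have "gen (point_add f (point_add f P Q) R) \<approx> gen (point_add f P Q) * gen R"
    using on by (intro point_add_on_curve_gen) auto
  also have "\<dots> \<approx> gen P * gen Q * gen R"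
    using on by (intro equivalent_times_right point_add_on_curve_gen) auto
  also have "\<dots> = gen P * (gen Q * gen R)" by (rule mult.assoc)
  also have "\<dots> \<approx> gen P * gen (point_add f Q R)"
    using on by (intro equivalent_times equivalent_refl equivalent_sym[OF point_add_on_curve_gen(2)]) auto
  also have "\<dots> \<approx> gen (point_add f P (point_add f Q R))"
    using on by (intro equivalent_sym[OF point_add_on_curve_gen(2)] point_add_on_curve_gen) auto
  finally show "P \<otimes>\<^bsub>EE\<^esub> Q \<otimes>\<^bsub>EE\<^esub> R = P \<otimes>\<^bsub>EE\<^esub> (Q \<otimes>\<^bsub>EE\<^esub> R)"
    using on by (auto intro!: gen_inj point_add_on_curve_gen(1))
next
  fix P Q assume "P \<in> carrier EE" "Q \<in> carrier EE"
  note on = this[unfolded carrier_EE]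
  have "gen (point_add f P Q) \<approx> gen P * gen Q" using on by (intro point_add_on_curve_gen)
  also have "\<dots> = gen Q * gen P" by (rule mult.commute)
  also have "\<dots> \<approx> gen (point_add f Q P)" using on by (intro equivalent_sym[OF point_add_on_curve_gen(2)])
  finally show "P \<otimes>\<^bsub>EE\<^esub> Q = Q \<otimes>\<^bsub>EE\<^esub> P"
    using on by (auto intro!: gen_inj point_add_on_curve_gen(1))
next
  fix P assume P: "P \<in> carrier EE"
  show "\<exists>Q\<in>carrier EE. Q \<otimes>\<^bsub>EE\<^esub> P = \<one>\<^bsub>EE\<^esub>"
  proof (rule bexI[of _ "neg P"])
    show "neg P \<otimes>\<^bsub>EE\<^esub> P = \<one>\<^bsub>EE\<^esub>" by (cases P) auto
    show "neg P \<in> carrier EE" using P by simp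
  qed
qed (auto intro: point_add_on_curve_gen)

interpretation EE: comm_group EE by (rule comm_group_EE)

lemma inv_EE [simp]: "on_curve f P \<Longrightarrow> inv\<^bsub>EE\<^esub> P = neg P"
proof (rule EE.inv_equality)
  show "neg P \<otimes>\<^bsub>EE\<^esub> P = \<one>\<^bsub>EE\<^esub>" by (cases P) simp_all
qed simp_all

section \<open>Relations between points and functions\<close>

definition add_list :: "'a point list \<Rightarrow> 'a point" where
  "add_list Ps = foldr (point_add f) Ps Infinity"

lemma add_list_simps [simp]: "add_list [] = Infinity" "add_list (P # Ps) = point_add f P (add_list Ps)"
  by (simp_all add: add_list_def)

lemma add_list_on_curve: "(\<And>P. P \<in> set Ps \<Longrightarrow> on_curve f P) \<Longrightarrow> on_curve f (add_list Ps)"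
  by (induction Ps) (auto intro: point_add_on_curve_gen)

lemma gen_add_list:
  "(\<And>P. P \<in> set Ps \<Longrightarrow> on_curve f P) \<Longrightarrow> gen (add_list Ps) \<approx> prod_list (map gen Ps)"
proof (induction Ps)
  case (Cons P Ps)
  then have "gen (add_list (P # Ps)) \<approx> gen P * gen (add_list Ps)"
    by (auto intro!: point_add_on_curve_gen add_list_on_curve)
  also have "\<dots> \<approx> gen P * prod_list (map gen Ps)"
    using Cons by (intro equivalent_times) auto
  finally show ?case by simp
qed auto

lemma add_list_decompose:
  assumes "subgroup H EE" "on_curve f P"
    and "\<And>Q. Q \<in> set Ps \<Longrightarrow> Q = P \<or> Q \<in> H"
  shows "\<exists>h\<in>H. add_list Ps = P [^]\<^bsub>EE\<^esub> count_list Ps P \<otimes>\<^bsub>EE\<^esub> h"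
  using assms(3)
proof (induction Ps)
  case Nil
  show ?case by (rule bexI[OF _ subgroup.one_closed[OF assms(1)]]) simp
next
  case (Cons Q Ps)
  then obtain h where h: "h \<in> H" "add_list Ps = P [^]\<^bsub>EE\<^esub> count_list Ps P \<otimes>\<^bsub>EE\<^esub> h" by auto
  have P: "P \<in> carrier EE" using assms(2) by simp
  have hc: "h \<in> carrier EE" by (rule subgroup.mem_carrier[OF assms(1) h(1)])
  have eq: "add_list (Q # Ps) = Q \<otimes>\<^bsub>EE\<^esub> (P [^]\<^bsub>EE\<^esub> count_list Ps P \<otimes>\<^bsub>EE\<^esub> h)"
    by (simp add: h(2))
  show ?case
  proof (cases "Q = P")
    case True
    have "add_list (P # Ps) = P [^]\<^bsub>EE\<^esub> Suc (count_list Ps P) \<otimes>\<^bsub>EE\<^esub> h"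
      using eq[unfolded True]
      by (simp only: EE.nat_pow_Suc2[OF P] EE.m_assoc[OF P EE.nat_pow_closed[OF P] hc])
    moreover have "count_list (Q # Ps) P = Suc (count_list Ps P)" using True by simp
    ultimately show ?thesis using h(1) True by metis
  next
    case False
    then have Q: "Q \<in> H" using Cons.prems by auto
    have Qc: "Q \<in> carrier EE" by (rule subgroup.mem_carrier[OF assms(1) Q])
    have "add_list (Q # Ps) = P [^]\<^bsub>EE\<^esub> count_list Ps P \<otimes>\<^bsub>EE\<^esub> (Q \<otimes>\<^bsub>EE\<^esub> h)"
      unfolding eq by (rule EE.m_lcomm[OF Qc EE.nat_pow_closed[OF P] hc])
    moreover have "Q \<otimes>\<^bsub>EE\<^esub> h \<in> H" using subgroup.m_closed[OF assms(1) Q h(1)] .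
    moreover have "count_list (Q # Ps) P = count_list Ps P" using False by simp
    ultimately show ?thesis by metis
  qed
qed

lemma fn_eq_0_imp_Norm: "Norm p q \<noteq> 0 \<Longrightarrow> fn p q \<noteq> 0"
  by (auto simp: fn_eq_0_iff)

text \<open>
  The zeros of a function add up to zero. If the function vanishes at \<open>P\<close> but not at \<open>-P\<close>, and the
  points over the other roots of its norm lie in a subgroup, then a positive multiple of \<open>P\<close> lies in it.
  A linear factor \<open>x - a\<close> common to \<open>p\<close> and \<open>q\<close> is divided out first, as its zeros on the curve may have
  irrational ordinates.
\<close>

lemma function_relation:
  assumes N: "Norm p q = smult c (linear_factors A)" "c \<noteq> 0"
    and P: "on x0 y0" "poly p x0 + poly q x0 * y0 = 0" "poly p x0 - poly q x0 * y0 \<noteq> 0"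
    and H: "subgroup H EE" "\<And>a b. a \<in># A \<Longrightarrow> a \<noteq> x0 \<Longrightarrow> on a b \<Longrightarrow> Affine a b \<in> H"
  shows "\<exists>e::nat. e > 0 \<and> Affine x0 y0 [^]\<^bsub>EE\<^esub> e \<in> H"
  using assms
proof (induction "degree (Norm p q)" arbitrary: p q c A rule: less_induct)
  case less
  show ?case
  proof (cases "\<exists>a\<in>#A. poly p a = 0 \<and> poly q a = 0")
    case True
    then obtain a where a: "a \<in># A" "poly p a = 0" "poly q a = 0" by blast
    then obtain p' q' where pq: "p = [:- a, 1:] * p'" "q = [:- a, 1:] * q'"
      unfolding poly_eq_0_iff_dvd by blast
    have N': "Norm p q = [:- a, 1:]\<^sup>2 * Norm p' q'"
      unfolding pq Norm_def by (simp only: power_mult_distrib algebra_simps)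
    have "Norm p q \<noteq> 0"
      unfolding less.prems(1) using less.prems(2) by (auto simp: prod_mset_zero_iff)
    then have nz: "Norm p' q' \<noteq> 0" using N' by (metis mult_zero_right)
    have "degree (Norm p q) = 2 + degree (Norm p' q')"
      unfolding N' using nz by (subst degree_mult_eq) (auto simp: degree_power_eq)
    then have d: "degree (Norm p' q') < degree (Norm p q)" by simp
    have "Norm p' q' dvd smult c (linear_factors A)"
      unfolding less.prems(1)[symmetric] N' by simp
    from dvd_prod_linear_factors[OF this less.prems(2)] obtain c' A' where
      A': "c' \<noteq> 0" "A' \<subseteq># A" "Norm p' q' = smult c' (linear_factors A')" by blast
    have "a \<noteq> x0" using less.prems(5) a by auto
    then have nz: "x0 - a \<noteq> 0" by simp
    have ev: "poly p x0 = (x0 - a) * poly p' x0" "poly q x0 = (x0 - a) * poly q' x0"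
      unfolding pq by (simp_all add: algebra_simps)
    have "(x0 - a) * (poly p' x0 + poly q' x0 * y0) = 0" "(x0 - a) * (poly p' x0 - poly q' x0 * y0) \<noteq> 0"
      using less.prems(4,5) unfolding ev by (simp_all add: algebra_simps)
    then have 1: "poly p' x0 + poly q' x0 * y0 = 0" "poly p' x0 - poly q' x0 * y0 \<noteq> 0"
      using nz by simp_all
    show ?thesis
      using less.hyps[OF d A'(3,1) less.prems(3) 1 less.prems(6)] less.prems(7) A'(2)
      by (meson mset_subset_eqD)
  next
    case False
    from lat_fn[OF less.prems(1,2)] False obtain V where
      V: "\<And>a. a \<in># A \<Longrightarrow> poly q a \<noteq> 0 \<and> poly V a = - poly p a / poly q a \<and> on a (poly V a)"
      and L: "lat {fn p q} = lat (\<Prod>a\<in>#A. gen (Affine a (poly V a)))" by blast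
    obtain as where as: "mset as = A" using ex_mset by blast
    define Ps where "Ps = map (\<lambda>a. Affine a (poly V a)) as"
    have on: "on_curve f P" if "P \<in> set Ps" for P
    proof -
      from that obtain a where a: "a \<in># A" "P = Affine a (poly V a)"
        unfolding Ps_def as[symmetric] by auto
      have "on a (poly V a)" using V[OF a(1)] by blast
      then show ?thesis by (simp only: a(2) on_curve_Affine)
    qed
    have "fn p q \<noteq> 0" using less.prems(1,2) by (intro fn_eq_0_imp_Norm) (auto simp: prod_mset_zero_iff)
    have "gen (add_list Ps) \<approx> prod_list (map gen Ps)" by (rule gen_add_list[OF on])
    also have "prod_list (map gen Ps) = (\<Prod>a\<in>#A. gen (Affine a (poly V a)))"
      unfolding Ps_def as[symmetric] by (simp add: prod_mset_prod_list[symmetric] o_def flip: mset_map)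
    also have "\<dots> \<approx> {fn p q}" by (rule equivalent_lat[OF L[symmetric]])
    also have "\<dots> \<approx> 1" by (rule equivalent_singleton) fact
    finally have 0: "add_list Ps = Infinity"
      by (intro gen_equivalent_one_imp add_list_on_curve on)
    have "poly (Norm p q) x0 = (poly p x0 + poly q x0 * y0) * (poly p x0 - poly q x0 * y0)"
    proof -
      have "poly f x0 = y0 * y0" using less.prems(3) by (simp add: on_def power2_eq_square)
      then show ?thesis by (simp add: Norm_def power2_eq_square algebra_simps)
    qed
    then have "poly (Norm p q) x0 = 0" using less.prems(4) by simp
    then have x0: "x0 \<in># A"
      unfolding less.prems(1) using less.prems(2) by (auto simp: poly_prod_mset prod_mset_zero_iff)
    have Vx0: "poly V x0 = y0"
    proof -
      have "poly p x0 = - (poly q x0 * y0)" using less.prems(4) by (simp add: eq_neg_iff_add_eq_0)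
      then show ?thesis using V[OF x0] by simp
    qed
    let ?P = "Affine x0 y0"
    have "\<exists>h\<in>H. add_list Ps = ?P [^]\<^bsub>EE\<^esub> count_list Ps ?P \<otimes>\<^bsub>EE\<^esub> h"
    proof (rule add_list_decompose[OF less.prems(6)])
      fix Q assume "Q \<in> set Ps"
      then obtain a where a: "a \<in># A" "Q = Affine a (poly V a)" unfolding Ps_def as[symmetric] by auto
      then show "Q = ?P \<or> Q \<in> H" using V[OF a(1)] Vx0 less.prems(7) by (cases "a = x0") auto
    qed (use less.prems(3) in simp)
    then obtain h where h: "h \<in> H" "?P [^]\<^bsub>EE\<^esub> count_list Ps ?P \<otimes>\<^bsub>EE\<^esub> h = \<one>\<^bsub>EE\<^esub>"
      unfolding 0 by auto
    have Pc: "?P \<in> carrier EE" using less.prems(3) by simp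
    have hc: "h \<in> carrier EE" by (rule subgroup.mem_carrier[OF less.prems(6) h(1)])
    have "?P [^]\<^bsub>EE\<^esub> count_list Ps ?P = inv\<^bsub>EE\<^esub> h"
      by (rule EE.inv_equality[symmetric, OF h(2) hc EE.nat_pow_closed[OF Pc]])
    then have "?P [^]\<^bsub>EE\<^esub> count_list Ps ?P \<in> H"
      using subgroup.m_inv_closed[OF less.prems(6) h(1)] by simp
    moreover have "?P \<in> set Ps" using x0 Vx0 unfolding Ps_def as[symmetric] by force
    then have "count_list Ps ?P > 0" by (metis count_list_0_iff gr0I)
    ultimately show ?thesis by blast
  qed
qed

lemma times_subset_vanishing:
  assumes "on a b" "G \<subseteq> S" "H \<subseteq> S" "G * H \<subseteq> vanishing a b"
  shows "G \<subseteq> vanishing a b \<or> H \<subseteq> vanishing a b"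
proof (rule ccontr)
  assume "\<not> ?thesis"
  then obtain g h where gh: "g \<in> G" "g \<notin> vanishing a b" "h \<in> H" "h \<notin> vanishing a b" by blast
  then have "g * h \<in> vanishing a b" using assms(4) by (auto simp: set_times_def)
  moreover obtain p q r t where "g = fn p q" "h = fn r t"
    using gh assms(2,3) by (meson S_cases subsetD)
  ultimately show False using gh(2,4) vanishing_times[OF assms(1), of p q r t] by simp
qed

lemma prod_gen_subset_S: "prod_list (map gen Ps) \<subseteq> S"
proof (induction Ps)
  case (Cons P Ps)
  show ?case
  proof
    fix u assume "u \<in> prod_list (map gen (P # Ps))"
    then obtain g h where "g \<in> gen P" "h \<in> prod_list (map gen Ps)" "u = g * h"
      by (auto simp: set_times_def)
    then show "u \<in> S" using Cons gen_subset_S[of P] by (metis S_closed(3) subsetD)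
  qed
qed (simp add: set_one)

lemma prod_gen_subset_vanishing:
  assumes "on a b" "prod_list (map gen Ps) \<subseteq> vanishing a b"
  shows "Affine a b \<in> set Ps"
  using assms(2)
proof (induction Ps)
  case Nil
  then have "1 \<in> vanishing a b" by (simp add: set_one)
  then show ?case using fn_in_vanishing[of 1 0 a b] by (simp add: fn_def)
next
  case (Cons P Ps)
  have "gen P \<subseteq> vanishing a b \<or> prod_list (map gen Ps) \<subseteq> vanishing a b"
    by (rule times_subset_vanishing[OF assms(1) gen_subset_S prod_gen_subset_S]) (use Cons.prems in simp)
  moreover have "P = Affine a b" if *: "gen P \<subseteq> vanishing a b"
  proof (cases P)
    case Infinity
    then show ?thesis using * fn_in_vanishing[of 1 0 a b] by (simp add: set_one fn_def)
  next
    case (Affine c d)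
    have "fn [:- c, 1:] 0 \<in> gen P" "fn [:- d:] 1 \<in> gen P"
      using emb_simps(5)[of "[:d:]"] by (simp_all add: Affine fn_def)
    with * have "fn [:- c, 1:] 0 \<in> vanishing a b" "fn [:- d:] 1 \<in> vanishing a b" by blast+
    then show ?thesis by (simp add: fn_in_vanishing Affine)
  qed
  ultimately show ?case using Cons.IH by auto
qed

lemma lat_mult_neg_list:
  assumes "\<And>P. P \<in> set Ps \<Longrightarrow> on_curve f P \<and> P \<noteq> Infinity"
  shows "\<exists>as. (\<forall>a\<in>set as. \<exists>b. Affine a b \<in> set Ps) \<and>
    lat (prod_list (map gen Ps) * prod_list (map (gen \<circ> neg) Ps)) = lat {emb (\<Prod>a\<leftarrow>as. [:- a, 1:])}"
  using assms
proof (induction Ps)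
  case Nil
  show ?case by (intro exI[of _ "[]"]) (simp add: set_one set_times_def)
next
  case (Cons P Ps)
  then obtain as where as: "\<forall>a\<in>set as. \<exists>b. Affine a b \<in> set Ps"
    "lat (prod_list (map gen Ps) * prod_list (map (gen \<circ> neg) Ps)) = lat {emb (\<Prod>a\<leftarrow>as. [:- a, 1:])}" by (metis list.set_intros(2))
  obtain a b where P: "P = Affine a b" "on a b" using Cons.prems[of P] by (cases P) auto
  let ?G = "prod_list (map gen Ps)" and ?H = "prod_list (map (gen \<circ> neg) Ps)"
  have "lat (prod_list (map gen (P # Ps)) * prod_list (map (gen \<circ> neg) (P # Ps)))
      = lat ((gen P * gen (neg P)) * (?G * ?H))" by (simp add: ac_simps)
  also have "\<dots> = lat ({emb [:- a, 1:]} * (?G * ?H))"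
    by (rule lat_times_cong) (use lat_mult_neg[OF P(2)] in \<open>simp add: P(1)\<close>)
  also have "\<dots> = lat ((?G * ?H) * {emb [:- a, 1:]})" by (simp only: mult.commute)
  also have "\<dots> = lat ({emb (\<Prod>a\<leftarrow>as. [:- a, 1:])} * {emb [:- a, 1:]})"
    by (rule lat_times_cong[OF as(2)])
  also have "{emb (\<Prod>a\<leftarrow>as. [:- a, 1:])} * {emb [:- a, 1:]} = {emb (\<Prod>a\<leftarrow>a # as. [:- a, 1:])}"
    by (simp add: set_times_def mult.commute del: mult_pCons_left mult_pCons_right)
  finally show ?case using as(1) P(1) by (intro exI[of _ "a # as"]) auto
qed

text \<open>
  A relation between points makes the product of their ideals principal, with a generator \<open>p + q y\<close>
  that divides the product \<open>D\<close> of the corresponding vertical lines; so its norm divides \<open>D\<^sup>2\<close>.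
  If this always forces \<open>q = 0\<close>, then the generator \<open>p(x)\<close> vanishes at the negative of one of
  the points, hence so does the product of the ideals, and this negative is itself among
  the points.
\<close>

lemma no_relation:
  assumes rigid: "\<And>as p q. (\<forall>a\<in>set as. \<exists>b. Affine a b \<in> set Ps) \<Longrightarrow>
      Norm p q dvd (\<Prod>a\<leftarrow>as. [:- a, 1:])\<^sup>2 \<Longrightarrow> q = 0"
    and Ps: "Ps \<noteq> []" "\<And>P. P \<in> set Ps \<Longrightarrow> on_curve f P \<and> P \<noteq> Infinity"
    and sum: "add_list Ps = Infinity"
  shows "\<exists>P\<in>set Ps. neg P \<in> set Ps"
proof -
  let ?G = "prod_list (map gen Ps)" and ?H = "prod_list (map (gen \<circ> neg) Ps)"
  obtain as where as: "\<forall>a\<in>set as. \<exists>b. Affine a b \<in> set Ps" and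
    GH: "lat (?G * ?H) = lat {emb (\<Prod>a\<leftarrow>as. [:- a, 1:])}"
    using lat_mult_neg_list[OF Ps(2)] by blast
  define D where "D = (\<Prod>a\<leftarrow>as. [:- a, 1:])"
  have D0: "D \<noteq> 0" unfolding D_def by (auto simp: prod_list_zero_iff)
  have "gen Infinity \<approx> ?G" unfolding sum[symmetric] by (rule gen_add_list) (use Ps(2) in blast)
  then have "?G \<approx> 1" by (simp add: equivalent_sym)
  then obtain c where c: "c \<noteq> 0" "lat ?G = lat {c}" unfolding equivalent_def by auto
  have "c \<in> S" using c(2) lat_incl[of c "{c}"] lat_subset_S[OF prod_gen_subset_S] by blast
  then obtain p q where pq: "c = fn p q" by (rule S_cases)
  have "lat {emb D} = lat ({c} * ?H)" unfolding D_def GH[symmetric] by (rule lat_times_cong[OF c(2)])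
  then have "emb D \<in> lat ({c} * ?H)" using lat_incl[of "emb D" "{emb D}"] by simp
  moreover have "u \<in> {c * s |s. s \<in> S}" if "u \<in> lat ({c} * ?H)" for u
  proof -
    have "{c} * ?H \<subseteq> lat {c}"
    proof
      fix u assume "u \<in> {c} * ?H"
      then obtain h where h: "h \<in> ?H" "u = c * h" by (auto simp: set_times_def)
      have "?H = prod_list (map gen (map neg Ps))" by simp
      then have "h \<in> S" using prod_gen_subset_S[of "map neg Ps"] h(1) by auto
      then have "h * c \<in> lat {c}" by (intro lat_scale lat_incl) auto
      then show "u \<in> lat {c}" using h(2) by (simp add: mult.commute)
    qed
    then have "u \<in> lat {c}" using lat_min that by blast
    then show ?thesis by (auto simp: lat_singleton mult.commute)
  qed
  ultimately obtain s where s: "s \<in> S" "emb D = c * s" by blast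
  obtain r t where rt: "s = fn r t" using s(1) by (rule S_cases)
  have eq: "fn p q * fn r t = fn D 0" using s(2) by (simp add: pq rt emb_conv_fn)
  have "Norm p q dvd D\<^sup>2" using Norm_mult[OF eq] by (auto simp: Norm_def[of D 0] intro: dvdI[OF sym])
  then have q: "q = 0" using rigid[OF as] by (simp add: D_def)
  then have pr: "p * r = D" using eq unfolding fn_simps fn_eq_iff by simp
  show ?thesis
  proof (cases "\<exists>a\<in>set as. poly p a = 0")
    case True
    then obtain a b where a: "poly p a = 0" "Affine a b \<in> set Ps" using as by blast
    then have on: "on a (- b)" using Ps(2)[OF a(2)] by (simp add: on_def)
    have "{c} \<subseteq> vanishing a (- b)" using a(1) by (simp add: pq q fn_in_vanishing)
    from lat_subset_vanishing[OF on this] have "?G \<subseteq> vanishing a (- b)"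
      using lat_incl c(2) by blast
    from prod_gen_subset_vanishing[OF on this] have "neg (Affine a b) \<in> set Ps" by simp
    then show ?thesis using a(2) by blast
  next
    case False
    have "p dvd smult 1 (linear_factors (mset as))"
      using dvdI[OF pr[symmetric]] by (simp add: D_def prod_mset_prod_list flip: mset_map)
    from dvd_prod_linear_factors[OF this] obtain c' A' where
      A': "c' \<noteq> 0" "A' \<subseteq># mset as" "p = smult c' (linear_factors A')" by auto
    have "A' = {#}"
    proof (rule ccontr)
      assume "A' \<noteq> {#}"
      then obtain a where "a \<in># A'" by blast
      then have "poly p a = 0" "a \<in> set as"
        using A' by (auto simp: poly_prod_mset prod_mset_zero_iff dest: mset_subset_eqD)
      then show False using False by blast
    qed
    then have p: "p = [:c':]" using A' by simp
    obtain P where "P \<in> set Ps" using Ps(1) by (cases Ps) auto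
    then obtain a b where ab: "Affine a b \<in> set Ps" "on a b" using Ps(2) by (metis on_curve_Affine point.exhaust)
    obtain Qs where Qs: "mset Ps = mset (Affine a b # Qs)"
      using ab(1) by (metis insert_DiffM ex_mset mset.simps(2) set_mset_mset)
    have "?G = prod_list (map gen (Affine a b # Qs))"
      using Qs by (metis mset_map prod_mset_prod_list)
    also have "\<dots> \<subseteq> vanishing a b"
    proof
      fix u assume "u \<in> prod_list (map gen (Affine a b # Qs))"
      then obtain g h where gh: "g \<in> gen (Affine a b)" "h \<in> prod_list (map gen Qs)" "u = g * h"
        by (auto simp: set_times_def)
      then have "g \<in> vanishing a b" "h \<in> S" using gen_vanishing prod_gen_subset_S by blast+
      moreover obtain p q r t where "g = fn p q" "h = fn r t"
        using calculation unfolding vanishing_def S_def by blast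
      ultimately show "u \<in> vanishing a b" using vanishing_times[OF ab(2)] gh(3) by simp
    qed
    finally have "lat ?G \<subseteq> vanishing a b" by (rule lat_subset_vanishing[OF ab(2)])
    then have "c \<in> vanishing a b" using c(2) lat_incl[of c "{c}"] by blast
    then show ?thesis using A'(1) by (simp add: pq p q fn_in_vanishing)
  qed
qed

end

section \<open>Coefficientwise morphisms and constants in the rational function field\<close>

instance alg_closure :: (field) field_gcd ..

locale ring_morphism =
  fixes h :: "'a::comm_ring_1 \<Rightarrow> 'b::comm_ring_1"
  assumes h_0 [simp]: "h 0 = 0" and h_1 [simp]: "h 1 = 1"
    and h_add [simp]: "h (x + y) = h x + h y" and h_mult [simp]: "h (x * y) = h x * h y"
begin

lemma h_uminus [simp]: "h (- x) = - h x"
  using h_add[of x "- x"] by (simp add: eq_neg_iff_add_eq_0 add.commute)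

lemma h_diff [simp]: "h (x - y) = h x - h y"
  using h_add[of x "- y"] by simp

lemma h_power [simp]: "h (x ^ n) = h x ^ n"
  by (induction n) simp_all

lemma h_sum: "h (sum g A) = (\<Sum>x\<in>A. h (g x))"
  by (induction A rule: infinite_finite_induct) simp_all

lemma h_numeral [simp]: "h (numeral n) = numeral n"
proof -
  have "h (of_nat k) = of_nat k" for k by (induction k) simp_all
  from this[of "numeral n"] show ?thesis by simp
qed

lemma map_pCons [simp]: "map_poly h (pCons c p) = pCons (h c) (map_poly h p)"
  by (simp add: map_poly_pCons)

lemma map_add: "map_poly h (p + q) = map_poly h p + map_poly h q"
  by (rule poly_eqI) (simp add: coeff_map_poly)

lemma map_smult: "map_poly h (smult c p) = smult (h c) (map_poly h p)"
  by (rule poly_eqI) (simp add: coeff_map_poly)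

lemma map_mult: "map_poly h (p * q) = map_poly h p * map_poly h q"
  by (induction p) (simp_all add: map_add map_smult)

lemma ring_morphism_map_poly: "ring_morphism (map_poly h)"
  by unfold_locales (simp_all add: map_add map_mult)

lemma poly_map: "poly (map_poly h p) (h x) = h (poly p x)"
  by (induction p) simp_all

lemma ring_morphism_poly: "ring_morphism (\<lambda>p. poly (map_poly h p) y)"
  by unfold_locales (simp_all add: map_add map_mult)

end

lemma ring_morphism_poly_eval: "ring_morphism (\<lambda>p. poly p x)"
  by unfold_locales simp_all

lemma ring_morphism_const: "ring_morphism (\<lambda>c. [:c:])"
  by unfold_locales (simp_all add: one_pCons)

lemma ring_morphism_to_fract: "ring_morphism to_fract"
  by unfold_locales simp_all

lemma ring_morphism_comp: "ring_morphism g \<Longrightarrow> ring_morphism h \<Longrightarrow> ring_morphism (\<lambda>x. h (g x))"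
  by (simp add: ring_morphism_def)

text \<open>
  The embedding of the constants into the rational function field in \<open>T\<close>.
\<close>

definition cst :: "'c::field \<Rightarrow> 'c poly fract" where
  "cst c = to_fract [:c:]"

definition TT :: "'c::field poly fract" where
  "TT = to_fract [:0, 1:]"

abbreviation lift :: "'c::field poly \<Rightarrow> 'c poly fract poly" where
  "lift \<equiv> map_poly cst"

lemma ring_morphism_cst: "ring_morphism cst"
  unfolding cst_def by (rule ring_morphism_comp[OF ring_morphism_const ring_morphism_to_fract])

interpretation cst: ring_morphism cst by (rule ring_morphism_cst)

lemma cst_eq_iff [simp]: "cst a = cst b \<longleftrightarrow> a = b"
  by (simp add: cst_def)

lemma cst_eq_0_iff [simp]: "cst a = 0 \<longleftrightarrow> a = 0"
  by (simp add: cst_def)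

lemma generic_cubic_eq:
  assumes "degree B \<le> 3" "degree C \<le> 3"
  shows "generic_cubic 0 B C = smult TT (lift B) + lift C"
proof (rule poly_eqI)
  have T: "to_fract (T_coeff 0 B C i) = TT * cst (coeff B i) + cst (coeff C i)" for i
    by (simp add: T_coeff_def TT_def cst_def flip: to_fract_mult to_fract_add)
  fix i :: nat
  consider "i = 0" | "i = 1" | "i = 2" | "i = 3" | "i > 3" by linarith
  then show "coeff (generic_cubic 0 B C) i
      = coeff (smult TT (lift B) + lift C) i"
  proof cases
    case 5
    then have "coeff B i = 0" "coeff C i = 0"
      using assms by (auto intro: coeff_eq_0)
    moreover obtain j where "i = Suc (Suc (Suc (Suc j)))" using 5 by (intro that[of "i - 4"]) simp
    ultimately show ?thesis by (simp add: generic_cubic_def coeff_map_poly)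
  qed (simp_all add: generic_cubic_def coeff_map_poly T numeral_2_eq_2 numeral_3_eq_3)
qed

text \<open>
  At a singular point the vanishing of the cubic and of its derivative expresses the two lowest coefficients
  by the others, and the discriminant vanishes identically after substitution.
\<close>

lemma generic_cubic_nonsingular:
  fixes A B C :: "'c::field poly"
  assumes "Delta_ell A B C \<noteq> 0" "poly (generic_cubic A B C) a = 0"
  shows "poly (pderiv (generic_cubic A B C)) a \<noteq> 0"
proof
  assume d: "poly (pderiv (generic_cubic A B C)) a = 0"
  define b where "b i = to_fract (T_coeff A B C i)" for i
  have f: "generic_cubic A B C = [:b 0, b 1, b 2, b 3:]" by (simp add: generic_cubic_def b_def)
  have num: "to_fract (numeral n :: 'c poly) = numeral n" for n
    by (rule ring_morphism.h_numeral[OF ring_morphism_to_fract])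
  have pw: "to_fract (p ^ n) = to_fract p ^ n" for p :: "'c poly" and n
    by (rule ring_morphism.h_power[OF ring_morphism_to_fract])
  have e1: "b 1 = - (a * (2 * b 2) + a * (a * (3 * b 3)))"
    using d unfolding f by (simp add: pderiv_pCons algebra_simps eq_neg_iff_add_eq_0)
  have e0: "b 0 = - (a * b 1 + a * (a * b 2) + a * (a * (a * b 3)))"
    using assms(2) unfolding f by (simp add: algebra_simps eq_neg_iff_add_eq_0)
  have "to_fract (Delta_ell A B C) = (b 3)\<^sup>2 * (- 27 * (b 0)\<^sup>2 * (b 3)\<^sup>2 + 18 * b 0 * b 1 * b 2 * b 3
      + (b 1)\<^sup>2 * (b 2)\<^sup>2 - 4 * b 0 * (b 2)^3 - 4 * (b 1)^3 * b 3)"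
    unfolding Delta_ell_def Let_def b_def by (simp add: num pw)
  also have "\<dots> = 0"
    unfolding e0 unfolding e1 by (simp add: power2_eq_square power3_eq_cube algebra_simps)
  finally show False using assms(1) by simp
qed

lemma poly_lift_TT: "poly (lift s) TT = to_fract s"
proof (induction s)
  case (pCons c s)
  have "to_fract (pCons c s) = to_fract ([:c:] + [:0, 1:] * s)" by simp
  also have "\<dots> = cst c + TT * to_fract s" by (simp only: cst_def TT_def to_fract_add to_fract_mult)
  finally show ?case using pCons by simp
qed simp

lemma fract_cases:
  fixes x :: "'a::idom fract"
  obtains u v where "v \<noteq> 0" "x = to_fract u / to_fract v"
  by (metis Fract_cases Fract_conv_to_fract)

lemma common_denominator:
  fixes p :: "'a::idom fract poly"
  shows "\<exists>d P. d \<noteq> 0 \<and> smult (to_fract d) p = fract_poly P"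
proof (induction p)
  case 0
  show ?case by (intro exI[of _ 1] exI[of _ 0]) simp
next
  case (pCons c p)
  then obtain d P where d: "d \<noteq> 0" "smult (to_fract d) p = fract_poly P" by blast
  obtain u v where c: "v \<noteq> 0" "c = to_fract u / to_fract v" by (rule fract_cases)
  have "smult (to_fract (d * v)) (pCons c p) = fract_poly (pCons (d * u) (smult v P))"
    using c d(2)[symmetric] by (simp add: map_poly_pCons mult.commute)
  then show ?case using d c by (intro exI[of _ "d * v"] exI) auto
qed

lemma lift_prod:
  fixes A :: "'c::field multiset"
  shows "lift (linear_factors A) = (linear_factors (image_mset cst A))"
  by (induction A) (simp_all add: cst.map_mult del: mult_pCons_left mult_pCons_right)

definition splits_over :: "'a::field set \<Rightarrow> 'a poly \<Rightarrow> bool" where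
  "splits_over R p \<longleftrightarrow> (\<exists>c A. p = smult c (linear_factors A) \<and> set_mset A \<subseteq> R)"

lemma splits_over_mult: "splits_over R p \<Longrightarrow> splits_over R q \<Longrightarrow> splits_over R (p * q)"
proof -
  assume "splits_over R p" "splits_over R q"
  then obtain c A d D where "p = smult c (linear_factors A)" "set_mset A \<subseteq> R"
    "q = smult d (\<Prod>a\<in>#D. [:- a, 1:])" "set_mset D \<subseteq> R"
    unfolding splits_over_def by blast
  then show ?thesis unfolding splits_over_def
    by (intro exI[of _ "c * d"] exI[of _ "A + D"]) (simp add: mult.commute)
qed

lemma splits_over_1: "splits_over R 1"
  unfolding splits_over_def by (intro exI[of _ 1] exI[of _ "{#}"]) simp

lemma splits_over_power: "splits_over R p \<Longrightarrow> splits_over R (p ^ n)"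
  by (induction n) (auto intro: splits_over_mult splits_over_1)

lemma splits_over_lift:
  fixes c :: "'c::alg_closed_field poly"
  assumes "c \<noteq> 0"
  shows "splits_over (cst ` {a. poly c a = 0}) (lift c)"
proof -
  obtain A where A: "c = smult (lead_coeff c) (linear_factors A)"
    using alg_closed_imp_factorization[OF assms] by blast
  have "lift c = smult (cst (lead_coeff c)) (linear_factors (image_mset cst A))"
    by (subst A) (simp only: cst.map_smult lift_prod)
  moreover have "poly c a = 0" if "a \<in># A" for a
    by (subst A) (use that in \<open>auto simp: poly_prod_mset prod_mset_zero_iff\<close>)
  ultimately show ?thesis unfolding splits_over_def by fastforce
qed

lemma constant_if_algebraic:
  fixes c :: "'c::alg_closed_field poly"
  assumes "poly (lift c) x = 0" "c \<noteq> 0"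
  shows "x \<in> range cst"
proof -
  obtain k A where A: "lift c = smult k (linear_factors A)" "set_mset A \<subseteq> cst ` {a. poly c a = 0}"
    using splits_over_lift[OF assms(2)] unfolding splits_over_def by blast
  have "lift c \<noteq> 0" using assms(2) by (simp add: map_poly_eq_0_iff)
  then have "k \<noteq> 0" using A(1) by auto
  then have "x \<in># A" using assms(1) unfolding A(1) by (auto simp: poly_prod_mset prod_mset_zero_iff)
  then show ?thesis using A(2) by blast
qed

section \<open>The pencil over an algebraically closed field: independence\<close>

locale pencil =
  fixes B C :: "'c::{alg_closed_field, field_gcd, field_char_0} poly"
  assumes degree_B: "degree B \<le> 2" and degree_C: "degree C = 3"
    and B_nonzero: "B \<noteq> 0" and Delta: "Delta_ell 0 B C \<noteq> 0"
begin

abbreviation F :: "'c poly fract poly" where "F \<equiv> generic_cubic 0 B C"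

lemma F_eq: "F = smult TT (lift B) + lift C"
  using degree_B degree_C by (intro generic_cubic_eq) auto

lemma degree_F: "degree F = 3"
proof -
  have "degree (lift C) = 3" by (simp add: degree_map_poly degree_C)
  moreover have "degree (smult TT (lift B)) < 3"
    using degree_B by (intro le_less_trans[OF degree_smult_le]) (simp add: degree_map_poly)
  ultimately show ?thesis unfolding F_eq by (simp add: degree_add_eq_right)
qed

sublocale cubic_curve F
proof
  have "cst (2 :: 'c) \<noteq> 0" by (simp del: cst.h_numeral)
  then show "(2 :: 'c poly fract) \<noteq> 0" unfolding cst.h_numeral .
qed (use degree_F generic_cubic_nonsingular[OF Delta] in auto)

lemma poly_F: "poly F x = TT * poly (lift B) x + poly (lift C) x"
  by (simp add: F_eq)

lemma on_cst: "on (cst \<theta>) y \<longleftrightarrow> y\<^sup>2 = to_fract [:poly C \<theta>, poly B \<theta>:]"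
proof -
  have "to_fract [:poly C \<theta>, poly B \<theta>:] = to_fract ([:poly C \<theta>:] + [:0, 1:] * [:poly B \<theta>:])" by simp
  then have "to_fract [:poly C \<theta>, poly B \<theta>:] = cst (poly C \<theta>) + TT * cst (poly B \<theta>)"
    by (simp only: cst_def TT_def to_fract_add to_fract_mult)
  then show ?thesis by (simp add: on_def poly_F cst.poly_map add.commute)
qed

text \<open>
  A constant abscissa \<open>\<theta>\<close> makes \<open>B(\<theta>) T + C(\<theta>)\<close> a square in \<open>K(T)\<close>, which is impossible if its
  degree in \<open>T\<close> is one.
\<close>

lemma on_cst_imp_root: assumes "on (cst \<theta>) y" shows "poly B \<theta> = 0"
proof (rule ccontr)
  assume nz: "poly B \<theta> \<noteq> 0"
  obtain u v where uv: "v \<noteq> 0" "y = to_fract u / to_fract v" by (rule fract_cases)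
  then have "to_fract u = y * to_fract v" by simp
  then have "(to_fract u)\<^sup>2 = to_fract [:poly C \<theta>, poly B \<theta>:] * (to_fract v)\<^sup>2"
    using assms unfolding on_cst by (simp only: power_mult_distrib)
  then have "to_fract (u\<^sup>2) = to_fract ([:poly C \<theta>, poly B \<theta>:] * v\<^sup>2)"
    by (simp only: power2_eq_square to_fract_mult)
  then have "u\<^sup>2 = [:poly C \<theta>, poly B \<theta>:] * v\<^sup>2" by (simp only: to_fract_eq_iff)
  then show False using odd_times_square_not_square[of u "[:poly C \<theta>, poly B \<theta>:]" v] nz uv(1) by simp
qed

lemma on_cst_root: "poly B \<theta> = 0 \<Longrightarrow> on (cst \<theta>) y \<longleftrightarrow> y\<^sup>2 = cst (poly C \<theta>)"
  unfolding on_cst by (simp add: cst_def)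

text \<open>
  The generic cubic with its coefficients in the polynomials in \<open>T\<close>; the outer variable is \<open>x\<close>.
\<close>

abbreviation F0 :: "'c poly poly" where
  "F0 \<equiv> [:T_coeff 0 B C 0, T_coeff 0 B C 1, T_coeff 0 B C 2, T_coeff 0 B C 3:]"

lemma fract_poly_F0: "fract_poly F0 = F"
  by (simp add: generic_cubic_def map_poly_pCons)

lemma map_eval_F0: "map_poly (\<lambda>p. poly p t) F0 = smult t B + C"
proof (rule poly_eqI)
  interpret ev: ring_morphism "\<lambda>p. poly p t" by (rule ring_morphism_poly_eval)
  fix i :: nat
  consider "i = 0" | "i = 1" | "i = 2" | "i = 3" | "i > 3" by linarith
  then show "coeff (map_poly (\<lambda>p. poly p t) F0) i = coeff (smult t B + C) i"
  proof cases
    case 5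
    then have "coeff B i = 0" "coeff C i = 0"
      using degree_B degree_C by (auto intro: coeff_eq_0)
    moreover have "coeff F0 i = 0" using 5 by (intro coeff_eq_0) (simp add: T_coeff_def)
    moreover have "coeff (map_poly (\<lambda>p. poly p t) F0) i = poly (coeff F0 i) t"
      by (rule coeff_map_poly) simp
    ultimately show ?thesis by (simp only: coeff_add coeff_smult poly_0 mult_zero_right add_0)
  qed (simp_all add: coeff_map_poly T_coeff_def numeral_2_eq_2 numeral_3_eq_3)
qed

lemma poly_F0_const: "poly F0 [:x:] = [:poly C x, poly B x:]"
proof (rule poly_ext)
  fix t :: 'c
  interpret ev: ring_morphism "\<lambda>p. poly p t" by (rule ring_morphism_poly_eval)
  have "poly (poly F0 [:x:]) t = poly (map_poly (\<lambda>p. poly p t) F0) (poly [:x:] t)"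
    by (rule ev.poly_map[symmetric])
  then show "poly (poly F0 [:x:]) t = poly [:poly C x, poly B x:] t"
    unfolding map_eval_F0 by simp
qed

lemma all_coeffs_root_imp_smult:
  fixes P :: "'c poly poly"
  assumes "map_poly (\<lambda>p. poly p t) P = 0"
  shows "\<exists>P'. P = smult [:- t, 1:] P'"
proof -
  have "[:- t, 1:] dvd coeff P i" for i
    using arg_cong[OF assms, of "\<lambda>p. coeff p i"]
    by (simp add: coeff_map_poly poly_eq_0_iff_dvd)
  then have "[:[:- t, 1:]:] dvd P" by (simp add: const_poly_dvd_iff)
  then show ?thesis by (auto simp: dvd_def)
qed

text \<open>
  Specializing \<open>x\<close> to a constant with \<open>B(x) \<noteq> 0\<close>, the term of \<open>P\<^sup>2\<close> has even degree in \<open>T\<close> and the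
  other one odd degree. They cannot cancel to a constant unless \<open>Q\<close> vanishes there, which happens for
  infinitely many \<open>x\<close>.
\<close>

lemma norm_equation_constant:
  fixes P Q :: "'c poly poly"
  assumes eq: "P\<^sup>2 - F0 * Q\<^sup>2 = smult [:k:] (map_poly (\<lambda>c. [:c:]) E)"
  shows "Q = 0"
proof -
  have Qx: "poly Q [:x:] = 0" if "poly B x \<noteq> 0" for x
  proof (rule ccontr)
    assume nz: "poly Q [:x:] \<noteq> 0"
    define l u v where "l = [:poly C x, poly B x:]" and "u = poly P [:x:]" and "v = poly Q [:x:]"
    have "u\<^sup>2 - l * v\<^sup>2 = poly (P\<^sup>2 - F0 * Q\<^sup>2) [:x:]"
      by (simp only: l_def u_def v_def poly_diff poly_mult poly_power poly_F0_const)
    also have "\<dots> = poly (smult [:k:] (map_poly (\<lambda>c. [:c:]) E)) [:x:]"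
      by (rule arg_cong[OF eq])
    also have "\<dots> = [:k:] * poly (map_poly (\<lambda>c. [:c:]) E) [:x:]" by (rule poly_smult)
    also have "poly (map_poly (\<lambda>c. [:c:]) E) [:x:] = [:poly E x:]"
      by (induction E) (simp_all add: map_poly_pCons)
    also have "[:k:] * \<dots> = [:k * poly E x:]" by simp
    finally have e: "u\<^sup>2 - l * v\<^sup>2 = [:k * poly E x:]" .
    have nz: "v \<noteq> 0" "l \<noteq> 0" "degree l = 1" using nz that by (simp_all add: v_def l_def)
    then have d: "degree (l * v\<^sup>2) = 1 + 2 * degree v"
      by (simp add: degree_mult_eq degree_power_eq)
    then have "odd (degree (l * v\<^sup>2))" by simp
    from degree_le_square_minus_odd[OF this, of u] have "1 + 2 * degree v \<le> 0"
      unfolding e d by simp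
    then show False by simp
  qed
  have fin: "finite {x. poly B x = 0}" using B_nonzero by (rule poly_roots_finite)
  show ?thesis
  proof (rule ccontr)
    assume "Q \<noteq> 0"
    then have "finite {y. poly Q y = 0}" by (rule poly_roots_finite)
    moreover have "(\<lambda>x. [:x:]) ` (- {x. poly B x = 0}) \<subseteq> {y. poly Q y = 0}" using Qx by auto
    ultimately have "finite ((\<lambda>x. [:x:]) ` (- {x. poly B x = 0}))" by (rule finite_subset[rotated])
    then have "finite (- {x. poly B x = 0})" by (rule finite_imageD) (auto simp: inj_on_def)
    with fin have "finite (UNIV :: 'c set)" by (metis Compl_partition finite_UnI)
    then show False using infinite_UNIV_char_0 by blast
  qed
qed

text \<open>
  If \<open>h\<close> has a root \<open>t\<close>, then at \<open>T = t\<close> the equation becomes \<open>P\<^sup>2 = (t B + C) Q\<^sup>2\<close> with a cubic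
  \<open>t B + C\<close>, so \<open>P\<close> and \<open>Q\<close> vanish at \<open>T = t\<close> and \<open>(T - t)\<^sup>2\<close> can be divided out. This
  reduces to constant \<open>h\<close>.
\<close>

lemma norm_equation_polynomial:
  fixes P Q :: "'c poly poly"
  assumes "P\<^sup>2 - F0 * Q\<^sup>2 = smult h (map_poly (\<lambda>c. [:c:]) E)" "lead_coeff E = 1" "h \<noteq> 0"
  shows "Q = 0"
  using assms(1,3)
proof (induction "degree h" arbitrary: P Q h rule: less_induct)
  case less
  let ?E = "map_poly (\<lambda>c. [:c:]) E :: 'c poly poly"
  show ?case
  proof (cases "degree h = 0")
    case False
    then obtain t where t: "poly h t = 0" using alg_closed_imp_poly_has_root by blast
    interpret ev: ring_morphism "\<lambda>p. poly p t" by (rule ring_morphism_poly_eval)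
    interpret m: ring_morphism "map_poly (\<lambda>p :: 'c poly. poly p t)" by (rule ev.ring_morphism_map_poly)
    let ?m = "map_poly (\<lambda>p :: 'c poly. poly p t)"
    have "(?m P)\<^sup>2 - ?m F0 * (?m Q)\<^sup>2 = ?m (P\<^sup>2 - F0 * Q\<^sup>2)"
      by (simp only: m.h_diff m.h_mult m.h_power)
    also have "\<dots> = 0" unfolding less.prems(1) by (simp add: ev.map_smult t)
    finally have "(?m P)\<^sup>2 = (smult t B + C) * (?m Q)\<^sup>2" unfolding map_eval_F0 by simp
    moreover have "degree (smult t B + C) = 3"
      using degree_B degree_C degree_smult_le[of t B]
      by (subst degree_add_eq_right) auto
    ultimately have "?m P = 0 \<and> ?m Q = 0" by (intro odd_times_square_not_square) auto
    then obtain P' Q' where PQ: "P = smult [:- t, 1:] P'" "Q = smult [:- t, 1:] Q'"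
      using all_coeffs_root_imp_smult by blast
    have eq: "smult ([:- t, 1:]\<^sup>2) (P'\<^sup>2 - F0 * Q'\<^sup>2) = smult h ?E"
      unfolding less.prems(1)[symmetric] PQ
      by (simp add: power2_eq_square smult_diff_right del: mult_pCons_left mult_pCons_right smult_pCons)
    have "coeff ?E (degree E) = 1"
      using assms(2) by (simp add: coeff_map_poly one_pCons)
    then have "h = [:- t, 1:]\<^sup>2 * coeff (P'\<^sup>2 - F0 * Q'\<^sup>2) (degree E)"
      using arg_cong[OF eq, of "\<lambda>p. coeff p (degree E)"] by (simp only: coeff_smult mult_1_right)
    then obtain h' where h': "h = [:- t, 1:]\<^sup>2 * h'" by blast
    have h'0: "h' \<noteq> 0" using less.prems(2) h' by auto
    have "degree h = 2 + degree h'"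
      unfolding h' using h'0 by (subst degree_mult_eq) (auto simp: degree_power_eq)
    then have d: "degree h' < degree h" by simp
    have "smult ([:- t, 1:]\<^sup>2) (P'\<^sup>2 - F0 * Q'\<^sup>2) = smult ([:- t, 1:]\<^sup>2) (smult h' ?E)"
      using eq unfolding h' by (simp only: smult_smult)
    then have "smult ([:- t, 1:]\<^sup>2) (P'\<^sup>2 - F0 * Q'\<^sup>2 - smult h' ?E) = 0"
      by (simp only: smult_diff_right) simp
    then have "P'\<^sup>2 - F0 * Q'\<^sup>2 = smult h' ?E"
      by (subst (asm) smult_eq_0_iff) auto
    from less.hyps[OF d this h'0] show ?thesis using PQ by simp
  next
    case True
    then obtain k where k: "h = [:k:]" by (auto elim: degree_eq_zeroE)
    show ?thesis by (rule norm_equation_constant[OF less.prems(1)[unfolded k]])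
  qed
qed

text \<open>
  A function whose zeros all have constant abscissa is a polynomial in \<open>x\<close>. Its norm is a scalar times
  a polynomial over the constants, and clearing denominators leads to the preceding equation.
\<close>

lemma rigidity:
  assumes "set_mset A \<subseteq> range cst" "Norm p q dvd (linear_factors A)"
  shows "q = 0"
proof -
  have "Norm p q dvd smult 1 (linear_factors A)" using assms(2) by simp
  from dvd_prod_linear_factors[OF this] obtain c A' where
    c: "c \<noteq> 0" "A' \<subseteq># A" "Norm p q = smult c (linear_factors A')" by auto
  have "set_mset A' \<subseteq> range cst" using c(2) assms(1) by (meson mset_subset_eqD subset_iff)
  then have "image_mset cst (image_mset (inv_into UNIV cst) A') = image_mset id A'"
    unfolding image_mset.compositionality
    by (intro image_mset_cong) (auto simp: o_def intro: f_inv_into_f)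
  then obtain A0 where A0: "A' = image_mset cst A0" by (metis image_mset.id id_apply)
  define w where "w = (linear_factors A0)"
  have N: "Norm p q = smult c (lift w)" unfolding c(3) A0 w_def lift_prod ..
  have lcE: "lead_coeff w = 1" unfolding w_def by (induction A0) (simp_all add: lead_coeff_mult del: mult_pCons_left)
  obtain d1 P1 where d1: "d1 \<noteq> 0" "smult (to_fract d1) p = fract_poly P1"
    using common_denominator by blast
  obtain d2 Q2 where d2: "d2 \<noteq> 0" "smult (to_fract d2) q = fract_poly Q2"
    using common_denominator by blast
  define P' Q' where "P' = smult d2 P1" and "Q' = smult d1 Q2"
  let ?d = "to_fract (d1 * d2)"
  have P': "fract_poly P' = smult ?d p" unfolding P'_def by (simp flip: d1(2) add: mult.commute)
  have Q': "fract_poly Q' = smult ?d q" unfolding Q'_def by (simp flip: d2(2))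
  interpret fp: ring_morphism "fract_poly :: 'c poly poly \<Rightarrow> _"
    by (rule ring_morphism.ring_morphism_map_poly[OF ring_morphism_to_fract])
  have "fract_poly (P'\<^sup>2 - F0 * Q'\<^sup>2) = (fract_poly P')\<^sup>2 - F * (fract_poly Q')\<^sup>2"
    by (simp only: fp.h_diff fp.h_mult fp.h_power fract_poly_F0)
  also have "\<dots> = smult (?d\<^sup>2) (Norm p q)"
    unfolding P' Q' Norm_def by (simp add: power2_eq_square smult_diff_right)
  also have "\<dots> = smult (?d\<^sup>2 * c) (lift w)" unfolding N by simp
  finally have eq: "fract_poly (P'\<^sup>2 - F0 * Q'\<^sup>2) = smult (?d\<^sup>2 * c) (lift w)" .
  define M where "M = P'\<^sup>2 - F0 * Q'\<^sup>2"
  note eq = eq[folded M_def]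
  define h where "h = coeff M (degree w)"
  have "to_fract h = coeff (fract_poly M) (degree w)"
    by (simp add: h_def coeff_map_poly)
  also have "\<dots> = ?d\<^sup>2 * c" unfolding eq using lcE by (simp add: coeff_map_poly)
  finally have h: "to_fract h = ?d\<^sup>2 * c" .
  have "lift w = fract_poly (map_poly (\<lambda>c. [:c:]) w)"
    by (simp add: map_poly_map_poly o_def cst_def[abs_def])
  then have "fract_poly M = fract_poly (smult h (map_poly (\<lambda>c. [:c:]) w))"
    unfolding eq h[symmetric] by simp
  then have "P'\<^sup>2 - F0 * Q'\<^sup>2 = smult h (map_poly (\<lambda>c. [:c:]) w)"
    unfolding M_def by (simp only: fract_poly_eq_iff)
  moreover have "h \<noteq> 0" using h c(1) d1(1) d2(1) by (metis mult_eq_0_iff power_eq_0_iff to_fract_eq_0_iff)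
  ultimately have "Q' = 0" using norm_equation_polynomial lcE by blast
  then have "smult ?d q = 0" using Q' by simp
  then show ?thesis using d1(1) d2(1) by simp
qed

theorem vertical_points_independent:
  assumes Ps: "Ps \<noteq> []" "\<And>P. P \<in> set Ps \<Longrightarrow> \<exists>\<theta> y. P = Affine (cst \<theta>) y \<and> on (cst \<theta>) y"
    and sum: "add_list Ps = Infinity"
  shows "\<exists>P\<in>set Ps. neg P \<in> set Ps"
proof (rule no_relation[OF _ Ps(1) _ sum])
  fix as p q
  assume as: "\<forall>a\<in>set as. \<exists>b. Affine a b \<in> set Ps" and N: "Norm p q dvd (\<Prod>a\<leftarrow>as. [:- a, 1:])\<^sup>2"
  have "set as \<subseteq> range cst" using as Ps(2) by fastforce
  then have "set_mset (mset as + mset as) \<subseteq> range cst" by simp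
  moreover have "(\<Prod>a\<leftarrow>as. [:- a, 1:])\<^sup>2 = (linear_factors (mset as + mset as))"
    by (simp add: power2_eq_square prod_mset_prod_list flip: mset_map)
  ultimately show "q = 0" using rigidity N by metis
qed (use Ps(2) in force)

end

lemma lift_uminus: "lift (- c) = - lift c"
  by (rule ring_morphism.h_uminus[OF cst.ring_morphism_map_poly])

lemma poly_eq_sum_upto:
  fixes p :: "'a::comm_ring_1 poly"
  assumes "degree p \<le> d"
  shows "poly p x = (\<Sum>i\<le>d. coeff p i * x ^ i)"
  unfolding poly_altdef
proof (rule sum.mono_neutral_left)
  show "\<forall>i\<in>{..d} - {..degree p}. coeff p i * x ^ i = 0"
    by (simp add: coeff_eq_0)
qed (use assms in auto)

section \<open>The vertical points span up to torsion\<close>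

context pencil
begin

interpretation EE: comm_group EE by (rule comm_group_EE)

text \<open>
  The equation of the curve says that \<open>B T = y\<^sup>2 - C\<close>. Polynomials in \<open>x\<close> and \<open>y\<close> have outer variable \<open>y\<close>.
\<close>

definition T_times_B :: "'c poly poly" where "T_times_B = [:- C, 0, 1:]"

text \<open>
  The polynomial \<open>B\<^sup>d s((y\<^sup>2 - C) / B)\<close> in \<open>x\<close> and \<open>y\<close>, which equals \<open>B\<^sup>d s(T)\<close> on the curve.
\<close>

definition clear_T :: "nat \<Rightarrow> 'c poly \<Rightarrow> 'c poly poly" where
  "clear_T d s = (\<Sum>i\<le>d. [:[:coeff s i:]:] * T_times_B ^ i * [:B:] ^ (d - i))"

text \<open>
  Stated for an arbitrary morphism, in order to apply both to the evaluation at a point and to the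
  passage to functions on the curve.
\<close>

lemma clear_T_eval:
  assumes "ring_morphism e" "degree s \<le> d" "e [:B:] * t = e T_times_B"
    "ring_morphism \<iota>" "\<And>c. e [:[:c:]:] = \<iota> c"
  shows "e (clear_T d s) = e [:B:] ^ d * poly (map_poly \<iota> s) t"
proof -
  interpret e: ring_morphism e by fact
  interpret i: ring_morphism \<iota> by fact
  have "e (clear_T d s) = (\<Sum>i\<le>d. \<iota> (coeff s i) * e T_times_B ^ i * e [:B:] ^ (d - i))"
    unfolding clear_T_def e.h_sum by (simp only: e.h_mult e.h_power assms(5))
  also have "\<dots> = (\<Sum>i\<le>d. e [:B:] ^ d * (\<iota> (coeff s i) * t ^ i))"
  proof (rule sum.cong[OF refl])
    fix i assume "i \<in> {..d}"
    then have "e [:B:] ^ d = e [:B:] ^ i * e [:B:] ^ (d - i)" by (simp flip: power_add)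
    then show "\<iota> (coeff s i) * e T_times_B ^ i * e [:B:] ^ (d - i)
        = e [:B:] ^ d * (\<iota> (coeff s i) * t ^ i)"
      unfolding assms(3)[symmetric] by (simp add: power_mult_distrib ac_simps)
  qed
  also have "\<dots> = e [:B:] ^ d * (\<Sum>i\<le>d. coeff (map_poly \<iota> s) i * t ^ i)"
    by (simp add: sum_distrib_left coeff_map_poly)
  also have "(\<Sum>i\<le>d. coeff (map_poly \<iota> s) i * t ^ i) = poly (map_poly \<iota> s) t"
    using assms(2) by (intro poly_eq_sum_upto[symmetric] order_trans[OF map_poly_degree_leq]) auto
  finally show ?thesis .
qed

text \<open>
  Evaluation of a plane polynomial at a point with coordinates in \<open>K(T)\<close>.
\<close>

definition evalP :: "'c poly fract \<Rightarrow> 'c poly fract \<Rightarrow> 'c poly poly \<Rightarrow> 'c poly fract" where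
  "evalP x y g = poly (map_poly (\<lambda>c. poly (lift c) x) g) y"

text \<open>
  A plane polynomial as a function on the curve.
\<close>

definition func :: "'c poly poly \<Rightarrow> 'c poly fract poly fract alg_closure" where
  "func g = poly (map_poly (\<lambda>c. emb (lift c)) g) yy"

lemma ring_morphism_emb: "ring_morphism emb"
  by unfold_locales simp_all

lemma ring_morphism_evalP: "ring_morphism (evalP x y)"
  unfolding evalP_def by (intro ring_morphism.ring_morphism_poly cst.ring_morphism_poly)

lemma ring_morphism_emb_lift: "ring_morphism (\<lambda>c :: 'c poly. emb (lift c))"
  by (rule ring_morphism_comp[OF cst.ring_morphism_map_poly ring_morphism_emb])

lemma ring_morphism_func: "ring_morphism func"
  unfolding func_def by (intro ring_morphism.ring_morphism_poly ring_morphism_emb_lift)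

lemma evalP_pCons: "evalP x y (pCons c g) = poly (lift c) x + y * evalP x y g"
proof -
  interpret r: ring_morphism "\<lambda>c :: 'c poly. poly (lift c) x" by (rule cst.ring_morphism_poly)
  show ?thesis by (simp add: evalP_def)
qed

lemma func_pCons: "func (pCons c g) = emb (lift c) + yy * func g"
proof -
  interpret r: ring_morphism "\<lambda>c :: 'c poly. emb (lift c)" by (rule ring_morphism_emb_lift)
  show ?thesis by (simp add: func_def)
qed

lemma evalP_0 [simp]: "evalP x y 0 = 0" and func_0 [simp]: "func 0 = 0"
  by (simp_all add: evalP_def func_def)

lemma func_eq_fn:
  "\<exists>p q. func g = fn p q \<and> (\<forall>a b. on a b \<longrightarrow> evalP a b g = poly p a + poly q a * b)"
proof (induction g)
  case 0
  show ?case by (intro exI[of _ 0]) (simp add: fn_def)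
next
  case (pCons c g)
  then obtain p q where pq: "func g = fn p q" "\<And>a b. on a b \<Longrightarrow> evalP a b g = poly p a + poly q a * b"
    by blast
  have "func (pCons c g) = fn (lift c + F * q) p"
    unfolding func_pCons pq(1) yy_conv_fn emb_conv_fn fn_simps by simp
  moreover have "evalP a b (pCons c g) = poly (lift c + F * q) a + poly p a * b" if "on a b" for a b
  proof -
    have "poly F a = b * b" using that by (simp add: on_def power2_eq_square)
    then show ?thesis unfolding evalP_pCons pq(2)[OF that] by (simp add: algebra_simps)
  qed
  ultimately show ?case by blast
qed

lemma evalP_clear_T:
  assumes "on x y" "degree s \<le> d"
  shows "evalP x y (clear_T d s) = poly (lift B) x ^ d * to_fract s"
proof -
  have 1: "evalP x y [:B:] = poly (lift B) x" by (simp add: evalP_pCons)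
  have "evalP x y T_times_B = y\<^sup>2 - poly (lift C) x"
    unfolding T_times_B_def evalP_pCons by (simp add: power2_eq_square lift_uminus)
  then have 2: "evalP x y [:B:] * TT = evalP x y T_times_B"
    using assms(1) unfolding 1 by (simp add: on_def poly_F mult.commute)
  show ?thesis
    using clear_T_eval[OF ring_morphism_evalP assms(2) 2 ring_morphism_cst]
    by (simp add: 1 poly_lift_TT evalP_pCons)
qed

lemma func_clear_T:
  assumes "degree s \<le> d"
  shows "func (clear_T d s) = emb (lift B ^ d * [:to_fract s:])"
proof -
  interpret ec: ring_morphism "\<lambda>k :: 'c poly fract. emb [:k:]"
    by (rule ring_morphism_comp[OF ring_morphism_const ring_morphism_emb])
  have 1: "func [:B:] = emb (lift B)" by (simp add: func_pCons)
  have "func T_times_B = yy\<^sup>2 - emb (lift C)"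
    unfolding T_times_B_def func_pCons by (simp add: power2_eq_square lift_uminus)
  then have 2: "func [:B:] * emb [:TT:] = func T_times_B"
  proof -
    have "F - lift C = lift B * [:TT:]" by (simp add: F_eq)
    then have "emb F - emb (lift C) = emb (lift B) * emb [:TT:]" by (metis emb_simps(4,6))
    then show ?thesis using \<open>func T_times_B = _\<close> by (simp add: 1 yy_square)
  qed
  have i: "ring_morphism (\<lambda>c :: 'c. emb [:cst c:])"
    by (rule ring_morphism_comp[OF ring_morphism_cst ec.ring_morphism_axioms])
  have "func (clear_T d s) = func [:B:] ^ d * poly (map_poly (\<lambda>c :: 'c. emb [:cst c:]) s) (emb [:TT:])"
    by (rule clear_T_eval[OF ring_morphism_func assms 2 i]) (simp add: func_pCons)
  also have "map_poly (\<lambda>c. emb [:cst c:]) s = map_poly (\<lambda>k. emb [:k:]) (lift s)"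
    by (simp add: map_poly_map_poly o_def)
  also have "poly \<dots> (emb [:TT:]) = emb [:to_fract s:]"
    unfolding ec.poly_map poly_lift_TT ..
  finally show ?thesis unfolding 1 by (simp only: emb_simps)
qed

text \<open>
  The plane polynomials that vanish at a point with nonconstant abscissa form a principal ideal. A primitive
  element of least degree in \<open>y\<close> generates it: pseudo-division leaves no remainder, and the factor in \<open>x\<close>
  that it introduces is removed by Gauss's lemma.
\<close>

lemma vanishing_polynomials_principal:
  assumes "x \<notin> range cst" "g0 \<noteq> 0" "evalP x y g0 = 0"
  shows "\<exists>g. evalP x y g = 0 \<and> (\<forall>h. evalP x y h = 0 \<longrightarrow> g dvd h)"
proof -
  interpret evalP: ring_morphism "evalP x y" by (rule ring_morphism_evalP)
  have "\<exists>g. (g \<noteq> 0 \<and> evalP x y g = 0) \<and>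
      (\<forall>h. (h \<noteq> 0 \<and> evalP x y h = 0) \<longrightarrow> degree g \<le> degree h)"
    using assms(2,3) ex_has_least_nat[of "\<lambda>g. g \<noteq> 0 \<and> evalP x y g = 0" g0 degree] by blast
  then obtain g1 where g1: "g1 \<noteq> 0" "evalP x y g1 = 0"
    and least: "\<And>h. h \<noteq> 0 \<Longrightarrow> evalP x y h = 0 \<Longrightarrow> degree g1 \<le> degree h" by blast
  define g where "g = primitive_part g1"
  have g: "g1 = smult (content g1) g" unfolding g_def by (simp add: content_times_primitive_part)
  have at_smult: "evalP x y (smult c h) = poly (lift c) x * evalP x y h" for c h
    using evalP.h_mult[of "[:c:]" h] by (simp add: evalP_pCons)
  have nz: "poly (lift c) x \<noteq> 0" if "c \<noteq> 0" for c using constant_if_algebraic that assms(1) by blast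
  have "poly (lift (content g1)) x * evalP x y g = 0" using g1(2) g at_smult by metis
  then have at_g: "evalP x y g = 0" using nz g1(1) by simp
  have g0: "g \<noteq> 0" and deg: "degree g = degree g1"
    using g1(1) by (simp_all add: g_def)
  have "g dvd h" if h: "evalP x y h = 0" for h
  proof -
    obtain c q where c: "c \<noteq> 0" "smult c h = g * q + pseudo_mod h g"
      using pseudo_mod(1)[OF g0] by blast
    have "evalP x y (pseudo_mod h g) = 0"
    proof -
      have "evalP x y (pseudo_mod h g) = evalP x y (smult c h) - evalP x y (g * q)"
        unfolding c(2) by simp
      then show ?thesis using h at_g by (simp add: at_smult)
    qed
    then have "pseudo_mod h g = 0"
      using pseudo_mod(2)[OF g0, of h] least[of "pseudo_mod h g"] deg by force
    then have "smult (to_fract c) (fract_poly h) = fract_poly g * fract_poly q"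
      using arg_cong[OF c(2), of fract_poly] by simp
    then have "fract_poly g dvd fract_poly h"
      using c(1) by (metis dvd_smult_cancel dvd_triv_left to_fract_eq_0_iff)
    then show ?thesis by (rule fract_poly_dvdD) (use g1(1) in \<open>simp add: g_def\<close>)
  qed
  then show ?thesis using at_g by blast
qed

text \<open>
  For \<open>P = (x\<^sub>0, y\<^sub>0)\<close> with \<open>x\<^sub>0 = u/v\<close> not constant and \<open>y\<^sub>0 = r/s\<close> nonzero, the plane polynomials
  \<open>G = B\<^sup>d (v(T) x - u(T))\<close> and \<open>W = B\<^sup>d (s(T) y - r(T))\<close> vanish at \<open>P\<close>, so the equation \<open>g\<close> of the plane curve of \<open>P\<close> divides both.
  From \<open>G\<close> one sees that the zeros of \<open>g\<close> lie over \<open>x\<^sub>0\<close> and the roots of \<open>B\<close>, and from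
  \<open>W\<close> that \<open>g\<close> does not vanish at \<open>-P\<close>.
\<close>

theorem vertical_points_span:
  assumes H: "subgroup H EE"
    and HB: "\<And>\<theta> y. poly B \<theta> = 0 \<Longrightarrow> on (cst \<theta>) y \<Longrightarrow> Affine (cst \<theta>) y \<in> H"
    and P: "on_curve F P"
  shows "\<exists>e::nat. e > 0 \<and> P [^]\<^bsub>EE\<^esub> e \<in> H"
proof (cases P)
  case Infinity
  then show ?thesis using subgroup.one_closed[OF H] by (intro exI[of _ 1]) simp
next
  case (Affine x0 y0)
  have on: "on x0 y0" using P Affine by simp
  then have on': "on x0 (- y0)" by (simp add: on_def)
  consider "x0 \<in> range cst" | "y0 = 0" | "x0 \<notin> range cst" "y0 \<noteq> 0" by blast
  then show ?thesis
  proof cases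
    case 1
    then obtain \<theta> where "x0 = cst \<theta>" by blast
    then have "P \<in> H" using HB on on_cst_imp_root Affine by blast
    then show ?thesis using P by (intro exI[of _ 1]) simp
  next
    case 2
    then have "P \<otimes>\<^bsub>EE\<^esub> P = \<one>\<^bsub>EE\<^esub>" by (simp add: Affine)
    then have "P [^]\<^bsub>EE\<^esub> (2::nat) \<in> H"
      using subgroup.one_closed[OF H] P by (simp add: numeral_2_eq_2)
    then show ?thesis by (intro exI[of _ 2]) simp
  next
    case 3
    obtain u v where uv: "v \<noteq> 0" "x0 = to_fract u / to_fract v" by (rule fract_cases)
    obtain r s where rs: "s \<noteq> 0" "y0 = to_fract r / to_fract s" by (rule fract_cases)
    define d where "d = degree u + degree v + degree r + degree s"
    have deg: "degree u \<le> d" "degree v \<le> d" "degree r \<le> d" "degree s \<le> d"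
      by (simp_all add: d_def)
    define G where "G = clear_T d v * [:[:0, 1:]:] - clear_T d u"
    define W where "W = clear_T d s * [:0, 1:] - clear_T d r"
    interpret evalP: ring_morphism "evalP x0 y0" by (rule ring_morphism_evalP)
    interpret evalN: ring_morphism "evalP x0 (- y0)" by (rule ring_morphism_evalP)
    interpret fu: ring_morphism func by (rule ring_morphism_func)
    have Bx: "poly (lift B) x0 \<noteq> 0" using constant_if_algebraic[of B x0] B_nonzero 3(1) by blast
    have "evalP x0 y0 G = poly (lift B) x0 ^ d * (to_fract v * x0 - to_fract u)"
      unfolding G_def evalP.h_diff evalP.h_mult
      by (simp add: evalP_clear_T[OF on] deg evalP_pCons algebra_simps)
    then have atG: "evalP x0 y0 G = 0" using uv by simp
    have "evalP x0 y0 W = poly (lift B) x0 ^ d * (to_fract s * y0 - to_fract r)"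
      unfolding W_def evalP.h_diff evalP.h_mult
      by (simp add: evalP_clear_T[OF on] deg evalP_pCons algebra_simps)
    then have atW: "evalP x0 y0 W = 0" using rs by simp
    have "evalP x0 (- y0) W = poly (lift B) x0 ^ d * (- (to_fract s * y0) - to_fract r)"
      unfolding W_def evalN.h_diff evalN.h_mult
      by (simp add: evalP_clear_T[OF on'] deg evalP_pCons algebra_simps)
    also have "to_fract s * y0 = to_fract r" using rs by simp
    also have "- to_fract r - to_fract r = - (2 * to_fract r)" by simp
    finally have atW': "evalP x0 (- y0) W \<noteq> 0" using 3(2) rs Bx two_nonzero by auto
    define D where "D = lift B ^ d * [:- to_fract u, to_fract v:]"
    have funcG: "func G = emb D"
    proof -
      have "func [:[:0, 1:]:] = emb [:0, 1:]" by (simp add: func_pCons)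
      then have "func G = emb (lift B ^ d * [:to_fract v:]) * emb [:0, 1:] - emb (lift B ^ d * [:to_fract u:])"
        unfolding G_def fu.h_diff fu.h_mult func_clear_T[OF deg(1)] func_clear_T[OF deg(2)] by simp
      also have "\<dots> = emb (lift B ^ d * ([:to_fract v:] * [:0, 1:] - [:to_fract u:]))"
        by (simp only: emb_simps algebra_simps)
      finally show ?thesis by (simp add: D_def)
    qed
    have "lift B \<noteq> 0" using B_nonzero by (auto simp: map_poly_eq_0_iff)
    then have D0: "D \<noteq> 0" unfolding D_def mult_eq_0_iff power_eq_0_iff using uv(1) by simp
    then have "G \<noteq> 0" using funcG by auto
    from vanishing_polynomials_principal[OF 3(1) this atG] obtain g where
      g: "evalP x0 y0 g = 0" "g dvd G" "g dvd W" using atG atW by blast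
    have atg': "evalP x0 (- y0) g \<noteq> 0" using g(3) atW' by (auto elim!: dvdE)
    obtain w where w: "G = g * w" using g(2) by blast
    obtain p q where pq: "func g = fn p q" "\<And>a b. on a b \<Longrightarrow> evalP a b g = poly p a + poly q a * b"
      using func_eq_fn by blast
    obtain p' q' where "func w = fn p' q'" using func_eq_fn by blast
    then have "fn p q * fn p' q' = fn D 0"
      using funcG unfolding w by (simp add: pq(1) emb_conv_fn)
    from Norm_mult[OF this] have dvd: "Norm p q dvd D\<^sup>2" by (auto simp: Norm_def[of D 0] intro: dvdI[OF sym])
    \<comment> \<open>The norm of \<open>g\<close> divides the norm of \<open>G\<close>, which is \<open>D\<^sup>2\<close>; the roots of \<open>D\<close> are \<open>x0\<close> and those of \<open>B\<close>.\<close>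
    define R where "R = insert x0 (cst ` {a. poly B a = 0})"
    have "splits_over R (lift B)"
      using splits_over_lift[OF B_nonzero] unfolding splits_over_def R_def by blast
    moreover have "[:- to_fract u, to_fract v:] = smult (to_fract v) (linear_factors ({#x0#}))"
      using uv by simp
    then have "splits_over R [:- to_fract u, to_fract v:]"
      unfolding splits_over_def R_def by (metis insertI1 empty_subsetI insert_subset set_mset_single)
    ultimately have "splits_over R (D\<^sup>2)"
      unfolding D_def by (intro splits_over_power splits_over_mult)
    then obtain c A where A: "D\<^sup>2 = smult c (linear_factors A)" "set_mset A \<subseteq> R"
      unfolding splits_over_def by blast
    have "c \<noteq> 0" using A(1) D0 by auto
    from dvd_prod_linear_factors[OF dvd[unfolded A(1)] this] obtain c' A' where
      A': "c' \<noteq> 0" "A' \<subseteq># A" "Norm p q = smult c' (linear_factors A')" by blast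
    have "\<exists>e::nat. e > 0 \<and> Affine x0 y0 [^]\<^bsub>EE\<^esub> e \<in> H"
    proof (rule function_relation[OF A'(3,1) on _ _ H])
      show "poly p x0 + poly q x0 * y0 = 0" using g(1) pq(2)[OF on] by simp
      show "poly p x0 - poly q x0 * y0 \<noteq> 0" using atg' pq(2)[OF on'] by simp
      fix a b assume a: "a \<in># A'" "a \<noteq> x0" "on a b"
      then have "a \<in> R" using A'(2) A(2) by (meson mset_subset_eqD subsetD)
      then show "Affine a b \<in> H" using a(2,3) HB unfolding R_def by blast
    qed
    then show ?thesis unfolding Affine .
  qed
qed

end

section \<open>Automorphisms of the algebraic closure\<close>

text \<open>
  Subrings containing the base field. They are fields, as all elements are algebraic.
\<close>

definition intermediate :: "'k::field alg_closure set \<Rightarrow> bool" where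
  "intermediate F \<longleftrightarrow> range to_ac \<subseteq> F \<and> (\<forall>x\<in>F. \<forall>y\<in>F. x + y \<in> F \<and> x * y \<in> F)"

lemma intermediateD:
  assumes "intermediate F"
  shows "to_ac c \<in> F" "x \<in> F \<Longrightarrow> y \<in> F \<Longrightarrow> x + y \<in> F" "x \<in> F \<Longrightarrow> y \<in> F \<Longrightarrow> x * y \<in> F"
    "x \<in> F \<Longrightarrow> - x \<in> F" "x \<in> F \<Longrightarrow> y \<in> F \<Longrightarrow> x - y \<in> F" "0 \<in> F" "1 \<in> F"
proof -
  show 1: "to_ac c \<in> F" for c using assms by (auto simp: intermediate_def)
  show 2: "x \<in> F \<Longrightarrow> y \<in> F \<Longrightarrow> x + y \<in> F" "x \<in> F \<Longrightarrow> y \<in> F \<Longrightarrow> x * y \<in> F" for x y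
    using assms by (auto simp: intermediate_def)
  show 3: "x \<in> F \<Longrightarrow> - x \<in> F" for x using 2(2)[OF 1[of "-1"], of x] by simp
  show "x \<in> F \<Longrightarrow> y \<in> F \<Longrightarrow> x - y \<in> F" for x y using 2(1)[of x "- y"] 3[of y] by simp
  show "0 \<in> F" "1 \<in> F" using 1[of 0] 1[of 1] by simp_all
qed

lemma intermediate_poly: 
  assumes "intermediate F" "x \<in> F" shows "poly (map_poly to_ac p) x \<in> F"
  by (induction p) (auto simp: map_poly_pCons intro!: intermediateD[OF assms(1)] assms(2))

text \<open>
  If \<open>c + x q(x) = 0\<close> with \<open>c \<noteq> 0\<close>, then \<open>- q(x) / c\<close> is the inverse of \<open>x\<close>.
\<close>

lemma intermediate_inverse:
  assumes F: "intermediate F" and x: "x \<in> F" shows "inverse x \<in> F"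
proof (cases "x = 0")
  case True
  then show ?thesis using x by simp
next
  case False
  have "inverse x \<in> F" if "p \<noteq> 0" "poly (map_poly to_ac p) x = 0" for p
    using that
  proof (induction p)
    case (pCons c q)
    have eq: "to_ac c + x * poly (map_poly to_ac q) x = 0" using pCons.prems by (simp add: map_poly_pCons)
    show ?case
    proof (cases "c = 0")
      case True
      then show ?thesis using pCons eq False by auto
    next
      case c: False
      have "x * (- (poly (map_poly to_ac q) x * to_ac (inverse c))) = 1"
      proof -
        have "x * poly (map_poly to_ac q) x = - to_ac c" using eq by (simp add: eq_neg_iff_add_eq_0 add.commute)
        then have "x * poly (map_poly to_ac q) x * to_ac (inverse c) = - 1"
          using c by (simp flip: to_ac_mult)
        then show ?thesis by (simp add: mult.assoc)
      qed
      then have "inverse x = - (poly (map_poly to_ac q) x * to_ac (inverse c))"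
        by (rule inverse_unique)
      also have "\<dots> \<in> F"
        by (rule intermediateD(4)[OF F intermediateD(3)[OF F intermediate_poly[OF F x] intermediateD(1)[OF F]]])
      finally show ?thesis .
    qed
  qed simp
  then show ?thesis using alg_closure_algebraic[of x] by blast
qed

text \<open>
  Graphs of ring morphisms over the base field that are defined on an intermediate ring. As sets of pairs they
  are closed under unions of chains.
\<close>

definition partial_morphism :: "('k::field alg_closure \<times> 'k alg_closure) set \<Rightarrow> bool" where
  "partial_morphism G \<longleftrightarrow> (\<forall>c. (to_ac c, to_ac c) \<in> G) \<and> single_valued G \<and>
     (\<forall>x y x' y'. (x, y) \<in> G \<longrightarrow> (x', y') \<in> G \<longrightarrow> (x + x', y + y') \<in> G \<and> (x * x', y * y') \<in> G)"

lemma partial_morphismD: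
  assumes "partial_morphism G"
  shows "(to_ac c, to_ac c) \<in> G" "(x, y) \<in> G \<Longrightarrow> (x, z) \<in> G \<Longrightarrow> y = z"
    "(x, y) \<in> G \<Longrightarrow> (x', y') \<in> G \<Longrightarrow> (x + x', y + y') \<in> G"
    "(x, y) \<in> G \<Longrightarrow> (x', y') \<in> G \<Longrightarrow> (x * x', y * y') \<in> G"
proof -
  show "(to_ac c, to_ac c) \<in> G" using assms by (simp add: partial_morphism_def)
  show "y = z" if "(x, y) \<in> G" "(x, z) \<in> G"
    using that assms unfolding partial_morphism_def by (blast dest: single_valuedD)
  show "(x + x', y + y') \<in> G" if "(x, y) \<in> G" "(x', y') \<in> G"
    using that assms unfolding partial_morphism_def by blast
  show "(x * x', y * y') \<in> G" if "(x, y) \<in> G" "(x', y') \<in> G"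
    using that assms unfolding partial_morphism_def by blast
qed

lemma intermediate_Domain: "partial_morphism G \<Longrightarrow> intermediate (Domain G)"
proof -
  assume G: "partial_morphism G"
  show ?thesis
    unfolding intermediate_def
  proof (intro conjI ballI)
    show "range to_ac \<subseteq> Domain G" using partial_morphismD(1)[OF G] by blast
    fix x y assume "x \<in> Domain G" "y \<in> Domain G"
    then obtain x' y' where xy: "(x, x') \<in> G" "(y, y') \<in> G" by blast
    show "x + y \<in> Domain G" by (rule DomainI[OF partial_morphismD(3)[OF G xy]])
    show "x * y \<in> Domain G" by (rule DomainI[OF partial_morphismD(4)[OF G xy]])
  qed
qed

context
  fixes G :: "('k::field alg_closure \<times> 'k alg_closure) set"
  assumes G: "partial_morphism G"
begin

definition image_of :: "'k alg_closure \<Rightarrow> 'k alg_closure" where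
  "image_of x = (if x \<in> Domain G then THE y. (x, y) \<in> G else 0)"

lemma image_of_eq: "(x, y) \<in> G \<Longrightarrow> image_of x = y"
  using partial_morphismD(2)[OF G] unfolding image_of_def by (auto intro!: the_equality)

lemma image_of_in: "x \<in> Domain G \<Longrightarrow> (x, image_of x) \<in> G"
  using image_of_eq by auto

lemma image_of_simps:
  "image_of (to_ac c) = to_ac c" "image_of 0 = 0" "image_of 1 = 1"
  "x \<in> Domain G \<Longrightarrow> y \<in> Domain G \<Longrightarrow> image_of (x + y) = image_of x + image_of y"
  "x \<in> Domain G \<Longrightarrow> y \<in> Domain G \<Longrightarrow> image_of (x * y) = image_of x * image_of y"
proof -
  show 1: "image_of (to_ac c) = to_ac c" for c by (rule image_of_eq[OF partial_morphismD(1)[OF G]])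
  show "image_of 0 = 0" "image_of 1 = 1" using 1[of 0] 1[of 1] by simp_all
  show "x \<in> Domain G \<Longrightarrow> y \<in> Domain G \<Longrightarrow> image_of (x + y) = image_of x + image_of y"
    "x \<in> Domain G \<Longrightarrow> y \<in> Domain G \<Longrightarrow> image_of (x * y) = image_of x * image_of y"
    using partial_morphismD(3,4)[OF G] image_of_in image_of_eq by meson+
qed

lemma image_of_nonzero: assumes "x \<in> Domain G" "x \<noteq> 0" shows "image_of x \<noteq> 0"
proof -
  have "inverse x \<in> Domain G" by (rule intermediate_inverse[OF intermediate_Domain[OF G] assms(1)])
  then have "image_of (x * inverse x) = image_of x * image_of (inverse x)" using assms(1) by (intro image_of_simps)
  then show ?thesis using assms(2) image_of_simps(3) by auto
qed

definition coeffs_in :: "'k alg_closure poly \<Rightarrow> bool" where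
  "coeffs_in p \<longleftrightarrow> (\<forall>i. coeff p i \<in> Domain G)"

lemma Domain_G: "intermediate (Domain G)" by (rule intermediate_Domain[OF G])

lemma coeffs_in_pCons [simp]: "coeffs_in (pCons c p) \<longleftrightarrow> c \<in> Domain G \<and> coeffs_in p"
  unfolding coeffs_in_def by (metis coeff_pCons_0 coeff_pCons_Suc not0_implies_Suc)

lemma coeffs_in_0 [simp]: "coeffs_in 0"
  using intermediateD(6)[OF Domain_G] by (simp add: coeffs_in_def)

lemma coeffs_in_add: "coeffs_in p \<Longrightarrow> coeffs_in q \<Longrightarrow> coeffs_in (p + q)"
  unfolding coeffs_in_def coeff_add using intermediateD(2)[OF Domain_G] by blast

lemma coeffs_in_smult: "c \<in> Domain G \<Longrightarrow> coeffs_in q \<Longrightarrow> coeffs_in (smult c q)"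
  unfolding coeffs_in_def coeff_smult using intermediateD(3)[OF Domain_G] by blast

lemma coeffs_in_mult: "coeffs_in p \<Longrightarrow> coeffs_in q \<Longrightarrow> coeffs_in (p * q)"
  using intermediateD(6)[OF Domain_G] by (induction p) (simp_all add: coeffs_in_add coeffs_in_smult)

abbreviation map_image :: "'k alg_closure poly \<Rightarrow> 'k alg_closure poly" where
  "map_image \<equiv> map_poly image_of"

lemma map_image_add: "coeffs_in p \<Longrightarrow> coeffs_in q \<Longrightarrow> map_image (p + q) = map_image p + map_image q"
  by (rule poly_eqI) (simp add: coeff_map_poly image_of_simps coeffs_in_def)

lemma map_image_smult: "c \<in> Domain G \<Longrightarrow> coeffs_in q \<Longrightarrow> map_image (smult c q) = smult (image_of c) (map_image q)"
  by (rule poly_eqI) (simp add: coeff_map_poly image_of_simps coeffs_in_def)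

lemma map_image_pCons: "map_image (pCons c p) = pCons (image_of c) (map_image p)"
  by (simp add: map_poly_pCons image_of_simps)

lemma map_image_mult: "coeffs_in p \<Longrightarrow> coeffs_in q \<Longrightarrow> map_image (p * q) = map_image p * map_image q"
proof (induction p)
  case (pCons c p)
  then show ?case
    using intermediateD(6)[OF Domain_G]
    by (simp add: map_image_pCons map_image_add map_image_smult coeffs_in_smult coeffs_in_mult image_of_simps)
qed simp

text \<open>
  Let \<open>m\<close> be a nonzero polynomial of least degree over the domain with root \<open>\<alpha>\<close>, and \<open>\<beta>\<close> a root of its image. Every
  polynomial over the domain with root \<open>\<alpha>\<close> is reduced to zero by multiples of \<open>m\<close>, so its image has root
  \<open>\<beta>\<close>. Hence \<open>p(\<alpha>) \<mapsto> (image of p)(\<beta>)\<close> is well-defined.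
\<close>

lemma extend_partial_morphism:
  fixes \<alpha> :: "'k alg_closure"
  shows "\<exists>G'. partial_morphism G' \<and> G \<subseteq> G' \<and> \<alpha> \<in> Domain G'"
proof -
  have "\<exists>m. (m \<noteq> 0 \<and> coeffs_in m \<and> poly m \<alpha> = 0) \<and>
     (\<forall>p. (p \<noteq> 0 \<and> coeffs_in p \<and> poly p \<alpha> = 0) \<longrightarrow> degree m \<le> degree p)"
  proof -
    obtain p :: "'k poly" where p: "p \<noteq> 0" "poly (map_poly to_ac p) \<alpha> = 0"
      by (rule alg_closure_algebraic)
    have "coeffs_in (map_poly to_ac p)"
      unfolding coeffs_in_def using intermediateD(1)[OF Domain_G] by (simp add: coeff_map_poly)
    moreover have "map_poly to_ac p \<noteq> 0" using p(1) by (simp add: map_poly_eq_0_iff)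
    ultimately show ?thesis
      using ex_has_least_nat[of "\<lambda>m. m \<noteq> 0 \<and> coeffs_in m \<and> poly m \<alpha> = 0" "map_poly to_ac p" degree] p(2)
      by blast
  qed
  then obtain m where m: "m \<noteq> 0" "coeffs_in m" "poly m \<alpha> = 0"
    and least: "\<And>p. p \<noteq> 0 \<Longrightarrow> coeffs_in p \<Longrightarrow> poly p \<alpha> = 0 \<Longrightarrow> degree m \<le> degree p"
    by blast
  have lc: "image_of (lead_coeff m) \<noteq> 0" using m(1,2) by (intro image_of_nonzero) (auto simp: coeffs_in_def)
  have "degree m > 0"
  proof (rule ccontr)
    assume "\<not> ?thesis"
    then obtain c where "m = [:c:]" by (auto elim: degree_eq_zeroE)
    then show False using m(1,3) by simp
  qed
  moreover have "degree (map_image m) = degree m"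
    using lc by (intro map_poly_degree_eq) 
  ultimately have "degree (map_image m) > 0" by simp
  then obtain \<beta> where \<beta>: "poly (map_image m) \<beta> = 0" using alg_closed_imp_poly_has_root by blast
  have transfer: "poly (map_image p) \<beta> = 0" if "coeffs_in p" "poly p \<alpha> = 0" for p
    using that
  proof (induction "degree p" arbitrary: p rule: less_induct)
    case less
    show ?case
    proof (cases "p = 0")
      case False
      have le: "degree m \<le> degree p" using least False less.prems by blast
      define c where "c = - (lead_coeff p * inverse (lead_coeff m))"
      have cD: "c \<in> Domain G"
        using less.prems(1) m(2) unfolding c_def coeffs_in_def
        by (intro intermediateD(3,4)[OF Domain_G] intermediate_inverse[OF Domain_G]) auto
      define q where "q = smult c (monom 1 (degree p - degree m) * m)"
      have mon: "coeffs_in (monom 1 n)" for n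
        using intermediateD(6,7)[OF Domain_G] by (simp add: coeffs_in_def coeff_monom)
      have qD: "coeffs_in q"
        unfolding q_def by (intro coeffs_in_smult coeffs_in_mult mon m(2) cD)
      have q0: "poly q \<alpha> = 0" "poly (map_image q) \<beta> = 0"
        using m(3) \<beta> cD mon m(2)
        by (simp_all add: q_def map_image_smult map_image_mult coeffs_in_mult)
      have "p + q = 0 \<or> degree (p + q) < degree p"
      proof (cases "degree p = 0")
        case True
        then show ?thesis using le \<open>degree m > 0\<close> by simp
      next
        case False
        have dq: "degree q \<le> degree p"
          unfolding q_def using le
          by (intro order_trans[OF degree_smult_le] order_trans[OF degree_mult_le]) (simp add: degree_monom_eq)
        have "coeff q (degree p) = - lead_coeff p"
          using m(1) le by (simp add: q_def coeff_monom_mult c_def)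
        then have "coeff (p + q) (degree p) = 0" by simp
        moreover have "degree (p + q) \<le> degree p" using dq by (intro degree_add_le) auto
        ultimately show ?thesis using False by (metis leading_coeff_0_iff order_le_imp_less_or_eq)
      qed
      then have "poly (map_image (p + q)) \<beta> = 0"
        using less.hyps[of "p + q"] less.prems q0(1) coeffs_in_add[OF less.prems(1) qD] by auto
      then show ?thesis using q0(2) by (simp add: map_image_add less.prems(1) qD)
    qed simp
  qed
  define G' where "G' = {(poly p \<alpha>, poly (map_image p) \<beta>) | p. coeffs_in p}"
  have G'I: "coeffs_in p \<Longrightarrow> (poly p \<alpha>, poly (map_image p) \<beta>) \<in> G'" for p by (auto simp: G'_def)
  have sub: "(x, y) \<in> G'" if "(x, y) \<in> G" for x y
    using G'I[of "[:x:]"] that image_of_eq[OF that] by (auto simp: map_image_pCons)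
  have "single_valued G'"
  proof (rule single_valuedI)
    fix x y z assume "(x, y) \<in> G'" "(x, z) \<in> G'"
    then obtain p q where pq: "coeffs_in p" "coeffs_in q" "x = poly p \<alpha>" "x = poly q \<alpha>"
      "y = poly (map_image p) \<beta>" "z = poly (map_image q) \<beta>" by (auto simp: G'_def)
    have D1: "- 1 \<in> Domain G" using intermediateD(4,7)[OF Domain_G] by blast
    have "image_of (- 1) = - 1" using image_of_simps(1)[of "- 1"] by simp
    then have "map_image (p + smult (- 1) q) = map_image p - map_image q"
      using pq(1,2) D1 by (simp only: map_image_add map_image_smult coeffs_in_smult) simp
    moreover have "poly (map_image (p + smult (- 1) q)) \<beta> = 0"
      using pq D1 by (intro transfer coeffs_in_add coeffs_in_smult) auto
    ultimately show "y = z" using pq by simp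
  qed
  moreover have "(x + x', y + y') \<in> G' \<and> (x * x', y * y') \<in> G'"
    if "(x, y) \<in> G'" "(x', y') \<in> G'" for x y x' y'
  proof -
    from that obtain p q where pq: "coeffs_in p" "coeffs_in q" "x = poly p \<alpha>" "x' = poly q \<alpha>"
      "y = poly (map_image p) \<beta>" "y' = poly (map_image q) \<beta>" by (auto simp: G'_def)
    then show ?thesis using G'I[OF coeffs_in_add[OF pq(1,2)]] G'I[OF coeffs_in_mult[OF pq(1,2)]]
      by (simp add: map_image_add map_image_mult)
  qed
  ultimately have "partial_morphism G'"
    unfolding partial_morphism_def using sub partial_morphismD(1)[OF G] by blast
  moreover have "G \<subseteq> G'" using sub by auto
  moreover have "\<alpha> \<in> Domain G'"
    using G'I[of "[:0, 1:]"] intermediateD(6,7)[OF Domain_G] by (auto simp: Domain_iff)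
  ultimately show ?thesis by blast
qed

end

lemma partial_morphism_Union:
  assumes "subset.chain {G. partial_morphism G} Cs" "Cs \<noteq> {}"
  shows "partial_morphism (\<Union>Cs)"
proof -
  have Cs: "partial_morphism G" if "G \<in> Cs" for G
    using assms(1) that by (auto simp: subset_chain_def)
  have common: "\<exists>G\<in>Cs. a \<in> G \<and> b \<in> G" if "a \<in> \<Union>Cs" "b \<in> \<Union>Cs" for a b
    using that assms(1) unfolding subset_chain_def by blast
  show ?thesis
    unfolding partial_morphism_def
  proof (intro conjI allI impI)
    show "(to_ac c, to_ac c) \<in> \<Union>Cs" for c
      using assms(2) partial_morphismD(1)[OF Cs] by blast
    show "single_valued (\<Union>Cs)"
    proof (rule single_valuedI)
      fix x y z assume "(x, y) \<in> \<Union>Cs" "(x, z) \<in> \<Union>Cs"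
      then obtain G where "G \<in> Cs" "(x, y) \<in> G" "(x, z) \<in> G" using common by blast
      then show "y = z" using partial_morphismD(2)[OF Cs] by blast
    qed
    fix x y x' y' assume "(x, y) \<in> \<Union>Cs" "(x', y') \<in> \<Union>Cs"
    then obtain G where G: "G \<in> Cs" "(x, y) \<in> G" "(x', y') \<in> G" using common by blast
    show "(x + x', y + y') \<in> \<Union>Cs"
      by (rule UnionI[OF G(1) partial_morphismD(3)[OF Cs[OF G(1)] G(2,3)]])
    show "(x * x', y * y') \<in> \<Union>Cs"
      by (rule UnionI[OF G(1) partial_morphismD(4)[OF Cs[OF G(1)] G(2,3)]])
  qed
qed

text \<open>
  A morphism over the base field permutes the finitely many roots of each polynomial over it, which gives
  surjectivity.
\<close>

lemma total_morphism_in_absolute_galois: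
  assumes "ring_morphism \<sigma>" "\<And>c. \<sigma> (to_ac c) = to_ac c"
  shows "\<sigma> \<in> absolute_galois"
proof -
  interpret \<sigma>: ring_morphism \<sigma> by fact
  have inj: "inj \<sigma>"
  proof (rule injI)
    fix x y assume "\<sigma> x = \<sigma> y"
    then have "\<sigma> (x - y) = 0" by simp
    moreover have "\<sigma> (x - y) * \<sigma> (inverse (x - y)) = 1" if "x \<noteq> y"
      by (simp only: \<sigma>.h_mult[symmetric]) (use that in simp)
    ultimately show "x = y" by force
  qed
  have "y \<in> range \<sigma>" for y
  proof -
    obtain p where p: "p \<noteq> 0" "poly (map_poly to_ac p) y = 0" by (rule alg_closure_algebraic)
    let ?Z = "{x. poly (map_poly to_ac p) x = 0}"
    have fin: "finite ?Z" using p(1) by (intro poly_roots_finite) (simp add: map_poly_eq_0_iff)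
    have "map_poly \<sigma> (map_poly to_ac p) = map_poly to_ac p"
      by (simp add: map_poly_map_poly o_def assms(2))
    then have "\<sigma> ` ?Z \<subseteq> ?Z" using \<sigma>.poly_map[of "map_poly to_ac p"] by auto
    then have "\<sigma> ` ?Z = ?Z"
      by (intro card_seteq[OF fin]) (auto simp: card_image inj_on_subset[OF inj])
    then show ?thesis using p(2) by blast
  qed
  then have "bij \<sigma>" using inj by (auto simp: bij_def)
  then show ?thesis
    using assms(2) by (simp add: absolute_galois_def ring_iso_def ring_hom_def ring_of_type_algebra_def)
qed

text \<open>
  By Zorn's lemma there is a maximal extension, and it is defined everywhere.
\<close>

theorem extend_to_absolute_galois:
  assumes "partial_morphism G0"
  shows "\<exists>\<sigma>\<in>absolute_galois. \<forall>x y. (x, y) \<in> G0 \<longrightarrow> \<sigma> x = y"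
proof -
  have "\<exists>M\<in>{G. partial_morphism G \<and> G0 \<subseteq> G}. \<forall>H\<in>{G. partial_morphism G \<and> G0 \<subseteq> G}. M \<subseteq> H \<longrightarrow> H = M"
  proof (rule subset_Zorn_nonempty)
    show "{G. partial_morphism G \<and> G0 \<subseteq> G} \<noteq> {}" using assms by blast
    fix Cs assume Cs: "Cs \<noteq> {}" "subset.chain {G. partial_morphism G \<and> G0 \<subseteq> G} Cs"
    then have "subset.chain {G. partial_morphism G} Cs" by (auto simp: subset_chain_def)
    from partial_morphism_Union[OF this Cs(1)] have "partial_morphism (\<Union>Cs)" .
    moreover obtain H where "H \<in> Cs" using Cs(1) by blast
    then have "G0 \<subseteq> \<Union>Cs" using Cs(2) unfolding subset_chain_def by blast
    ultimately show "\<Union>Cs \<in> {G. partial_morphism G \<and> G0 \<subseteq> G}" by simp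
  qed
  then obtain G where GM: "G \<in> {G. partial_morphism G \<and> G0 \<subseteq> G}"
    and max0: "\<forall>H\<in>{G. partial_morphism G \<and> G0 \<subseteq> G}. G \<subseteq> H \<longrightarrow> H = G" by (rule bexE)
  have G: "partial_morphism G" "G0 \<subseteq> G" using GM by simp_all
  have max: "H = G" if "partial_morphism H" "G0 \<subseteq> H" "G \<subseteq> H" for H
    using max0 that by simp
  have dom: "\<alpha> \<in> Domain G" for \<alpha>
  proof -
    obtain G' where G': "partial_morphism G'" "G \<subseteq> G'" "\<alpha> \<in> Domain G'"
      using extend_partial_morphism[OF G(1), of \<alpha>] by blast
    have "G' = G" by (rule max[OF G'(1) subset_trans[OF G(2) G'(2)] G'(2)])
    then show ?thesis using G'(3) by simp
  qed
  have "ring_morphism (image_of G)"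
    by unfold_locales (simp_all add: image_of_simps[OF G(1)] dom)
  then have "image_of G \<in> absolute_galois"
    by (rule total_morphism_in_absolute_galois) (simp add: image_of_simps[OF G(1)])
  moreover have "image_of G x = y" if "(x, y) \<in> G0" for x y
    using that G(2) image_of_eq[OF G(1)] by blast
  ultimately show ?thesis by blast
qed

text \<open>
  The conjugation \<open>u + v s \<mapsto> u - v s\<close> of a quadratic extension extends to the algebraic closure.
\<close>

theorem quadratic_conjugation:
  assumes F: "intermediate F" and s: "s \<notin> F" "s\<^sup>2 \<in> F"
  shows "\<exists>\<sigma>\<in>absolute_galois. (\<forall>x\<in>F. \<sigma> x = x) \<and> \<sigma> s = - s"
proof -
  note FD = intermediateD[OF F]
  define G where "G = {(u + v * s, u - v * s) | u v. u \<in> F \<and> v \<in> F}"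
  have GI: "(u + v * s, u - v * s) \<in> G" if "u \<in> F" "v \<in> F" for u v
    using that by (auto simp: G_def)
  have "partial_morphism G"
    unfolding partial_morphism_def
  proof (intro conjI allI impI)
    show "(to_ac c, to_ac c) \<in> G" for c using GI[OF FD(1)[of c] FD(6)] by simp
    show "single_valued G"
    proof (rule single_valuedI)
      fix x y z assume "(x, y) \<in> G" "(x, z) \<in> G"
      then obtain u v u' v' where uv: "u \<in> F" "v \<in> F" "u' \<in> F" "v' \<in> F"
        "x = u + v * s" "x = u' + v' * s" "y = u - v * s" "z = u' - v' * s" by (auto simp: G_def)
      have "v = v'"
      proof (rule ccontr)
        assume ne: "v \<noteq> v'"
        have "(v - v') * s = u' - u" using uv(5,6) by (simp add: algebra_simps)
        then have "s = (u' - u) * inverse (v - v')" using ne by (simp add: field_simps)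
        then show False using s(1) uv FD(3,5) intermediate_inverse[OF F] by simp
      qed
      then show "y = z" using uv by simp
    qed
    fix x y x' y' assume "(x, y) \<in> G" "(x', y') \<in> G"
    then obtain u v u' v' where uv: "u \<in> F" "v \<in> F" "u' \<in> F" "v' \<in> F"
      "x = u + v * s" "y = u - v * s" "x' = u' + v' * s" "y' = u' - v' * s" by (auto simp: G_def)
    show "(x + x', y + y') \<in> G"
      using GI[OF FD(2)[OF uv(1,3)] FD(2)[OF uv(2,4)]] by (simp add: uv(5-8) algebra_simps)
    have "(u * u' + v * v' * s\<^sup>2 + (u * v' + v * u') * s, u * u' + v * v' * s\<^sup>2 - (u * v' + v * u') * s) \<in> G"
      by (intro GI FD(2,3) uv s)
    then show "(x * x', y * y') \<in> G"
      by (simp add: uv(5-8) algebra_simps power2_eq_square)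
  qed
  from extend_to_absolute_galois[OF this] obtain \<sigma> where
    \<sigma>: "\<sigma> \<in> absolute_galois" "\<And>x y. (x, y) \<in> G \<Longrightarrow> \<sigma> x = y" by blast
  have "\<sigma> x = x" if "x \<in> F" for x using \<sigma>(2)[OF GI[OF that FD(6)]] by simp
  moreover have "\<sigma> s = - s" using \<sigma>(2)[OF GI[OF FD(6,7)]] by simp
  ultimately show ?thesis using \<sigma>(1) by blast
qed

lemma absolute_galoisD:
  fixes \<sigma> :: "'a::field alg_closure \<Rightarrow> 'a alg_closure"
  assumes "\<sigma> \<in> absolute_galois"
  shows "ring_morphism \<sigma>" "\<sigma> (to_ac c) = to_ac c" "inj \<sigma>"
proof -
  let ?R = "ring_of_type_algebra :: 'a alg_closure ring"
  have hom: "\<sigma> \<in> ring_hom ?R ?R" and bij: "bij_betw \<sigma> (carrier ?R) (carrier ?R)"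
    and fix_base: "\<And>c. \<sigma> (to_ac c) = to_ac c"
    using assms unfolding absolute_galois_def ring_iso_def by blast+
  have R: "carrier ?R = UNIV" "x \<oplus>\<^bsub>?R\<^esub> y = x + y" "x \<otimes>\<^bsub>?R\<^esub> y = x * y" "\<one>\<^bsub>?R\<^esub> = 1" for x y
    by (simp_all add: ring_of_type_algebra_def)
  have add: "\<sigma> (x + y) = \<sigma> x + \<sigma> y" for x y
    using ring_hom_add[OF hom, of x y] unfolding R by simp
  have mult: "\<sigma> (x * y) = \<sigma> x * \<sigma> y" for x y
    using ring_hom_mult[OF hom, of x y] unfolding R by simp
  have one: "\<sigma> 1 = 1" using ring_hom_one[OF hom] unfolding R .
  have "\<sigma> 0 = 0" using add[of 0 0] unfolding add_0_right add_cancel_right_right .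
  then show "ring_morphism \<sigma>" using one add mult by unfold_locales
  show "\<sigma> (to_ac c) = to_ac c" by (rule fix_base)
  show "inj \<sigma>" using bij unfolding R by (rule bij_betw_imp_inj_on)
qed

lemma adjoin_properties:
  fixes \<theta> :: "'a::field alg_closure"
  shows "intermediate (adjoin \<theta>)" "\<theta> \<in> adjoin \<theta>"
proof -
  let ?R = "ring_of_type_algebra :: 'a alg_closure ring"
  have R: "x \<oplus>\<^bsub>?R\<^esub> y = x + y" "x \<otimes>\<^bsub>?R\<^esub> y = x * y" for x y
    by (simp_all add: ring_of_type_algebra_def)
  have "x + y \<in> adjoin \<theta>" "x * y \<in> adjoin \<theta>" if "x \<in> adjoin \<theta>" "y \<in> adjoin \<theta>" for x y
    using generate_field.eng_add[of x ?R _ y] generate_field.eng_mult[of x ?R _ y] that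
    unfolding adjoin_def R by blast+
  moreover have "x \<in> adjoin \<theta>" if "x \<in> insert \<theta> (range to_ac)" for x
    unfolding adjoin_def using that by (rule generate_field.incl)
  ultimately show "intermediate (adjoin \<theta>)" "\<theta> \<in> adjoin \<theta>"
    unfolding intermediate_def by blast+
qed

lemma adjoin_subset:
  fixes \<theta> :: "'a::field alg_closure"
  assumes F: "intermediate F" "\<theta> \<in> F" shows "adjoin \<theta> \<subseteq> F"
proof
  interpret R: field "ring_of_type_algebra :: 'a alg_closure ring" by (rule field_from_type_algebra)
  fix x assume "x \<in> adjoin \<theta>"
  then show "x \<in> F"
    unfolding adjoin_def
  proof induction
    case one
    then show ?case using intermediateD(7)[OF F(1)] by (simp add: ring_of_type_algebra_def)
  next
    case (incl h)
    then show ?case using F intermediateD(1)[OF F(1)] by auto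
  next
    case (a_inv h)
    have "\<ominus>\<^bsub>ring_of_type_algebra\<^esub> h = - h"
      by (rule R.minus_equality) (simp_all add: ring_of_type_algebra_def)
    then show ?case using a_inv intermediateD(4)[OF F(1)] by simp
  next
    case (m_inv h)
    have "inv\<^bsub>ring_of_type_algebra\<^esub> h = inverse h"
      by (rule R.comm_inv_char) (use m_inv(2) in \<open>simp_all add: ring_of_type_algebra_def\<close>)
    then show ?case using m_inv intermediate_inverse[OF F(1)] by simp
  next
    case (eng_add h1 h2)
    then show ?case using intermediateD(2)[OF F(1)] by (simp add: ring_of_type_algebra_def)
  next
    case (eng_mult h1 h2)
    then show ?case using intermediateD(3)[OF F(1)] by (simp add: ring_of_type_algebra_def)
  qed
qed

section \<open>The rank of an abelian group\<close>

text \<open>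
  Elimination of one coordinate by cross multiplication.
\<close>

lemma integer_linear_dependence:
  fixes n :: "'i \<Rightarrow> 'j \<Rightarrow> int"
  assumes "finite J" "finite I" "card J < card I"
  shows "\<exists>c. (\<exists>i\<in>I. c i \<noteq> 0) \<and> (\<forall>j\<in>J. (\<Sum>i\<in>I. c i * n i j) = 0)"
  using assms
proof (induction J arbitrary: I n rule: finite_induct)
  case empty
  then obtain i where "i \<in> I" by fastforce
  then show ?case by (intro exI[of _ "\<lambda>_. 1"]) auto
next
  case (insert j J)
  have lt: "card J < card I" using insert.prems insert.hyps by simp
  show ?case
  proof (cases "\<forall>i\<in>I. n i j = 0")
    case True
    then show ?thesis using insert.IH[OF insert.prems(1) lt, of n] by auto
  next
    case False
    then obtain i0 where i0: "i0 \<in> I" "n i0 j \<noteq> 0" by blast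
    let ?I = "I - {i0}"
    have fin: "finite ?I" using insert.prems by simp
    have "card J < card ?I" using insert.prems insert.hyps i0 by simp
    from insert.IH[OF fin this, of "\<lambda>i j'. n i0 j * n i j' - n i j * n i0 j'"] obtain c where
      c: "\<exists>i\<in>?I. c i \<noteq> 0" "\<And>j'. j' \<in> J \<Longrightarrow> (\<Sum>i\<in>?I. c i * (n i0 j * n i j' - n i j * n i0 j')) = 0" by blast
    define d where "d i = (if i = i0 then - (\<Sum>i\<in>?I. c i * n i j) else n i0 j * c i)" for i
    have split: "(\<Sum>i\<in>I. d i * n i j') = (\<Sum>i\<in>?I. c i * (n i0 j * n i j' - n i j * n i0 j'))" for j'
    proof -
      have "(\<Sum>i\<in>I. d i * n i j') = d i0 * n i0 j' + (\<Sum>i\<in>?I. d i * n i j')"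
        using insert.prems(1) i0(1) by (rule sum.remove)
      also have "(\<Sum>i\<in>?I. d i * n i j') = (\<Sum>i\<in>?I. n i0 j * c i * n i j')"
        by (rule sum.cong) (auto simp: d_def)
      also have "d i0 * n i0 j' = - (\<Sum>i\<in>?I. c i * n i j * n i0 j')"
        by (simp add: d_def sum_distrib_right)
      finally show ?thesis by (simp add: algebra_simps sum_subtractf)
    qed
    have "\<exists>i\<in>I. d i \<noteq> 0" using c(1) i0(2) by (auto simp: d_def)
    moreover have "\<forall>j'\<in>insert j J. (\<Sum>i\<in>I. d i * n i j') = 0"
      unfolding split using c(2) by (auto simp: mult.commute)
    ultimately show ?thesis by blast
  qed
qed

text \<open>
  The integral combination of the family \<open>g\<close>, in multiplicative notation. The index set keeps coefficients apart
  from group elements.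
\<close>

definition (in comm_group) combination :: "'i set \<Rightarrow> ('i \<Rightarrow> 'a) \<Rightarrow> ('i \<Rightarrow> int) \<Rightarrow> 'a" where
  "combination I g n = (\<Otimes>i\<in>I. g i [^] n i)"

context comm_group
begin

lemma combination_closed: "g \<in> I \<rightarrow> carrier G \<Longrightarrow> combination I g n \<in> carrier G"
  unfolding combination_def by (intro finprod_closed) auto

lemma combination_add:
  assumes "g \<in> I \<rightarrow> carrier G"
  shows "combination I g (\<lambda>i. m i + n i) = combination I g m \<otimes> combination I g n"
proof -
  have "combination I g (\<lambda>i. m i + n i) = (\<Otimes>i\<in>I. g i [^] m i \<otimes> g i [^] n i)"
    unfolding combination_def by (rule finprod_cong') (use assms in \<open>auto simp: int_pow_mult Pi_iff\<close>)
  also have "\<dots> = combination I g m \<otimes> combination I g n"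
    unfolding combination_def by (rule finprod_multf) (use assms in auto)
  finally show ?thesis .
qed

lemma combination_zero: "g \<in> I \<rightarrow> carrier G \<Longrightarrow> combination I g (\<lambda>i. 0) = \<one>"
  unfolding combination_def by (simp add: finprod_one)

lemma combination_uminus:
  assumes "g \<in> I \<rightarrow> carrier G"
  shows "combination I g (\<lambda>i. - n i) = inv combination I g n"
proof -
  have "combination I g (\<lambda>i. - n i) \<otimes> combination I g n = \<one>"
    using combination_add[OF assms, of "\<lambda>i. - n i" n] combination_zero[OF assms] by simp
  then show ?thesis using combination_closed[OF assms] by (simp add: inv_equality)
qed

lemma combination_nat_pow:
  assumes "g \<in> I \<rightarrow> carrier G"
  shows "combination I g n [^] (k::nat) = combination I g (\<lambda>i. int k * n i)"
proof (induction k)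
  case 0
  then show ?case using combination_zero[OF assms] by simp
next
  case (Suc k)
  have "combination I g n [^] Suc k = combination I g (\<lambda>i. int k * n i) \<otimes> combination I g n"
    using Suc by simp
  also have "\<dots> = combination I g (\<lambda>i. int k * n i + n i)" by (rule combination_add[OF assms, symmetric])
  finally show ?case by (simp add: algebra_simps)
qed

lemma combination_int_pow:
  assumes "g \<in> I \<rightarrow> carrier G"
  shows "combination I g n [^] (k::int) = combination I g (\<lambda>i. k * n i)"
proof (cases k rule: int_cases2)
  case (nonneg j)
  then show ?thesis using combination_nat_pow[OF assms] by (simp add: int_pow_int)
next
  case (nonpos j)
  have "combination I g n [^] k = inv (combination I g n [^] int j)"
    unfolding nonpos by (rule int_pow_neg[OF combination_closed[OF assms]])
  also have "\<dots> = inv combination I g (\<lambda>i. int j * n i)"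
    using combination_nat_pow[OF assms] by (simp add: int_pow_int)
  finally show ?thesis using combination_uminus[OF assms, of "\<lambda>i. int j * n i"] nonpos by simp
qed

lemma combination_sum:
  assumes "g \<in> I \<rightarrow> carrier G" "finite T"
  shows "(\<Otimes>t\<in>T. combination I g (n t) [^] (c t :: int)) = combination I g (\<lambda>i. \<Sum>t\<in>T. c t * n t i)"
  using assms(2)
proof (induction T rule: finite_induct)
  case empty
  then show ?case using combination_zero[OF assms(1)] by simp
next
  case (insert t T)
  have "(\<Otimes>t\<in>insert t T. combination I g (n t) [^] c t)
      = combination I g (n t) [^] c t \<otimes> (\<Otimes>t\<in>T. combination I g (n t) [^] c t)"
    using insert.hyps combination_closed[OF assms(1)] by (intro finprod_insert) auto
  also have "\<dots> = combination I g (\<lambda>i. c t * n t i + (\<Sum>t\<in>T. c t * n t i))"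
    unfolding insert.IH unfolding combination_int_pow[OF assms(1)] by (rule combination_add[OF assms(1), symmetric])
  finally show ?case using insert.hyps by simp
qed

text \<open>
  More than \<open>card I\<close> elements have multiples that are integral combinations of \<open>card I\<close> elements, and a linear
  dependence of the coefficient vectors is a relation.
\<close>

theorem group_rank_eq_card:
  assumes "finite I" "g \<in> I \<rightarrow> carrier G"
    and indep: "\<And>n. combination I g n = \<one> \<Longrightarrow> \<forall>i\<in>I. n i = 0"
    and span: "\<And>x. x \<in> carrier G \<Longrightarrow> \<exists>(e::nat) n. e > 0 \<and> x [^] e = combination I g n"
  shows "group_rank G = enat (card I)"
proof (rule antisym)
  show "group_rank G \<le> enat (card I)"
    unfolding group_rank_def
  proof (rule SUP_least)
    fix T assume "T \<in> {S. Z_independent G S}"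
    then have T: "finite T" "T \<subseteq> carrier G"
      "\<And>n :: 'a \<Rightarrow> int. (\<Otimes>x\<in>T. x [^] n x) = \<one> \<Longrightarrow> \<forall>x\<in>T. n x = 0" by (auto simp: Z_independent_def)
    show "enat (card T) \<le> enat (card I)"
    proof (rule ccontr)
      assume "\<not> ?thesis"
      then have lt: "card I < card T" by simp
      have "\<forall>t\<in>T. \<exists>e n. (e::nat) > 0 \<and> t [^] e = combination I g n" using span T(2) by blast
      then obtain e n where en: "\<And>t. t \<in> T \<Longrightarrow> (e t :: nat) > 0 \<and> t [^] e t = combination I g (n t)"
        by metis
      obtain c where c: "\<exists>t\<in>T. c t \<noteq> 0" "\<And>i. i \<in> I \<Longrightarrow> (\<Sum>t\<in>T. c t * n t i) = 0"
        using integer_linear_dependence[OF assms(1) T(1) lt, of n] by blast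
      have "(\<Otimes>t\<in>T. t [^] (int (e t) * c t)) = (\<Otimes>t\<in>T. combination I g (n t) [^] c t)"
      proof (rule finprod_cong')
        show "(\<lambda>t. combination I g (n t) [^] c t) \<in> T \<rightarrow> carrier G"
          using combination_closed[OF assms(2)] by auto
        fix t assume t: "t \<in> T"
        then have "t [^] (int (e t) * c t) = (t [^] int (e t)) [^] c t"
          using T(2) by (intro int_pow_pow[symmetric]) auto
        then show "t [^] (int (e t) * c t) = combination I g (n t) [^] c t"
          using en[OF t] by (simp add: int_pow_int)
      qed simp
      also have "\<dots> = combination I g (\<lambda>i. \<Sum>t\<in>T. c t * n t i)" by (rule combination_sum[OF assms(2) T(1)])
      also have "\<dots> = combination I g (\<lambda>i. 0)"
        unfolding combination_def using assms(2) c(2) by (intro finprod_cong') auto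
      also have "\<dots> = \<one>" by (rule combination_zero[OF assms(2)])
      finally have "\<forall>t\<in>T. int (e t) * c t = 0" by (rule T(3))
      then show False using c(1) en by (metis mult_eq_0_iff of_nat_eq_0_iff not_gr_zero)
    qed
  qed
  \<comment> \<open>A repeated member of the family would give a relation with the coefficients 1 and -1.\<close>
  have inj: "inj_on g I"
  proof (rule inj_onI, rule ccontr)
    fix i j assume ij: "i \<in> I" "j \<in> I" "g i = g j" "i \<noteq> j"
    let ?d = "\<lambda>k x. if x = k then (1::int) else 0"
    have one: "combination I g (?d k) = g k" if "k \<in> I" for k
    proof -
      have "combination I g (?d k) = (\<Otimes>i\<in>I. if k = i then g i else \<one>)"
        unfolding combination_def using assms(2) that by (intro finprod_cong') (auto simp: Pi_iff)
      then show ?thesis using finprod_singleton[OF that assms(1), of g] assms(2) by simp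
    qed
    have "combination I g (\<lambda>x. ?d i x + - ?d j x) = g i \<otimes> inv g j"
      unfolding combination_add[OF assms(2)] combination_uminus[OF assms(2)] using one ij by simp
    also have "\<dots> = \<one>" using ij assms(2) by (auto intro: r_inv)
    finally have "\<forall>x\<in>I. ?d i x + - ?d j x = 0" by (rule indep)
    then show False using ij by auto
  qed
  have "Z_independent G (g ` I)"
    unfolding Z_independent_def
  proof (intro conjI allI impI)
    show "finite (g ` I)" "g ` I \<subseteq> carrier G" using assms(1,2) by auto
    fix n :: "'a \<Rightarrow> int" assume "(\<Otimes>x\<in>g ` I. x [^] n x) = \<one>"
    moreover have "(\<Otimes>x\<in>g ` I. x [^] n x) = combination I g (\<lambda>i. n (g i))"
      unfolding combination_def using assms(2) by (intro finprod_reindex inj) auto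
    ultimately show "\<forall>x\<in>g ` I. n x = 0" using indep by auto
  qed
  then have "enat (card (g ` I)) \<le> group_rank G"
    unfolding group_rank_def by (intro SUP_upper) simp
  then show "enat (card I) \<le> group_rank G" using card_image[OF inj] by simp
qed

end

section \<open>A basis up to torsion over the algebraic closure\<close>

context pencil
begin

interpretation EE: comm_group EE by (rule comm_group_EE)

definition vertical :: "'c set" where
  "vertical = {\<theta>. poly B \<theta> = 0 \<and> poly C \<theta> \<noteq> 0}"

lemma finite_vertical: "finite vertical"
  unfolding vertical_def using poly_roots_finite[OF B_nonzero] by (rule finite_subset[rotated]) auto

context
  fixes sq :: "'c \<Rightarrow> 'c"
  assumes sq: "\<And>\<theta>. (sq \<theta>)\<^sup>2 = poly C \<theta>"
begin

definition VP :: "'c \<Rightarrow> 'c poly fract point" where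
  "VP \<theta> = Affine (cst \<theta>) (cst (sq \<theta>))"

lemma on_VP: "poly B \<theta> = 0 \<Longrightarrow> on (cst \<theta>) (cst (sq \<theta>))"
  by (simp add: on_cst_root sq[symmetric])

lemma VP_carrier: "VP \<in> vertical \<rightarrow> carrier EE"
  using on_VP by (auto simp: vertical_def VP_def)

lemma add_list_append:
  assumes "\<And>P. P \<in> set Ps \<Longrightarrow> on_curve F P" "\<And>P. P \<in> set Qs \<Longrightarrow> on_curve F P"
  shows "add_list (Ps @ Qs) = add_list Ps \<otimes>\<^bsub>EE\<^esub> add_list Qs"
  using assms(1)
proof (induction Ps)
  case (Cons P Ps)
  have c: "P \<in> carrier EE" "add_list Ps \<in> carrier EE" "add_list Qs \<in> carrier EE"
    using Cons.prems assms(2) by (auto intro!: add_list_on_curve)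
  show ?case using Cons EE.m_assoc[OF c] by simp
qed simp

lemma add_list_replicate: "on_curve F P \<Longrightarrow> add_list (replicate k P) = P [^]\<^bsub>EE\<^esub> k"
proof (induction k)
  case (Suc k)
  then show ?case using EE.nat_pow_Suc2[of P k] by simp
qed simp

text \<open>
  A combination is the sum of a list in which \<open>P\<^sub>\<theta>\<close> occurs with one sign only. By the independence of
  vertical points some point of the list is the negative of another one, so \<open>P\<^sub>\<theta> = - P\<^sub>\<theta>\<close> for some \<open>\<theta>\<close>, contrary to
  \<open>C(\<theta>) \<noteq> 0\<close>.
\<close>

theorem VP_independent:
  assumes "EE.combination vertical VP n = Infinity"
  shows "\<forall>\<theta>\<in>vertical. n \<theta> = 0"
proof (rule ccontr)
  assume "\<not> ?thesis"
  then obtain \<theta>0 where \<theta>0: "\<theta>0 \<in> vertical" "n \<theta>0 \<noteq> 0" by blast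
  define S where "S \<theta> = (if n \<theta> \<ge> 0 then VP \<theta> else neg (VP \<theta>))" for \<theta>
  have S_on: "on_curve F (S \<theta>)" if "\<theta> \<in> vertical" for \<theta>
    using VP_carrier that by (auto simp: S_def)
  define Ps where "Ps \<theta>s = concat (map (\<lambda>\<theta>. replicate (nat \<bar>n \<theta>\<bar>) (S \<theta>)) \<theta>s)" for \<theta>s
  have Ps_set: "P \<in> set (Ps \<theta>s) \<Longrightarrow> \<exists>\<theta>\<in>set \<theta>s. P = S \<theta>" for P \<theta>s
    by (auto simp: Ps_def split: if_splits)
  have "add_list (Ps \<theta>s) = EE.combination (set \<theta>s) VP n" if "distinct \<theta>s" "set \<theta>s \<subseteq> vertical" for \<theta>s
    using that
  proof (induction \<theta>s)
    case Nil
    then show ?case by (simp add: Ps_def EE.combination_def)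
  next
    case (Cons \<theta> \<theta>s)
    have V: "VP \<theta> \<in> carrier EE" using Cons.prems VP_carrier by auto
    have 1: "add_list (replicate (nat \<bar>n \<theta>\<bar>) (S \<theta>)) = VP \<theta> [^]\<^bsub>EE\<^esub> n \<theta>"
    proof (cases "n \<theta> \<ge> 0")
      case True
      then show ?thesis using V add_list_replicate[of "VP \<theta>"] int_pow_int[where G = EE and x = "VP \<theta>" and n = "nat (n \<theta>)"]
        by (simp add: S_def)
    next
      case False
      then have "add_list (replicate (nat \<bar>n \<theta>\<bar>) (S \<theta>)) = neg (VP \<theta>) [^]\<^bsub>EE\<^esub> nat (- n \<theta>)"
        using V by (simp add: S_def add_list_replicate)
      also have "neg (VP \<theta>) = inv\<^bsub>EE\<^esub> VP \<theta>" using V by simp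
      also have "(inv\<^bsub>EE\<^esub> VP \<theta>) [^]\<^bsub>EE\<^esub> nat (- n \<theta>) = VP \<theta> [^]\<^bsub>EE\<^esub> n \<theta>"
        using False V int_pow_def2[where G = EE and a = "VP \<theta>" and z = "n \<theta>"] EE.nat_pow_inv[OF V] by simp
      finally show ?thesis .
    qed
    have "add_list (Ps (\<theta> # \<theta>s)) = add_list (replicate (nat \<bar>n \<theta>\<bar>) (S \<theta>)) \<otimes>\<^bsub>EE\<^esub> add_list (Ps \<theta>s)"
    proof -
      have "Ps (\<theta> # \<theta>s) = replicate (nat \<bar>n \<theta>\<bar>) (S \<theta>) @ Ps \<theta>s" by (simp add: Ps_def)
      then show ?thesis using Cons.prems S_on Ps_set
        by (simp only:) (rule add_list_append; fastforce split: if_splits)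
    qed
    also have "\<dots> = VP \<theta> [^]\<^bsub>EE\<^esub> n \<theta> \<otimes>\<^bsub>EE\<^esub> EE.combination (set \<theta>s) VP n"
      using Cons 1 by simp
    also have "\<dots> = EE.combination (set (\<theta> # \<theta>s)) VP n"
    proof -
      have "(\<lambda>\<theta>. VP \<theta> [^]\<^bsub>EE\<^esub> n \<theta>) \<in> set \<theta>s \<rightarrow> carrier EE"
        using VP_carrier Cons.prems by (auto simp del: carrier_EE intro!: EE.int_pow_closed)
      then show ?thesis unfolding EE.combination_def
        using Cons.prems V EE.finprod_insert[of "set \<theta>s" \<theta> "\<lambda>\<theta>. VP \<theta> [^]\<^bsub>EE\<^esub> n \<theta>"]
        by (simp del: carrier_EE mult_EE)
    qed
    finally show ?case .
  qed
  moreover obtain \<theta>s where \<theta>s: "set \<theta>s = vertical" "distinct \<theta>s"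
    using finite_distinct_list[OF finite_vertical] by blast
  ultimately have 0: "add_list (Ps \<theta>s) = Infinity" using assms by simp
  have "S \<theta>0 \<in> set (Ps \<theta>s)" using \<theta>0 \<theta>s(1) by (auto simp: Ps_def)
  then have ne: "Ps \<theta>s \<noteq> []" by auto
  have "\<exists>P\<in>set (Ps \<theta>s). neg P \<in> set (Ps \<theta>s)"
  proof (rule vertical_points_independent[OF ne _ 0])
    fix P assume "P \<in> set (Ps \<theta>s)"
    then obtain \<theta> where \<theta>: "\<theta> \<in> vertical" "P = S \<theta>" using Ps_set \<theta>s(1) by blast
    then show "\<exists>\<theta> y. P = Affine (cst \<theta>) y \<and> on (cst \<theta>) y"
      using S_on[OF \<theta>(1)] by (auto simp: S_def VP_def)
  qed
  then obtain \<theta> \<theta>' where \<theta>: "\<theta> \<in> vertical" "\<theta>' \<in> vertical" "neg (S \<theta>) = S \<theta>'"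
    using Ps_set \<theta>s(1) by metis
  then have "\<theta> = \<theta>'" by (auto simp: S_def VP_def split: if_splits)
  then have "cst (sq \<theta>) = - cst (sq \<theta>)"
    using \<theta>(3) unfolding S_def VP_def by (cases "n \<theta>' \<ge> 0") (simp_all only: neg.simps point.inject if_True if_False minus_minus)
  then have "2 * cst (sq \<theta>) = 0" by (metis add.right_inverse mult_2)
  then have "sq \<theta> = 0" using two_nonzero by simp
  then show False using \<theta>(1) sq[of \<theta>] by (simp add: vertical_def)
qed

text \<open>
  The points whose double is a combination of the \<open>P\<^sub>\<theta>\<close> form a subgroup. It contains the vertical points
  with \<open>C(\<theta>) = 0\<close>, which are \<open>2\<close>-torsion.
\<close>

theorem VP_span:
  assumes "on_curve F P"
  shows "\<exists>(e::nat) n. e > 0 \<and> P [^]\<^bsub>EE\<^esub> e = EE.combination vertical VP n"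
proof -
  define H where "H = {Q \<in> carrier EE. \<exists>n. Q [^]\<^bsub>EE\<^esub> (2::nat) = EE.combination vertical VP n}"
  have "subgroup H EE"
  proof (rule EE.subgroupI)
    show "H \<subseteq> carrier EE" by (auto simp: H_def)
    have "\<one>\<^bsub>EE\<^esub> [^]\<^bsub>EE\<^esub> (2::nat) = EE.combination vertical VP (\<lambda>_. 0)"
      unfolding EE.combination_zero[OF VP_carrier] by (rule EE.nat_pow_one)
    then show "H \<noteq> {}" unfolding H_def using EE.one_closed by blast
    fix a assume a: "a \<in> H"
    then obtain n where n: "a \<in> carrier EE" "a [^]\<^bsub>EE\<^esub> (2::nat) = EE.combination vertical VP n"
      by (auto simp: H_def)
    have "(inv\<^bsub>EE\<^esub> a) [^]\<^bsub>EE\<^esub> (2::nat) = EE.combination vertical VP (\<lambda>i. - n i)"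
      unfolding EE.combination_uminus[OF VP_carrier] n(2)[symmetric] by (rule EE.nat_pow_inv[OF n(1)])
    then show "inv\<^bsub>EE\<^esub> a \<in> H" unfolding H_def using EE.inv_closed[OF n(1)] by blast
    fix b assume "b \<in> H"
    then obtain m where m: "b \<in> carrier EE" "b [^]\<^bsub>EE\<^esub> (2::nat) = EE.combination vertical VP m"
      by (auto simp: H_def)
    have "(a \<otimes>\<^bsub>EE\<^esub> b) [^]\<^bsub>EE\<^esub> (2::nat) = EE.combination vertical VP (\<lambda>i. n i + m i)"
      unfolding EE.combination_add[OF VP_carrier] n(2)[symmetric] m(2)[symmetric]
      by (rule EE.nat_pow_distrib[OF n(1) m(1)])
    then show "a \<otimes>\<^bsub>EE\<^esub> b \<in> H" unfolding H_def using EE.m_closed[OF n(1) m(1)] by blast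
  qed
  moreover have "Affine (cst \<theta>) y \<in> H" if \<theta>: "poly B \<theta> = 0" and y: "on (cst \<theta>) y" for \<theta> y
  proof (cases "poly C \<theta> = 0")
    case True
    then have "y = 0" using y \<theta> by (simp add: on_cst_root)
    then have "Affine (cst \<theta>) y [^]\<^bsub>EE\<^esub> (2::nat) = \<one>\<^bsub>EE\<^esub>" by (simp add: numeral_2_eq_2)
    also have "\<dots> = EE.combination vertical VP (\<lambda>_. 0)" by (rule EE.combination_zero[OF VP_carrier, symmetric])
    finally show ?thesis using y unfolding H_def by auto
  next
    case False
    then have v: "\<theta> \<in> vertical" using \<theta> by (simp add: vertical_def)
    have one: "EE.combination vertical VP (\<lambda>x. if x = \<theta> then k else 0) = VP \<theta> [^]\<^bsub>EE\<^esub> k" for k :: int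
    proof -
      have "EE.combination vertical VP (\<lambda>x. if x = \<theta> then k else 0)
          = (\<Otimes>\<^bsub>EE\<^esub>x\<in>vertical. if \<theta> = x then VP x [^]\<^bsub>EE\<^esub> k else \<one>\<^bsub>EE\<^esub>)"
        unfolding EE.combination_def using VP_carrier v
        by (intro EE.finprod_cong') (auto simp del: carrier_EE one_EE intro!: EE.int_pow_closed)
      then show ?thesis
        using EE.finprod_singleton[OF v finite_vertical, of "\<lambda>x. VP x [^]\<^bsub>EE\<^esub> k"] VP_carrier
        by (auto simp del: carrier_EE one_EE)
    qed
    have Vc: "VP \<theta> \<in> carrier EE" using v VP_carrier by blast
    have "y\<^sup>2 = (cst (sq \<theta>))\<^sup>2" using y \<theta> sq[of \<theta>] by (simp add: on_cst_root flip: cst.h_power)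
    then consider "y = cst (sq \<theta>)" | "y = - cst (sq \<theta>)" by (auto simp: power2_eq_iff)
    then have "\<exists>k::int. Affine (cst \<theta>) y = VP \<theta> [^]\<^bsub>EE\<^esub> k"
    proof cases
      case 1
      then show ?thesis using EE.int_pow_1[OF Vc] by (intro exI[of _ 1]) (simp add: VP_def)
    next
      case 2
      then have "Affine (cst \<theta>) y = inv\<^bsub>EE\<^esub> VP \<theta>" using Vc by (simp add: VP_def)
      also have "\<dots> = VP \<theta> [^]\<^bsub>EE\<^esub> (- 1 :: int)"
        using EE.int_pow_neg[OF Vc, of 1] EE.int_pow_1[OF Vc] by simp
      finally show ?thesis by blast
    qed
    then obtain n where n: "Affine (cst \<theta>) y = EE.combination vertical VP n" using one by metis
    have "Affine (cst \<theta>) y [^]\<^bsub>EE\<^esub> (2::nat) = EE.combination vertical VP (\<lambda>i. int 2 * n i)"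
      unfolding n by (rule EE.combination_nat_pow[OF VP_carrier])
    then show ?thesis using y unfolding H_def by auto
  qed
  ultimately obtain e :: nat where e: "e > 0" "P [^]\<^bsub>EE\<^esub> e \<in> H"
    using vertical_points_span[OF _ _ assms] by blast
  have Pc: "P \<in> carrier EE" using assms by simp
  from e(2) obtain n where "(P [^]\<^bsub>EE\<^esub> e) [^]\<^bsub>EE\<^esub> (2::nat) = EE.combination vertical VP n" by (auto simp: H_def)
  then have "P [^]\<^bsub>EE\<^esub> (e * 2) = EE.combination vertical VP n" using EE.nat_pow_pow[OF Pc] by simp
  then show ?thesis using e(1) by (intro exI[of _ "e * 2"]) auto
qed

end

end

section \<open>Change of the base field\<close>

context comm_group
begin

lemma combination_reindex:
  assumes "inj_on h I" "finite J" "h ` I \<subseteq> J" "g \<in> J \<rightarrow> carrier G"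
    and "\<And>j. j \<in> J \<Longrightarrow> j \<notin> h ` I \<Longrightarrow> n j = 0"
  shows "combination J g n = combination I (g \<circ> h) (n \<circ> h)"
proof -
  have "combination J g n = (\<Otimes>j\<in>h ` I. g j [^] n j)"
    unfolding combination_def using assms(2-5) by (intro finprod_mono_neutral_cong_right) auto
  also have "\<dots> = combination I (g \<circ> h) (n \<circ> h)"
    unfolding combination_def o_def using assms by (intro finprod_reindex) auto
  finally show ?thesis .
qed

lemma combination_cong:
  "g \<in> I \<rightarrow> carrier G \<Longrightarrow> (\<And>i. i \<in> I \<Longrightarrow> f i = g i) \<Longrightarrow> (\<And>i. i \<in> I \<Longrightarrow> m i = n i) \<Longrightarrow>
    combination I f m = combination I g n"
  unfolding combination_def by (intro finprod_cong') auto

end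

lemma hom_combination:
  assumes "comm_group G" "comm_group H" "h \<in> hom G H" "finite I" "g \<in> I \<rightarrow> carrier G"
  shows "h (comm_group.combination G I g n) = comm_group.combination H I (h \<circ> g) n"
  using assms(4,5)
proof (induction I rule: finite_induct)
  interpret G: comm_group G by fact
  interpret H: comm_group H by fact
  {
    case empty
    show ?case
      using hom_one[OF assms(3) G.is_group H.is_group] by (simp add: G.combination_def H.combination_def)
  next
    case (insert i I)
    have gi: "g i \<in> carrier G" and gI: "g \<in> I \<rightarrow> carrier G" using insert.prems by auto
    have hgi: "h (g i) \<in> carrier H" and hgI: "h \<circ> g \<in> I \<rightarrow> carrier H"
      using gi gI hom_in_carrier[OF assms(3)] by (auto simp: Pi_iff)
    have G1: "G.combination (insert i I) g n = g i [^]\<^bsub>G\<^esub> n i \<otimes>\<^bsub>G\<^esub> G.combination I g n"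
      unfolding G.combination_def using insert.hyps gi gI by (intro G.finprod_insert) auto
    have H1: "H.combination (insert i I) (h \<circ> g) n
        = (h \<circ> g) i [^]\<^bsub>H\<^esub> n i \<otimes>\<^bsub>H\<^esub> H.combination I (h \<circ> g) n"
      unfolding H.combination_def using insert.hyps hgi hgI by (intro H.finprod_insert) (auto simp: Pi_iff)
    have "h (G.combination (insert i I) g n) = h (g i [^]\<^bsub>G\<^esub> n i) \<otimes>\<^bsub>H\<^esub> h (G.combination I g n)"
      unfolding G1 using gi G.combination_closed[OF gI] by (intro hom_mult[OF assms(3)]) auto
    then show ?case
      unfolding H1 insert.IH[OF gI] using hom_int_pow[OF assms(3) gi G.is_group H.is_group] by simp
  }
qed

locale field_morphism = ring_morphism h for h :: "'a::field \<Rightarrow> 'b::field"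
begin

lemma h_eq_0_iff [simp]: "h x = 0 \<longleftrightarrow> x = 0"
proof
  assume "h x = 0"
  then have "h (x * inverse x) = 0" by simp
  then show "x = 0" by (cases "x = 0") (simp_all del: h_mult)
qed simp

lemma h_eq_iff [simp]: "h x = h y \<longleftrightarrow> x = y"
  using h_eq_0_iff[of "x - y"] by simp

lemma h_inverse [simp]: "h (inverse x) = inverse (h x)"
proof (cases "x = 0")
  case False
  then have "h x * h (inverse x) = 1" by (simp flip: h_mult)
  then show ?thesis by (rule inverse_unique[symmetric])
qed simp

lemma h_divide [simp]: "h (x / y) = h x / h y"
  by (simp add: divide_inverse)

lemma map_eq_0_iff [simp]: "map_poly h p = 0 \<longleftrightarrow> p = 0"
  by (rule map_poly_eq_0_iff) simp_all

lemma degree_map [simp]: "degree (map_poly h p) = degree p"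
  by (rule degree_map_poly) simp

lemma pderiv_map: "map_poly h (pderiv p) = pderiv (map_poly h p)"
  by (induction p) (simp_all add: pderiv_pCons map_add)

text \<open>
  The extension of a field morphism to rational functions, acting on their coefficients.
\<close>

definition base_change :: "'a poly fract \<Rightarrow> 'b poly fract" where
  "base_change q = (THE r. \<exists>a b. b \<noteq> 0 \<and> q = to_fract a / to_fract b \<and>
     r = to_fract (map_poly h a) / to_fract (map_poly h b))"

lemma base_change_quotient:
  assumes "b \<noteq> 0"
  shows "base_change (to_fract a / to_fract b) = to_fract (map_poly h a) / to_fract (map_poly h b)"
  unfolding base_change_def
proof (rule the_equality)
  fix r assume "\<exists>a' b'. b' \<noteq> 0 \<and> to_fract a / to_fract b = to_fract a' / to_fract b' \<and>
     r = to_fract (map_poly h a') / to_fract (map_poly h b')"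
  then obtain a' b' where r: "b' \<noteq> 0" "to_fract a / to_fract b = to_fract a' / to_fract b'"
    "r = to_fract (map_poly h a') / to_fract (map_poly h b')" by blast
  then have "to_fract (a * b') = to_fract (a' * b)" using assms by (simp add: field_simps)
  then have "a * b' = a' * b" by (simp only: to_fract_eq_iff)
  then have "map_poly h (a * b') = map_poly h (a' * b)" by simp
  then have "to_fract (map_poly h a' * map_poly h b) = to_fract (map_poly h a * map_poly h b')"
    unfolding map_mult by simp
  then show "r = to_fract (map_poly h a) / to_fract (map_poly h b)"
    unfolding r(3) using assms r(1) by (subst frac_eq_eq) simp_all
qed (use assms in blast)

lemma base_change_to_fract [simp]: "base_change (to_fract a) = to_fract (map_poly h a)"
  using base_change_quotient[of 1 a] by simp

lemma field_morphism_base_change: "field_morphism base_change"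
proof
  show "base_change 0 = 0" "base_change 1 = 1"
    using base_change_to_fract[of 0] base_change_to_fract[of 1] by simp_all
  fix x y :: "'a poly fract"
  obtain a b where x: "b \<noteq> 0" "x = to_fract a / to_fract b" by (rule fract_cases)
  obtain c d where y: "d \<noteq> 0" "y = to_fract c / to_fract d" by (rule fract_cases)
  have bd: "b * d \<noteq> 0" using x y by simp
  have "x + y = to_fract (a * d + c * b) / to_fract (b * d)" using x y by (simp add: field_simps)
  then have "base_change (x + y) = to_fract (map_poly h (a * d + c * b)) / to_fract (map_poly h (b * d))"
    by (simp only: base_change_quotient[OF bd])
  also have "\<dots> = to_fract (map_poly h a) / to_fract (map_poly h b) + to_fract (map_poly h c) / to_fract (map_poly h d)"
    using x(1) y(1) by (simp add: map_add map_mult add_frac_eq)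
  finally show "base_change (x + y) = base_change x + base_change y"
    unfolding x(2) y(2) by (simp only: base_change_quotient[OF x(1)] base_change_quotient[OF y(1)])
  have "x * y = to_fract (a * c) / to_fract (b * d)" using x y by simp
  then have "base_change (x * y) = to_fract (map_poly h (a * c)) / to_fract (map_poly h (b * d))"
    by (simp only: base_change_quotient[OF bd])
  also have "\<dots> = to_fract (map_poly h a) / to_fract (map_poly h b) * (to_fract (map_poly h c) / to_fract (map_poly h d))"
    by (simp add: map_mult)
  finally show "base_change (x * y) = base_change x * base_change y"
    unfolding x(2) y(2) by (simp only: base_change_quotient[OF x(1)] base_change_quotient[OF y(1)])
qed

lemma base_change_cst [simp]: "base_change (cst c) = cst (h c)"
  by (simp add: cst_def)

lemma map_generic_cubic:
  "map_poly base_change (generic_cubic 0 B C) = generic_cubic 0 (map_poly h B) (map_poly h C)"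
proof -
  interpret b: field_morphism base_change by (rule field_morphism_base_change)
  show ?thesis by (simp add: generic_cubic_def T_coeff_def coeff_map_poly)
qed

fun map_point :: "'a point \<Rightarrow> 'b point" where
  "map_point Infinity = Infinity"
| "map_point (Affine x y) = Affine (h x) (h y)"

lemma map_point_eq_iff [simp]: "map_point P = map_point Q \<longleftrightarrow> P = Q"
  by (cases P; cases Q) auto

lemma on_curve_map_point [simp]: "on_curve (map_poly h f) (map_point P) \<longleftrightarrow> on_curve f P"
  by (cases P) (simp_all add: on_curve_def poly_map flip: h_power)

lemma map_point_add: "map_point (point_add f P Q) = point_add (map_poly h f) (map_point P) (map_point Q)"
proof (cases "P = Infinity \<or> Q = Infinity")
  case True
  then show ?thesis by (cases P; cases Q) auto
next
  case False
  then obtain x1 y1 x2 y2 where PQ: "P = Affine x1 y1" "Q = Affine x2 y2" by (cases P; cases Q) auto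
  have "h y1 = - h y2 \<longleftrightarrow> y1 = - y2" by (metis h_eq_iff h_uminus)
  then show ?thesis
    by (simp add: PQ Let_def coeff_map_poly poly_map flip: pderiv_map)
qed

lemma map_point_hom: "map_point \<in> hom (point_group f) (point_group (map_poly h f))"
  by (rule homI) (simp_all add: point_group_def map_point_add)

end

section \<open>Descent to the base field\<close>

interpretation ac: field_morphism to_ac
  by unfold_locales simp_all

lemma galois_orbitI: "\<sigma> \<in> absolute_galois \<Longrightarrow> \<sigma> \<theta> \<in> galois_orbit \<theta>"
  unfolding galois_orbit_def by blast

lemma identity_in_absolute_galois: "(\<lambda>x. x) \<in> absolute_galois"
  by (rule total_morphism_in_absolute_galois) (unfold_locales, simp_all)

lemma adjoin_to_ac: "adjoin (to_ac r) = range to_ac"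
proof
  have "intermediate (range to_ac)"
    unfolding intermediate_def by (auto simp flip: to_ac_add to_ac_mult)
  then show "adjoin (to_ac r) \<subseteq> range to_ac" by (rule adjoin_subset) simp
  show "range to_ac \<subseteq> adjoin (to_ac r)" using intermediateD(1)[OF adjoin_properties(1)] by blast
qed

locale descent =
  fixes B C :: "'k::field_char_0 poly"
  assumes degree_B0: "degree B \<le> 2" and degree_C0: "degree C = 3"
    and B0_nonzero: "B \<noteq> 0" and Delta0: "Delta_ell 0 B C \<noteq> 0"
begin

abbreviation BO :: "'k alg_closure poly" where "BO \<equiv> map_poly to_ac B"
abbreviation CO :: "'k alg_closure poly" where "CO \<equiv> map_poly to_ac C"

lemma Delta_map: "Delta_ell 0 BO CO = map_poly to_ac (Delta_ell 0 B C)"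
proof -
  interpret m: ring_morphism "map_poly to_ac :: 'k poly \<Rightarrow> _" by (rule ac.ring_morphism_map_poly)
  have T: "T_coeff 0 BO CO i = map_poly to_ac (T_coeff 0 B C i)" for i
    by (simp add: T_coeff_def coeff_map_poly)
  show ?thesis unfolding Delta_ell_def Let_def T by simp
qed

sublocale pencil BO CO
  by unfold_locales (use degree_B0 degree_C0 B0_nonzero Delta0 in \<open>simp_all add: Delta_map\<close>)

abbreviation f :: "'k poly fract poly" where "f \<equiv> generic_cubic 0 B C"

sublocale base: cubic_curve f
proof
  show "degree f = 3"
    using degree_F unfolding ac.map_generic_cubic[symmetric]
    by (simp add: field_morphism.degree_map[OF ac.field_morphism_base_change])
  have "cst (2 :: 'k) \<noteq> 0" by (simp del: cst.h_numeral)
  then show "(2 :: 'k poly fract) \<noteq> 0" unfolding cst.h_numeral .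
qed (rule generic_cubic_nonsingular[OF Delta0])

sublocale bc: field_morphism "ac.base_change :: 'k poly fract \<Rightarrow> _"
  by (rule ac.field_morphism_base_change)

interpretation EE: comm_group EE by (rule comm_group_EE)
interpretation E0: comm_group base.EE by (rule base.comm_group_EE)

abbreviation psi :: "'k poly fract point \<Rightarrow> 'k alg_closure poly fract point" where
  "psi \<equiv> bc.map_point"

lemma psi_hom: "psi \<in> hom base.EE EE"
  using bc.map_point_hom[of f] unfolding ac.map_generic_cubic .

lemma psi_on_curve [simp]: "on_curve F (psi P) \<longleftrightarrow> on_curve f P"
  using bc.on_curve_map_point[of f P] unfolding ac.map_generic_cubic .

text \<open>
  The Galois action on points over \<open>K(T)\<close>.
\<close>

definition act :: "('k alg_closure \<Rightarrow> 'k alg_closure) \<Rightarrow>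
    'k alg_closure poly fract point \<Rightarrow> 'k alg_closure poly fract point" where
  "act \<sigma> = field_morphism.map_point (field_morphism.base_change \<sigma>)"

lemma act_properties:
  assumes "\<sigma> \<in> absolute_galois"
  shows "act \<sigma> \<in> hom EE EE" "act \<sigma> (psi P) = psi P"
    "act \<sigma> (Affine (cst a) (cst b)) = Affine (cst (\<sigma> a)) (cst (\<sigma> b))"
    "poly BO a = 0 \<Longrightarrow> poly BO (\<sigma> a) = 0" "poly CO (\<sigma> a) = \<sigma> (poly CO a)"
proof -
  interpret s: field_morphism \<sigma>
    using absolute_galoisD(1)[OF assms] by (rule field_morphism.intro)
  interpret sb: field_morphism s.base_change by (rule s.field_morphism_base_change)
  have fix_map: "map_poly \<sigma> (map_poly to_ac p) = map_poly to_ac p" for p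
    by (simp add: map_poly_map_poly o_def absolute_galoisD(2)[OF assms])
  have act: "act \<sigma> = sb.map_point" by (simp add: act_def)
  show "act \<sigma> \<in> hom EE EE"
    using sb.map_point_hom[of F] unfolding act s.map_generic_cubic fix_map .
  have "s.base_change (ac.base_change x) = ac.base_change x" for x
  proof -
    obtain u v where x: "v \<noteq> 0" "x = to_fract u / to_fract v" by (rule fract_cases)
    have "s.base_change (ac.base_change x)
        = to_fract (map_poly \<sigma> (map_poly to_ac u)) / to_fract (map_poly \<sigma> (map_poly to_ac v))"
      unfolding x(2) ac.base_change_quotient[OF x(1)] using x(1) by (intro s.base_change_quotient) simp
    then show ?thesis unfolding fix_map x(2) ac.base_change_quotient[OF x(1)] .
  qed
  then show "act \<sigma> (psi P) = psi P" unfolding act by (cases P) simp_all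
  show "act \<sigma> (Affine (cst a) (cst b)) = Affine (cst (\<sigma> a)) (cst (\<sigma> b))" unfolding act by simp
  show "poly CO (\<sigma> a) = \<sigma> (poly CO a)" using s.poly_map[of CO a] unfolding fix_map .
  show "poly BO (\<sigma> a) = 0" if "poly BO a = 0" using s.poly_map[of BO a] that unfolding fix_map by simp
qed

context
  fixes sq :: "'k alg_closure \<Rightarrow> 'k alg_closure"
  assumes sq: "\<And>\<theta>. (sq \<theta>)\<^sup>2 = poly CO \<theta>"
begin

abbreviation V :: "'k alg_closure \<Rightarrow> 'k alg_closure poly fract point" where "V \<equiv> VP sq"

lemma V_carrier: "V \<in> vertical \<rightarrow> carrier EE" by (rule VP_carrier[OF sq])

lemma sq_nonzero: "\<theta> \<in> vertical \<Longrightarrow> sq \<theta> \<noteq> 0"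
  using sq[of \<theta>] by (auto simp: vertical_def)

lemma combination_unique:
  assumes "EE.combination vertical V m = EE.combination vertical V n" "\<theta> \<in> vertical"
  shows "m \<theta> = n \<theta>"
proof -
  have c: "EE.combination vertical V n \<in> carrier EE" by (rule EE.combination_closed[OF V_carrier])
  have "EE.combination vertical V (\<lambda>i. m i + - n i) = \<one>\<^bsub>EE\<^esub>"
    unfolding EE.combination_add[OF V_carrier] EE.combination_uminus[OF V_carrier] assms(1)
    by (rule EE.r_inv[OF c])
  then have "\<forall>\<theta>\<in>vertical. m \<theta> + - n \<theta> = 0" by (intro VP_independent[OF sq]) simp
  then show ?thesis using assms(2) by force
qed

text \<open>
  The automorphism maps every \<open>P\<^sub>\<theta>\<close> to \<open>\<plusminus> P\<^sub>\<theta>\<close> and fixes the points over \<open>k(T)\<close>. By uniqueness of the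
  coefficients, the coefficient of a negated point equals its negative.
\<close>

lemma negated_coefficient_zero:
  assumes \<sigma>: "\<sigma> \<in> absolute_galois" "\<And>\<theta>. \<theta> \<in> vertical \<Longrightarrow> \<sigma> \<theta> = \<theta>"
    and \<theta>1: "\<theta>1 \<in> vertical" "\<sigma> (sq \<theta>1) = - sq \<theta>1"
    and P: "psi P = EE.combination vertical V n"
  shows "n \<theta>1 = 0"
proof -
  define \<epsilon> where "\<epsilon> \<theta> = (if \<sigma> (sq \<theta>) = sq \<theta> then 1 else - 1 :: int)" for \<theta>
  interpret s: ring_morphism \<sigma> by (rule absolute_galoisD(1)[OF \<sigma>(1)])
  have actV: "act \<sigma> (V \<theta>) = V \<theta> [^]\<^bsub>EE\<^esub> \<epsilon> \<theta>" if \<theta>: "\<theta> \<in> vertical" for \<theta>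
  proof -
    have Vc: "V \<theta> \<in> carrier EE" using V_carrier \<theta> by blast
    have a: "act \<sigma> (V \<theta>) = Affine (cst \<theta>) (cst (\<sigma> (sq \<theta>)))"
      unfolding VP_def[OF sq] act_properties(3)[OF \<sigma>(1)] \<sigma>(2)[OF \<theta>] ..
    show ?thesis
    proof (cases "\<sigma> (sq \<theta>) = sq \<theta>")
      case True
      then show ?thesis unfolding a using EE.int_pow_1[OF Vc] by (simp add: \<epsilon>_def VP_def[OF sq])
    next
      case False
      have "(\<sigma> (sq \<theta>))\<^sup>2 = (sq \<theta>)\<^sup>2"
        using act_properties(5)[OF \<sigma>(1), of \<theta>] \<sigma>(2)[OF \<theta>] by (simp add: sq flip: s.h_power)
      then have "\<sigma> (sq \<theta>) = - sq \<theta>" using False by (auto simp: power2_eq_iff)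
      then have "act \<sigma> (V \<theta>) = inv\<^bsub>EE\<^esub> V \<theta>" unfolding a using Vc by (simp add: VP_def[OF sq])
      also have "\<dots> = V \<theta> [^]\<^bsub>EE\<^esub> (- 1 :: int)" using EE.int_pow_neg[OF Vc, of 1] EE.int_pow_1[OF Vc] by simp
      finally show ?thesis using False by (simp add: \<epsilon>_def)
    qed
  qed
  have "EE.combination vertical V n = act \<sigma> (psi P)"
    unfolding act_properties(2)[OF \<sigma>(1)] by (rule P[symmetric])
  also have "\<dots> = EE.combination vertical (act \<sigma> \<circ> V) n"
    unfolding P by (rule hom_combination[OF comm_group_EE comm_group_EE act_properties(1)[OF \<sigma>(1)]
          finite_vertical V_carrier])
  also have "\<dots> = EE.combination vertical V (\<lambda>\<theta>. \<epsilon> \<theta> * n \<theta>)"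
    unfolding EE.combination_def
  proof (rule EE.finprod_cong')
    show "(\<lambda>\<theta>. V \<theta> [^]\<^bsub>EE\<^esub> (\<epsilon> \<theta> * n \<theta>)) \<in> vertical \<rightarrow> carrier EE"
      using V_carrier by (auto simp: Pi_iff simp del: carrier_EE)
    fix \<theta> assume \<theta>: "\<theta> \<in> vertical"
    then show "(act \<sigma> \<circ> V) \<theta> [^]\<^bsub>EE\<^esub> n \<theta> = V \<theta> [^]\<^bsub>EE\<^esub> (\<epsilon> \<theta> * n \<theta>)"
      unfolding o_def actV[OF \<theta>] using V_carrier by (intro EE.int_pow_pow) blast
  qed simp
  finally have "n \<theta>1 = \<epsilon> \<theta>1 * n \<theta>1" using \<theta>1(1) by (rule combination_unique)
  moreover have "\<epsilon> \<theta>1 = - 1" using \<theta>1 sq_nonzero[OF \<theta>1(1)] by (simp add: \<epsilon>_def)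
  ultimately show ?thesis by simp
qed

lemma span_over_base:
  assumes "P \<in> carrier base.EE"
  shows "\<exists>(e::nat) n. e > 0 \<and> psi (P [^]\<^bsub>base.EE\<^esub> e) = EE.combination vertical V n"
proof -
  have "on_curve F (psi P)" using assms by simp
  from VP_span[OF sq this] obtain e :: nat and n where
    e: "e > 0" "psi P [^]\<^bsub>EE\<^esub> e = EE.combination vertical V n" by blast
  have "psi (P [^]\<^bsub>base.EE\<^esub> e) = psi P [^]\<^bsub>EE\<^esub> e"
    by (rule hom_nat_pow[OF psi_hom assms E0.is_group EE.is_group])
  then show ?thesis using e by metis
qed

text \<open>
  For \<open>A = 0\<close> only the second alternative in the definition of \<open>delta\<close> can occur.
\<close>

lemma delta_eq: "delta 0 B C = card (galois_orbit ` {\<theta> \<in> vertical. sq \<theta> \<in> adjoin \<theta>})"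
proof -
  interpret m: ring_morphism "map_poly to_ac :: 'k poly \<Rightarrow> _" by (rule ac.ring_morphism_map_poly)
  have "ac_eval (Delta_conic 0 B C) \<theta> = (poly BO \<theta>)\<^sup>2" for \<theta>
    by (simp add: ac_eval_def Delta_conic_def)
  moreover have "nonzero_square_in (adjoin \<theta>) (ac_eval C \<theta>) \<longleftrightarrow> poly CO \<theta> \<noteq> 0 \<and> sq \<theta> \<in> adjoin \<theta>" for \<theta>
  proof -
    have "(\<exists>s\<in>adjoin \<theta>. poly CO \<theta> = s\<^sup>2) \<longleftrightarrow> sq \<theta> \<in> adjoin \<theta>"
    proof
      assume "\<exists>s\<in>adjoin \<theta>. poly CO \<theta> = s\<^sup>2"
      then obtain s where s: "s \<in> adjoin \<theta>" "(sq \<theta>)\<^sup>2 = s\<^sup>2" using sq by metis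
      then have "sq \<theta> = s \<or> sq \<theta> = - s" by (simp add: power2_eq_iff)
      then show "sq \<theta> \<in> adjoin \<theta>" using s(1) intermediateD(4)[OF adjoin_properties(1)] by metis
    next
      assume "sq \<theta> \<in> adjoin \<theta>"
      then show "\<exists>s\<in>adjoin \<theta>. poly CO \<theta> = s\<^sup>2" using sq[of \<theta>] by metis
    qed
    then show ?thesis by (simp add: nonzero_square_in_def ac_eval_def)
  qed
  ultimately show ?thesis
    unfolding delta_def vertical_def
    by (intro arg_cong[of _ _ card] arg_cong[of _ _ "(`) galois_orbit"])
       (auto simp: ac_eval_def nonzero_square_in_def[of _ 0])
qed

text \<open>
  If no value \<open>C(\<theta>)\<close> is a square in \<open>k(\<theta>)\<close> and each \<open>k(\<theta>)\<close> contains all \<open>\<theta>'\<close>, then for each \<open>\<theta>\<close> there is an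
  automorphism that fixes all \<open>\<theta>'\<close> and negates \<open>P\<^sub>\<theta>\<close>; all points over \<open>k(T)\<close> are torsion.
\<close>

lemma rank_zero:
  assumes "\<And>\<theta>. \<theta> \<in> vertical \<Longrightarrow> sq \<theta> \<notin> adjoin \<theta>" "\<And>\<theta>. \<theta> \<in> vertical \<Longrightarrow> vertical \<subseteq> adjoin \<theta>"
  shows "group_rank base.EE = enat (delta 0 B C)"
proof -
  have "group_rank base.EE = enat (card ({} :: unit set))"
  proof (rule E0.group_rank_eq_card)
    fix P assume "P \<in> carrier base.EE"
    from span_over_base[OF this] obtain e :: nat and n where
      e: "e > 0" "psi (P [^]\<^bsub>base.EE\<^esub> e) = EE.combination vertical V n" by blast
    have "n \<theta> = 0" if \<theta>: "\<theta> \<in> vertical" for \<theta>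
    proof -
      have F: "intermediate (adjoin \<theta>)" by (rule adjoin_properties)
      have "(sq \<theta>)\<^sup>2 \<in> adjoin \<theta>" unfolding sq by (rule intermediate_poly[OF F adjoin_properties(2)])
      from quadratic_conjugation[OF F assms(1)[OF \<theta>] this] obtain \<sigma> where
        "\<sigma> \<in> absolute_galois" "\<forall>x\<in>adjoin \<theta>. \<sigma> x = x" "\<sigma> (sq \<theta>) = - sq \<theta>" by blast
      then show ?thesis using assms(2)[OF \<theta>] \<theta> e(2) by (intro negated_coefficient_zero[of \<sigma> \<theta>]) blast+
    qed
    then have "EE.combination vertical V n = EE.combination vertical V (\<lambda>_. 0)"
      by (intro EE.combination_cong V_carrier) auto
    then have "psi (P [^]\<^bsub>base.EE\<^esub> e) = psi Infinity"
      using e(2) EE.combination_zero[OF V_carrier] by simp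
    then have "P [^]\<^bsub>base.EE\<^esub> e = E0.combination ({} :: unit set) (\<lambda>_. Infinity) (\<lambda>_. 0)"
      unfolding bc.map_point_eq_iff by (simp add: E0.combination_def)
    then show "\<exists>(e::nat) n. e > 0 \<and> P [^]\<^bsub>base.EE\<^esub> e = E0.combination ({} :: unit set) (\<lambda>_. Infinity) n"
      using e(1) by blast
  qed auto
  moreover have empty: "{\<theta> \<in> vertical. sq \<theta> \<in> adjoin \<theta>} = {}" using assms(1) by blast
  have "delta 0 B C = 0" unfolding delta_eq empty by simp
  ultimately show ?thesis by simp
qed

text \<open>
  For \<open>\<theta>\<close> in \<open>k\<close> the orbit is a singleton. If \<open>C(\<theta>)\<close> is a square in \<open>k\<close>, then \<open>P\<^sub>\<theta>\<close> is a point over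
  \<open>k(T)\<close>, otherwise its coefficient vanishes.
\<close>

lemma rank_rational_roots:
  assumes rational: "\<And>\<theta>. poly BO \<theta> = 0 \<Longrightarrow> \<theta> \<in> range to_ac"
  shows "group_rank base.EE = enat (delta 0 B C)"
proof -
  define I where "I = {r. to_ac r \<in> vertical \<and> sq (to_ac r) \<in> range to_ac}"
  define g where "g r = Affine (cst r) (cst (of_ac (sq (to_ac r))))" for r
  have toI: "to_ac ` I \<subseteq> vertical" and injI: "inj_on to_ac I"
    using inj_to_ac by (auto simp: I_def inj_on_def)
  have finI: "finite I" using finite_imageD[OF finite_subset[OF toI finite_vertical] injI] .
  have psig: "psi (g r) = V (to_ac r)" if "r \<in> I" for r
  proof -
    have "to_ac (of_ac (sq (to_ac r))) = sq (to_ac r)"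
      by (rule to_ac_of_ac) (use that in \<open>simp add: I_def\<close>)
    then show ?thesis by (simp add: g_def VP_def[OF sq])
  qed
  have gc: "g \<in> I \<rightarrow> carrier base.EE"
  proof
    fix r assume r: "r \<in> I"
    have "V (to_ac r) \<in> carrier EE" using V_carrier toI r by blast
    then have "on_curve F (psi (g r))" unfolding psig[OF r] by simp
    then show "g r \<in> carrier base.EE" by simp
  qed
  have psi_comb: "psi (E0.combination I g n) = EE.combination I (V \<circ> to_ac) n" for n
  proof -
    have "psi (E0.combination I g n) = EE.combination I (psi \<circ> g) n"
      by (rule hom_combination[OF base.comm_group_EE comm_group_EE psi_hom finI gc])
    also have "\<dots> = EE.combination I (V \<circ> to_ac) n"
      using V_carrier toI psig by (intro EE.combination_cong) (auto simp: Pi_iff simp del: carrier_EE)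
    finally show ?thesis .
  qed
  have "group_rank base.EE = enat (card I)"
  proof (rule E0.group_rank_eq_card[OF finI gc])
    fix n assume "E0.combination I g n = \<one>\<^bsub>base.EE\<^esub>"
    then have 1: "EE.combination I (V \<circ> to_ac) n = Infinity" using psi_comb[of n] by simp
    define m where "m \<theta> = (if \<theta> \<in> to_ac ` I then n (of_ac \<theta>) else 0)" for \<theta>
    have "EE.combination vertical V m = EE.combination I (V \<circ> to_ac) (m \<circ> to_ac)"
      by (rule EE.combination_reindex[OF injI finite_vertical toI V_carrier]) (simp add: m_def)
    also have "\<dots> = EE.combination I (V \<circ> to_ac) n"
      using V_carrier toI by (intro EE.combination_cong) (auto simp: m_def Pi_iff simp del: carrier_EE)
    finally have "\<forall>\<theta>\<in>vertical. m \<theta> = 0" using VP_independent[OF sq] 1 by simp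
    then show "\<forall>r\<in>I. n r = 0" using toI by (auto simp: m_def image_subset_iff dest!: bspec[of vertical _ "to_ac _"])
  next
    fix P assume "P \<in> carrier base.EE"
    from span_over_base[OF this] obtain e :: nat and n where
      e: "e > 0" "psi (P [^]\<^bsub>base.EE\<^esub> e) = EE.combination vertical V n" by blast
    have "n \<theta> = 0" if \<theta>: "\<theta> \<in> vertical" "\<theta> \<notin> to_ac ` I" for \<theta>
    proof -
      obtain r where r: "\<theta> = to_ac r" using rational \<theta>(1) by (auto simp: vertical_def)
      then have s: "sq \<theta> \<notin> range to_ac" using \<theta> by (auto simp: I_def)
      have F: "intermediate (range to_ac :: 'k alg_closure set)"
        unfolding adjoin_to_ac[of r, symmetric] by (rule adjoin_properties)
      have "(sq \<theta>)\<^sup>2 \<in> range to_ac" unfolding sq r by (rule intermediate_poly[OF F]) simp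
      from quadratic_conjugation[OF F s this] obtain \<sigma> where
        \<sigma>: "\<sigma> \<in> absolute_galois" "\<forall>x\<in>range to_ac. \<sigma> x = x" "\<sigma> (sq \<theta>) = - sq \<theta>" by blast
      show ?thesis
        using \<sigma> \<theta>(1) rational e(2) by (intro negated_coefficient_zero[of \<sigma> \<theta>]) (auto simp: vertical_def)
    qed
    then have "EE.combination vertical V n = EE.combination I (V \<circ> to_ac) (n \<circ> to_ac)"
      by (intro EE.combination_reindex[OF injI finite_vertical toI V_carrier])
    then have "psi (P [^]\<^bsub>base.EE\<^esub> e) = psi (E0.combination I g (n \<circ> to_ac))"
      unfolding psi_comb e(2) .
    then show "\<exists>(e::nat) n. e > 0 \<and> P [^]\<^bsub>base.EE\<^esub> e = E0.combination I g n"
      unfolding bc.map_point_eq_iff using e(1) by blast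
  qed
  also have "card I = delta 0 B C"
  proof -
    have "{\<theta> \<in> vertical. sq \<theta> \<in> adjoin \<theta>} = to_ac ` I"
    proof (intro equalityI subsetI)
      fix \<theta> assume \<theta>: "\<theta> \<in> {\<theta> \<in> vertical. sq \<theta> \<in> adjoin \<theta>}"
      then obtain r where "\<theta> = to_ac r" using rational by (auto simp: vertical_def)
      then show "\<theta> \<in> to_ac ` I" using \<theta> adjoin_to_ac[of r] by (auto simp: I_def)
    qed (auto simp: I_def adjoin_to_ac)
    moreover have "galois_orbit (to_ac r) = {to_ac r}" for r :: 'k
    proof
      show "galois_orbit (to_ac r) \<subseteq> {to_ac r}"
        unfolding galois_orbit_def using absolute_galoisD(2) by auto
      show "{to_ac r} \<subseteq> galois_orbit (to_ac r)"
        using galois_orbitI[OF identity_in_absolute_galois] by blast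
    qed
    then have "inj_on (galois_orbit :: 'k alg_closure \<Rightarrow> _) (to_ac ` I)" by (auto simp: inj_on_def)
    ultimately show ?thesis unfolding delta_eq by (simp add: card_image injI)
  qed
  finally show ?thesis .
qed

end

text \<open>
  A root of \<open>B\<close> outside \<open>k\<close> is one of two conjugate roots, which the conjugation of \<open>k(\<theta>\<^sub>1)\<close> exchanges. It is
  obtained by negating \<open>\<theta>\<^sub>1 - \<theta>\<^sub>2\<close>, whose square lies in \<open>k\<close>.
\<close>

lemma quadratic_roots:
  assumes root: "poly BO \<theta>1 = 0" and irr: "\<theta>1 \<notin> range to_ac"
  shows "\<exists>\<theta>2 t \<sigma>. \<theta>1 + \<theta>2 = to_ac t \<and> \<theta>1 \<noteq> \<theta>2 \<and> {x. poly BO x = 0} = {\<theta>1, \<theta>2} \<and>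
     \<sigma> \<in> absolute_galois \<and> \<sigma> \<theta>1 = \<theta>2 \<and> \<sigma> \<theta>2 = \<theta>1 \<and>
     adjoin \<theta>1 \<subseteq> {to_ac u + to_ac v * \<theta>1 | u v. True}"
proof -
  define b0 b1 b2 where "b0 = coeff B 0" and "b1 = coeff B 1" and "b2 = coeff B 2"
  have B: "B = [:b0, b1, b2:]"
  proof (rule poly_eqI)
    fix i :: nat
    consider "i = 0" | "i = 1" | "i = 2" | "i > 2" by linarith
    then show "coeff B i = coeff [:b0, b1, b2:] i"
    proof cases
      case 4
      then obtain j where "i = Suc (Suc (Suc j))" by (intro that[of "i - 3"]) simp
      moreover have "coeff B i = 0" using 4 degree_B0 by (intro coeff_eq_0) simp
      ultimately show ?thesis by simp
    qed (simp_all add: b0_def b1_def b2_def numeral_2_eq_2)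
  qed
  have BO_eval: "poly BO x = to_ac b0 + to_ac b1 * x + to_ac b2 * x\<^sup>2" for x
    unfolding B by (simp add: power2_eq_square algebra_simps)
  have b2: "b2 \<noteq> 0"
  proof
    assume b2: "b2 = 0"
    have eq: "to_ac b0 + to_ac b1 * \<theta>1 = 0" using root unfolding BO_eval b2 by simp
    show False
    proof (cases "b1 = 0")
      case True
      then show False using eq B0_nonzero b2 B by simp
    next
      case False
      then have "\<theta>1 = to_ac (- b0 / b1)" using eq by (simp add: field_simps eq_neg_iff_add_eq_0)
      then show False using irr by blast
    qed
  qed
  define t where "t = - b1 / b2"
  define \<theta>2 where "\<theta>2 = to_ac t - \<theta>1"
  have b1: "to_ac b1 = - to_ac b2 * to_ac t" using b2 by (simp add: t_def)
  have sq1: "\<theta>1\<^sup>2 = to_ac t * \<theta>1 - to_ac (b0 / b2)"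
  proof -
    have "to_ac b2 * (\<theta>1\<^sup>2 - to_ac t * \<theta>1 + to_ac (b0 / b2)) = 0"
      using root b2 unfolding BO_eval b1 by (simp add: algebra_simps)
    then have "\<theta>1\<^sup>2 - to_ac t * \<theta>1 + to_ac (b0 / b2) = 0" using b2 by simp
    then show ?thesis by (simp add: algebra_simps eq_neg_iff_add_eq_0 del: to_ac_divide) 
  qed
  have fac: "poly BO x = to_ac b2 * ((x - \<theta>1) * (x - \<theta>2))" for x
  proof -
    have "poly BO x = poly BO x - poly BO \<theta>1" using root by simp
    also have "\<dots> = to_ac b2 * ((x - \<theta>1) * (x - \<theta>2))"
      unfolding BO_eval b1 \<theta>2_def by (simp add: power2_eq_square algebra_simps)
    finally show ?thesis .
  qed
  have roots: "{x. poly BO x = 0} = {\<theta>1, \<theta>2}" unfolding fac using b2 by auto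
  have F: "intermediate (range to_ac :: 'k alg_closure set)"
    unfolding adjoin_to_ac[of 0, symmetric] by (rule adjoin_properties)
  define d where "d = \<theta>1 - \<theta>2"
  have d: "d = 2 * \<theta>1 - to_ac t" by (simp add: d_def \<theta>2_def)
  have dirr: "d \<notin> range to_ac"
  proof
    assume "d \<in> range to_ac"
    then obtain c where c: "d = to_ac c" by blast
    have "2 * \<theta>1 = to_ac c + to_ac t" unfolding c[symmetric] d by simp
    then have "2 * \<theta>1 = 2 * to_ac ((c + t) / 2)" by simp
    then have "\<theta>1 = to_ac ((c + t) / 2)" by (simp only: mult_cancel_left) simp
    then show False using irr by blast
  qed
  have "d\<^sup>2 = to_ac (t\<^sup>2 - 4 * (b0 / b2))"
  proof -
    have "d\<^sup>2 = 4 * \<theta>1\<^sup>2 - 4 * to_ac t * \<theta>1 + (to_ac t)\<^sup>2" by (simp add: d power2_eq_square algebra_simps)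
    then show ?thesis unfolding sq1 by (simp add: algebra_simps)
  qed
  then have "d\<^sup>2 \<in> range to_ac" by blast
  from quadratic_conjugation[OF F dirr this] obtain \<sigma> where
    \<sigma>: "\<sigma> \<in> absolute_galois" "\<And>c. \<sigma> (to_ac c) = to_ac c" "\<sigma> d = - d" by blast
  interpret s: ring_morphism \<sigma> by (rule absolute_galoisD(1)[OF \<sigma>(1)])
  have "2 * \<sigma> \<theta>1 = \<sigma> (d + to_ac t)" by (simp add: d)
  also have "\<dots> = 2 * \<theta>2" unfolding s.h_add \<sigma>(2,3) by (simp add: d \<theta>2_def)
  finally have s1: "\<sigma> \<theta>1 = \<theta>2" by simp
  have s2: "\<sigma> \<theta>2 = \<theta>1" unfolding \<theta>2_def s.h_diff \<sigma>(2) s1 by (simp add: \<theta>2_def)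
  have "\<theta>1 \<noteq> \<theta>2"
  proof
    assume "\<theta>1 = \<theta>2"
    then have "d = to_ac 0" by (simp add: d_def)
    then show False using dirr by blast
  qed
  moreover have "adjoin \<theta>1 \<subseteq> {to_ac u + to_ac v * \<theta>1 | u v. True}" (is "_ \<subseteq> ?K")
  proof (rule adjoin_subset)
    have K: "to_ac u + to_ac v * \<theta>1 \<in> ?K" for u v by blast
    show "intermediate ?K"
      unfolding intermediate_def
    proof (intro conjI ballI)
      show "range to_ac \<subseteq> ?K" using K[of _ 0] by auto
      fix x y assume "x \<in> ?K" "y \<in> ?K"
      then obtain u v u' v' where xy: "x = to_ac u + to_ac v * \<theta>1" "y = to_ac u' + to_ac v' * \<theta>1" by blast
      have "x + y = to_ac (u + u') + to_ac (v + v') * \<theta>1" by (simp add: xy algebra_simps)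
      then show "x + y \<in> ?K" using K by metis
      have "x * y = to_ac u * to_ac u' + (to_ac u * to_ac v' + to_ac v * to_ac u') * \<theta>1
          + to_ac v * to_ac v' * \<theta>1\<^sup>2" by (simp add: xy algebra_simps power2_eq_square)
      also have "\<dots> = to_ac (u * u' - v * v' * (b0 / b2)) + to_ac (u * v' + v * u' + v * v' * t) * \<theta>1"
        unfolding sq1 by (simp add: algebra_simps)
      finally show "x * y \<in> ?K" using K by metis
    qed
    show "\<theta>1 \<in> ?K" using K[of 0 1] by simp
  qed
  ultimately show ?thesis using roots \<sigma>(1) s1 s2
    by (intro exI[of _ \<theta>2] exI[of _ t] exI[of _ \<sigma>]) (simp add: \<theta>2_def)
qed

text \<open>
  If \<open>C(\<theta>\<^sub>1) = (u + v \<theta>\<^sub>1)\<^sup>2\<close> with \<open>u\<close>, \<open>v\<close> in \<open>k\<close>, then the points \<open>(\<theta>\<^sub>i, u + v \<theta>\<^sub>i)\<close> are conjugate and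
  lie on the line \<open>y = u + v x\<close> over \<open>k\<close>. So their sum \<open>Q\<close>, the negative of the third point on this
  line, is defined over \<open>k(T)\<close>. The two coefficients of a point over \<open>k(T)\<close> agree, as the conjugation exchanges the
  two points; so \<open>Q\<close> spans up to torsion.
\<close>

lemma rank_conjugate_squares:
  assumes root: "\<theta>1 \<in> vertical" and irr: "\<theta>1 \<notin> range to_ac"
    and sq0: "\<And>\<theta>. (sq0 \<theta>)\<^sup>2 = poly CO \<theta>" and good: "sq0 \<theta>1 \<in> adjoin \<theta>1"
  shows "group_rank base.EE = enat (delta 0 B C)"
proof -
  have "poly BO \<theta>1 = 0" using root by (simp add: vertical_def)
  from quadratic_roots[OF this irr] obtain \<theta>2 t \<sigma> where
    t: "\<theta>1 + \<theta>2 = to_ac t" and ne: "\<theta>1 \<noteq> \<theta>2" and roots: "{x. poly BO x = 0} = {\<theta>1, \<theta>2}"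
    and \<sigma>: "\<sigma> \<in> absolute_galois" "\<sigma> \<theta>1 = \<theta>2" "\<sigma> \<theta>2 = \<theta>1"
    and adj: "adjoin \<theta>1 \<subseteq> {to_ac u + to_ac v * \<theta>1 | u v. True}" by blast
  from good adj obtain u v where uv: "sq0 \<theta>1 = to_ac u + to_ac v * \<theta>1" by blast
  interpret s: field_morphism \<sigma> using absolute_galoisD(1)[OF \<sigma>(1)] by (rule field_morphism.intro)
  \<comment> \<open>The square root at \<open>\<theta>2\<close> is chosen conjugate to the one at \<open>\<theta>1\<close>.\<close>
  define sq where "sq = sq0(\<theta>2 := to_ac u + to_ac v * \<theta>2)"
  have C2: "poly CO \<theta>2 = (to_ac u + to_ac v * \<theta>2)\<^sup>2"
  proof -
    have "poly CO \<theta>2 = \<sigma> (poly CO \<theta>1)" using act_properties(5)[OF \<sigma>(1), of \<theta>1] \<sigma>(2) by simp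
    also have "\<dots> = (\<sigma> (to_ac u + to_ac v * \<theta>1))\<^sup>2" unfolding sq0[symmetric] uv by simp
    also have "\<dots> = (to_ac u + to_ac v * \<theta>2)\<^sup>2" by (simp add: absolute_galoisD(2)[OF \<sigma>(1)] \<sigma>(2))
    finally show ?thesis .
  qed
  have sq: "(sq \<theta>)\<^sup>2 = poly CO \<theta>" for \<theta> using sq0 C2 by (simp add: sq_def)
  have sq12: "sq \<theta> = to_ac u + to_ac v * \<theta>" if "\<theta> \<in> {\<theta>1, \<theta>2}" for \<theta>
    using that ne uv by (auto simp: sq_def)
  have "poly CO \<theta>2 \<noteq> 0"
    using act_properties(5)[OF \<sigma>(1), of \<theta>1] \<sigma>(2) root by (simp add: vertical_def)
  then have vert: "vertical = {\<theta>1, \<theta>2}" using roots root by (auto simp: vertical_def)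
  have fix_ac: "\<sigma> (to_ac c) = to_ac c" for c by (rule absolute_galoisD(2)[OF \<sigma>(1)])
  let ?V = "VP sq"
  have Vc: "?V \<in> vertical \<rightarrow> carrier EE" by (rule VP_carrier[OF sq])
  \<comment> \<open>The line through the two points has slope \<open>v\<close>, and their abscissae add up to \<open>t\<close>.\<close>
  define x3 where "x3 = ((cst v)\<^sup>2 - coeff f 2) / coeff f 3 - cst t"
  define Q where "Q = Affine x3 (- (cst u + cst v * x3))"
  have F_coeff: "coeff F i = ac.base_change (coeff f i)" for i
    unfolding ac.map_generic_cubic[symmetric] by (simp add: coeff_map_poly)
  have psiQ: "psi Q = ?V \<theta>1 \<otimes>\<^bsub>EE\<^esub> ?V \<theta>2"
  proof -
    define y where "y = ac.base_change x3"
    have y: "y = ((cst (to_ac v))\<^sup>2 - coeff F 2) / coeff F 3 - cst \<theta>1 - cst \<theta>2"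
    proof -
      have "cst \<theta>1 + cst \<theta>2 = cst (to_ac t)" by (simp flip: t)
      then show ?thesis unfolding y_def x3_def F_coeff by (simp add: algebra_simps)
    qed
    have m: "(cst (sq \<theta>2) - cst (sq \<theta>1)) / (cst \<theta>2 - cst \<theta>1) = cst (to_ac v)"
    proof -
      have "cst (sq \<theta>2) - cst (sq \<theta>1) = cst (to_ac v) * (cst \<theta>2 - cst \<theta>1)"
        by (simp add: sq12 algebra_simps)
      then show ?thesis using ne by simp
    qed
    have "?V \<theta>1 \<otimes>\<^bsub>EE\<^esub> ?V \<theta>2 = Affine y (- (cst (sq \<theta>1) + cst (to_ac v) * (y - cst \<theta>1)))"
      unfolding VP_def[OF sq] using ne by (simp add: m Let_def) (simp add: y)
    also have "cst (sq \<theta>1) + cst (to_ac v) * (y - cst \<theta>1) = cst (to_ac u) + cst (to_ac v) * y"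
      by (simp add: sq12 algebra_simps)
    also have "Affine y (- \<dots>) = psi Q" by (simp add: Q_def y_def)
    finally show ?thesis ..
  qed
  have V12: "?V \<theta>1 \<in> carrier EE" "?V \<theta>2 \<in> carrier EE" using Vc vert by auto
  have "on_curve F (psi Q)" unfolding psiQ using EE.m_closed[OF V12] by simp
  then have Qc: "Q \<in> carrier base.EE" by simp
  have psiQ1: "psi Q = EE.combination vertical ?V (\<lambda>_. 1)"
  proof -
    have "EE.combination vertical ?V (\<lambda>_. 1) = (\<Otimes>\<^bsub>EE\<^esub>\<theta>\<in>{\<theta>1, \<theta>2}. ?V \<theta>)"
      unfolding EE.combination_def vert using V12 by (intro EE.finprod_cong') (auto simp: EE.int_pow_1 simp del: carrier_EE)
    also have "\<dots> = ?V \<theta>1 \<otimes>\<^bsub>EE\<^esub> ?V \<theta>2"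
      using V12 ne EE.finprod_insert[of "{\<theta>2}" \<theta>1 ?V] EE.finprod_insert[of "{}" \<theta>2 ?V] EE.r_one[OF V12(2)]
      by (simp del: carrier_EE mult_EE one_EE)
    finally show ?thesis using psiQ by simp
  qed
  have psiQk: "psi (Q [^]\<^bsub>base.EE\<^esub> k) = EE.combination vertical ?V (\<lambda>_. k)" for k :: int
  proof -
    have "psi (Q [^]\<^bsub>base.EE\<^esub> k) = psi Q [^]\<^bsub>EE\<^esub> k"
      by (rule hom_int_pow[OF psi_hom Qc E0.is_group EE.is_group])
    then show ?thesis unfolding psiQ1 EE.combination_int_pow[OF Vc] by simp
  qed
  have E0_comb: "E0.combination {()} (\<lambda>_. Q) n = Q [^]\<^bsub>base.EE\<^esub> n ()" for n
    unfolding E0.combination_def using Qc by (simp del: base.carrier_EE base.mult_EE base.one_EE)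
  have "group_rank base.EE = enat (card {()})"
  proof (rule E0.group_rank_eq_card)
    show "(\<lambda>_. Q) \<in> {()} \<rightarrow> carrier base.EE" using Qc by simp
  next
    fix n :: "unit \<Rightarrow> int" assume "E0.combination {()} (\<lambda>_. Q) n = \<one>\<^bsub>base.EE\<^esub>"
    then have "EE.combination vertical ?V (\<lambda>_. n ()) = Infinity"
      unfolding psiQk[symmetric] E0_comb by simp
    then have "n () = 0" using VP_independent[OF sq] root by blast
    then show "\<forall>i\<in>{()}. n i = 0" by simp
  next
    fix P assume "P \<in> carrier base.EE"
    from span_over_base[OF sq this] obtain e :: nat and n where
      e: "e > 0" "psi (P [^]\<^bsub>base.EE\<^esub> e) = EE.combination vertical ?V n" by blast
    have inv: "\<sigma> ` vertical = vertical" "inj_on \<sigma> vertical" "\<And>\<theta>. \<theta> \<in> vertical \<Longrightarrow> \<sigma> (\<sigma> \<theta>) = \<theta>"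
      using \<sigma> vert by (auto simp: inj_on_def)
    have "EE.combination vertical ?V n = act \<sigma> (EE.combination vertical ?V n)"
      unfolding e(2)[symmetric] act_properties(2)[OF \<sigma>(1)] ..
    also have "\<dots> = EE.combination vertical (act \<sigma> \<circ> ?V) n"
      by (rule hom_combination[OF comm_group_EE comm_group_EE act_properties(1)[OF \<sigma>(1)] finite_vertical Vc])
    also have "\<dots> = EE.combination vertical (?V \<circ> \<sigma>) ((n \<circ> \<sigma>) \<circ> \<sigma>)"
    proof (rule EE.combination_cong)
      show "?V \<circ> \<sigma> \<in> vertical \<rightarrow> carrier EE" using Vc inv(1) by (auto simp: Pi_iff simp del: carrier_EE)
      fix \<theta> assume \<theta>: "\<theta> \<in> vertical"
      have "\<sigma> (sq \<theta>) = sq (\<sigma> \<theta>)" using \<theta> \<sigma> unfolding vert by (auto simp: sq12 fix_ac)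
      then show "(act \<sigma> \<circ> ?V) \<theta> = (?V \<circ> \<sigma>) \<theta>"
        unfolding o_def VP_def[OF sq] act_properties(3)[OF \<sigma>(1)] by simp
      show "n \<theta> = ((n \<circ> \<sigma>) \<circ> \<sigma>) \<theta>" using inv(3)[OF \<theta>] by simp
    qed
    also have "\<dots> = EE.combination vertical ?V (n \<circ> \<sigma>)"
      by (rule EE.combination_reindex[OF inv(2) finite_vertical _ Vc, symmetric]) (use inv(1) in auto)
    finally have "n \<theta>1 = (n \<circ> \<sigma>) \<theta>1" using root by (rule combination_unique[OF sq])
    then have "n \<theta>2 = n \<theta>1" using \<sigma>(2) by simp
    then have "EE.combination vertical ?V n = EE.combination vertical ?V (\<lambda>_. n \<theta>1)"
      using vert by (intro EE.combination_cong Vc) auto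
    then have "psi (P [^]\<^bsub>base.EE\<^esub> e) = psi (E0.combination {()} (\<lambda>_. Q) (\<lambda>_. n \<theta>1))"
      unfolding e(2) E0_comb psiQk .
    then show "\<exists>(e::nat) n. e > 0 \<and> P [^]\<^bsub>base.EE\<^esub> e = E0.combination {()} (\<lambda>_. Q) n"
      unfolding bc.map_point_eq_iff using e(1) by blast
  qed simp
  also have "card {()} = delta 0 B C"
  proof -
    have "sq \<theta> \<in> adjoin \<theta>" if "\<theta> \<in> vertical" for \<theta>
      using that sq12[of \<theta>] intermediateD(1,2,3)[OF adjoin_properties(1)[of \<theta>]] adjoin_properties(2)[of \<theta>]
      unfolding vert by simp
    then have "{\<theta> \<in> vertical. sq \<theta> \<in> adjoin \<theta>} = {\<theta>1, \<theta>2}" using vert by blast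
    moreover have "galois_orbit \<theta> = {\<theta>1, \<theta>2}" if \<theta>: "\<theta> \<in> {\<theta>1, \<theta>2}" for \<theta>
    proof
      show "galois_orbit \<theta> \<subseteq> {\<theta>1, \<theta>2}"
        unfolding galois_orbit_def roots[symmetric] using act_properties(4) \<theta> roots by blast
      have "\<theta> \<in> galois_orbit \<theta>" "\<sigma> \<theta> \<in> galois_orbit \<theta>"
        using galois_orbitI[OF identity_in_absolute_galois] galois_orbitI[OF \<sigma>(1)] by blast+
      then show "{\<theta>1, \<theta>2} \<subseteq> galois_orbit \<theta>" using \<theta> \<sigma>(2,3) by auto
    qed
    then have "galois_orbit ` {\<theta>1, \<theta>2} = {{\<theta>1, \<theta>2}}" by auto
    ultimately show ?thesis unfolding delta_eq[OF sq] by simp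
  qed
  finally show ?thesis .
qed

theorem rank_eq_delta: "group_rank base.EE = enat (delta 0 B C)"
proof -
  have "\<forall>\<theta>. \<exists>s. s\<^sup>2 = poly CO \<theta>" using nth_root_exists[of 2] by auto
  then obtain sq where sq: "\<And>\<theta>. (sq \<theta>)\<^sup>2 = poly CO \<theta>" by metis
  consider "\<And>\<theta>. poly BO \<theta> = 0 \<Longrightarrow> \<theta> \<in> range to_ac"
    | \<theta>1 where "poly BO \<theta>1 = 0" "\<theta>1 \<notin> range to_ac" by blast
  then show ?thesis
  proof cases
    case 1
    then show ?thesis by (rule rank_rational_roots[OF sq])
  next
    case 2
    from quadratic_roots[OF this] obtain \<theta>2 t where
      t: "\<theta>1 + \<theta>2 = to_ac t" and roots: "{x. poly BO x = 0} = {\<theta>1, \<theta>2}" by blast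
    have "\<theta>2 \<notin> range to_ac"
    proof
      assume "\<theta>2 \<in> range to_ac"
      then obtain c where "\<theta>2 = to_ac c" by blast
      then have "\<theta>1 = to_ac (t - c)" using t by (simp add: eq_diff_eq)
      then show False using 2(2) by blast
    qed
    then have irr: "\<theta> \<notin> range to_ac" if "\<theta> \<in> vertical" for \<theta>
    proof -
      have "\<theta> \<in> {x. poly BO x = 0}" using that by (simp add: vertical_def)
      then show ?thesis unfolding roots using 2(2) \<open>\<theta>2 \<notin> range to_ac\<close> by auto
    qed
    show ?thesis
    proof (cases "\<exists>\<theta>\<in>vertical. sq \<theta> \<in> adjoin \<theta>")
      case True
      then show ?thesis using rank_conjugate_squares[OF _ irr sq] by blast
    next
      case False
      have "vertical \<subseteq> adjoin \<theta>" if \<theta>: "\<theta> \<in> vertical" for \<theta>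
      proof
        fix \<theta>' assume "\<theta>' \<in> vertical"
        then have "\<theta> \<in> {x. poly BO x = 0}" "\<theta>' \<in> {x. poly BO x = 0}"
          using \<theta> by (simp_all add: vertical_def)
        then have "\<theta>' = \<theta> \<or> \<theta>' = to_ac t - \<theta>"
          unfolding roots using t by (auto simp: eq_diff_eq add.commute)
        then show "\<theta>' \<in> adjoin \<theta>"
          using intermediateD(1,5)[OF adjoin_properties(1)[of \<theta>]] adjoin_properties(2)[of \<theta>] by auto
      qed
      then show ?thesis using False by (intro rank_zero[OF sq]) blast+
    qed
  qed
qed

end

theorem proposition6p5:
  fixes B C :: "'k::number_field poly"
  assumes "Polynomial.degree B \<le> 2" and "Polynomial.degree C = 3"
    and "standing_assumptions 0 B C"
    and "Delta_conic 0 B C \<noteq> 0"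
  shows "curve_rank 0 B C = enat (delta 0 B C)"
proof -
  interpret descent B C
    using assms by unfold_locales (auto simp: standing_assumptions_def Delta_conic_def)
  show ?thesis unfolding curve_rank_def by (rule rank_eq_delta)
qed

end
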